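(* Let $p>q\ge 0$ and $d\ge1$ be integers, and let $Y=(Y_t)_{t\in\mathbb{R}}$ be the $d$-dimensional MCARMA process with autoregressive polynomial $P(z)=I_dz^p+A_1z^{p-1}+\dots+A_p$ and moving average polynomial $Q(z)=B_0z^q+\dots+B_q$, where all zeros $\lambda_1,\dots,\lambda_{pd}$ (listed with multiplicity, not necessarily different) of $\det P$ have negative real part. For $\Delta>0$ put $Y_n^\Delta=Y_{n\Delta}$ and $\Phi^\Delta(z)=\prod_{i=1}^{pd}(1-e^{\Delta\lambda_i}z)$, and consider the filtered process $X^\Delta_n=\Phi^\Delta(B)Y^\Delta_n$, $n\in\mathbb{Z}$, where $B$ is the backshift operator. Then for any $\Delta>0$ the filtered process $X^\Delta$ is a $d$-dimensional moving average process of order less than $pd$; i.e., there exist a ($d\times d$) matrix polynomial $\Psi^\Delta$ of degree less than $pd$ and a ($d$-dimensional) white noise sequence $Z^\Delta$ such that $$X^\Delta_n=\Phi^\Delta(B)Y^\Delta_n=\Psi^\Delta(B)Z^\Delta_n,\qquad n\in\mathbb{Z}.$$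
   Context: $A_i,B_j$ are real $d\times d$ matrices; $I_d$ is the identity matrix; $\mathfrak{i}$ is the imaginary unit. Driving process: $L=(L_t)_{t\in\mathbb{R}}$ is a two-sided $d$-dimensional Lévy process, $L_t=L_1(t)$ for $t\ge0$, $L_t=-L_2(-t-)$ for $t<0$, with $L_1,L_2$ i.i.d. one-sided Lévy processes, $\mathbf{E}L_1(1)=0$, $\mathbf{E}\|L_1(1)\|^2<\infty$; $\Sigma_L$ is the covariance matrix of $L_1(1)$. MCARMA process: $Y_t=\int_{-\infty}^t g(t-s)\,\mathrm{d}L_s$ (in the $L^2$ sense), with $g(t)=\frac1{2\pi}\int_{-\infty}^{\infty}e^{\mathfrak{i}tx}P(\mathfrak{i}x)^{-1}Q(\mathfrak{i}x)\,\mathrm{d}x$ (inverse Fourier transform in the $L^2$ sense; $g$ vanishes on the negative half-line). Backshift operator: $BV_n=V_{n-1}$. White noise: a zero-mean, uncorrelated sequence of random vectors with finite second moments and a common covariance matrix. *)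

theory Defs
  imports
    "HOL-Probability.Probability"
    "HOL-Computational_Algebra.Fundamental_Theorem_Algebra"
begin

section \<open>Matrix polynomials\<close>

definition ar_poly :: "nat \<Rightarrow> (nat \<Rightarrow> real^'d^'d) \<Rightarrow> (real^'d^'d) poly" where
  "ar_poly p A = monom (mat 1) p + (\<Sum>k=1..p. monom (A k) (p - k))"

definition ma_poly :: "nat \<Rightarrow> (nat \<Rightarrow> real^'d^'d) \<Rightarrow> (real^'d^'d) poly" where
  "ma_poly q B = (\<Sum>k\<le>q. monom (B k) (q - k))"

text \<open>
  The product that the library puts on \<^typ>\<open>real^'d^'d\<close> is the entrywise one, so evaluation and
  determinants of matrix polynomials go through the matrix of their entries.
\<close>

definition poly_entries :: "(real^'d^'d) poly \<Rightarrow> complex poly^'d^'d" where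
  "poly_entries R = (\<chi> i j. map_poly (\<lambda>C. complex_of_real (C $ i $ j)) R)"

definition mpoly_eval :: "(real^'d^'d) poly \<Rightarrow> complex \<Rightarrow> complex^'d^'d" where
  "mpoly_eval R z = (\<chi> i j. poly (poly_entries R $ i $ j) z)"


section \<open>Polynomials in the backshift operator\<close>

definition backshift :: "(int \<Rightarrow> 'a) \<Rightarrow> int \<Rightarrow> 'a" where
  "backshift V n = V (n - 1)"

definition scalar_filter ::
    "real poly \<Rightarrow> (int \<Rightarrow> 'w \<Rightarrow> real^'d) \<Rightarrow> int \<Rightarrow> 'w \<Rightarrow> real^'d" where
  "scalar_filter \<phi> V n \<omega> = (\<Sum>k\<le>degree \<phi>. coeff \<phi> k *\<^sub>R (backshift ^^ k) V n \<omega>)"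

definition matrix_filter ::
    "(real^'d^'d) poly \<Rightarrow> (int \<Rightarrow> 'w \<Rightarrow> real^'d) \<Rightarrow> int \<Rightarrow> 'w \<Rightarrow> real^'d" where
  "matrix_filter \<Psi> V n \<omega> = (\<Sum>k\<le>degree \<Psi>. coeff \<Psi> k *v (backshift ^^ k) V n \<omega>)"

text \<open>
  The zeros of a real polynomial come in conjugate pairs, so the product below has real
  coefficients and taking real parts in \<open>filter_poly\<close> discards nothing: see
  \<open>of_real_filter_poly\<close>.
\<close>

definition complex_filter_poly :: "nat \<Rightarrow> (nat \<Rightarrow> complex) \<Rightarrow> real \<Rightarrow> complex poly" where
  "complex_filter_poly m lam \<Delta> = (\<Prod>i=1..m. [:1, - exp (complex_of_real \<Delta> * lam i):])"

definition filter_poly :: "nat \<Rightarrow> (nat \<Rightarrow> complex) \<Rightarrow> real \<Rightarrow> real poly" where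
  "filter_poly m lam \<Delta> = map_poly Re (complex_filter_poly m lam \<Delta>)"

lemma map_poly_cnj_det:
  "map_poly cnj (det (poly_entries R)) = det (poly_entries R)"
proof -
  have entry: "cnj (poly (poly_entries R $ i $ j) (cnj x)) = poly (poly_entries R $ i $ j) x"
    for i j x
    using poly_cnj_real[of "poly_entries R $ i $ j" "cnj x"]
    by (simp add: poly_entries_def coeff_map_poly)
  have "cnj (poly (det (poly_entries R)) (cnj x)) = poly (det (poly_entries R)) x" for x
    unfolding det_def by (simp add: poly_sum poly_prod entry)
  then show ?thesis
    by (simp add: poly_eq_poly_eq_iff[symmetric] fun_eq_iff)
qed

lemma order_cnj_le:
  assumes "map_poly cnj p = p" "p \<noteq> 0"
  shows "order a p \<le> order (cnj a) p"
proof -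
  obtain e where e: "p = [:-a, 1:] ^ order a p * e"
    using order_1 dvdE by metis
  have "p = [:- cnj a, 1:] ^ order a p * map_poly cnj e"
  proof -
    have "poly p x = poly ([:- cnj a, 1:] ^ order a p * map_poly cnj e) x" for x
    proof -
      have "poly p x = cnj (poly p (cnj x))"
        by (metis assms(1) poly_map_poly_cnj)
      also have "\<dots> = cnj (poly ([:-a, 1:] ^ order a p * e) (cnj x))"
        using e by simp
      finally show ?thesis by simp
    qed
    then show ?thesis
      by (simp add: poly_eq_poly_eq_iff[symmetric] fun_eq_iff)
  qed
  then have "[:- cnj a, 1:] ^ order a p dvd p"
    by (metis dvd_triv_left)
  then show ?thesis
    using assms(2) by (metis order_divides)
qed

lemma image_mset_cnj_proots:
  assumes "map_poly cnj p = p"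
  shows "image_mset cnj (proots p) = proots p"
proof (cases "p = 0")
  case False
  have ord: "order (cnj a) p = order a p" for a
    using order_cnj_le[OF assms False, of a] order_cnj_le[OF assms False, of "cnj a"] by simp
  have vim: "cnj -` {a} = {cnj a}" for a
    by force
  show ?thesis
  proof (rule multiset_eqI)
    fix a
    have "count (image_mset cnj (proots p)) a
        = (\<Sum>y\<in>cnj -` {a} \<inter> set_mset (proots p). count (proots p) y)"
      by (simp add: count_image_mset)
    also have "\<dots> = count (proots p) (cnj a)"
      unfolding vim by (cases "cnj a \<in># proots p") (auto simp: not_in_iff)
    also have "\<dots> = count (proots p) a"
      using False ord by simp
    finally show "count (image_mset cnj (proots p)) a = count (proots p) a" .
  qed
qed simp

lemma of_real_filter_poly:
  assumes zeros: "{#lam i. i \<in># mset_set {1..m}#} = proots (det (poly_entries R))"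
  shows "map_poly complex_of_real (filter_poly m lam \<Delta>) = complex_filter_poly m lam \<Delta>"
proof -
  let ?S = "proots (det (poly_entries R))" and ?W = "complex_filter_poly m lam \<Delta>"
  let ?f = "\<lambda>x l. 1 - exp (complex_of_real \<Delta> * l) * x"
  have sym: "image_mset cnj ?S = ?S"
    by (rule image_mset_cnj_proots[OF map_poly_cnj_det])
  have W: "poly ?W x = (\<Prod>l\<in>#?S. ?f x l)" for x
    unfolding complex_filter_poly_def zeros[symmetric]
    by (simp add: poly_prod poly_prod_mset image_mset.compositionality o_def prod_unfold_prod_mset
        mult.commute)
  have c: "cnj (\<Prod>l\<in>#T. ?f (cnj x) l) = (\<Prod>l\<in>#image_mset cnj T. ?f x l)" for x T
    by (induction T) (simp_all add: exp_cnj)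
  have "poly (map_poly cnj ?W) x = poly ?W x" for x
    using c[of x ?S] by (simp add: W sym)
  then have "map_poly cnj ?W = ?W"
    by (simp add: poly_eq_poly_eq_iff[symmetric] fun_eq_iff)
  then have "cnj (coeff ?W k) = coeff ?W k" for k
    by (metis coeff_map_poly complex_cnj_zero)
  then have "coeff ?W k \<in> \<real>" for k
    by (simp add: Reals_cnj_iff)
  then show ?thesis
    by (intro poly_eqI) (simp add: filter_poly_def coeff_map_poly)
qed


section \<open>Levy processes\<close>

definition levy_process :: "'w measure \<Rightarrow> (real \<Rightarrow> 'w \<Rightarrow> real^'d) \<Rightarrow> bool" where
  "levy_process M X \<longleftrightarrow>
     (\<forall>t\<ge>0. X t \<in> borel_measurable M) \<and>
     (AE \<omega> in M. X 0 \<omega> = 0) \<and>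
     (\<forall>n (t :: nat \<Rightarrow> real). 0 \<le> t 0 \<longrightarrow> (\<forall>k<n. t k \<le> t (Suc k)) \<longrightarrow>
        prob_space.indep_vars M (\<lambda>_. borel) (\<lambda>k \<omega>. X (t (Suc k)) \<omega> - X (t k) \<omega>) {..<n}) \<and>
     (\<forall>s\<ge>0. \<forall>h\<ge>0. distr M borel (\<lambda>\<omega>. X (s + h) \<omega> - X s \<omega>) = distr M borel (X h)) \<and>
     (\<forall>t\<ge>0. \<forall>\<epsilon>>0.
        ((\<lambda>s. measure M {\<omega>\<in>space M. norm (X s \<omega> - X t \<omega>) > \<epsilon>}) \<longlongrightarrow> 0) (at t within {0..})) \<and>
     (AE \<omega> in M. (\<forall>t\<ge>0. ((\<lambda>s. X s \<omega>) \<longlongrightarrow> X t \<omega>) (at_right t)) \<and>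
                  (\<forall>t>0. \<exists>l. ((\<lambda>s. X s \<omega>) \<longlongrightarrow> l) (at_left t)))"

text \<open>
  For \<open>t < 0\<close> the left limit \<open>- L2 (-t-)\<close> only exists almost surely, hence the \<open>AE\<close> and the
  separate measurability requirement on \<open>L\<close>.
\<close>

definition two_sided_levy ::
    "'w measure \<Rightarrow> (real \<Rightarrow> 'w \<Rightarrow> real^'d) \<Rightarrow> (real \<Rightarrow> 'w \<Rightarrow> real^'d) \<Rightarrow> (real \<Rightarrow> 'w \<Rightarrow> real^'d) \<Rightarrow> bool"
  where
  "two_sided_levy M L1 L2 L \<longleftrightarrow>
     levy_process M L1 \<and> levy_process M L2 \<and>
     prob_space.indep_var M
       (\<Pi>\<^sub>M t\<in>{0..}. borel) (\<lambda>\<omega>. \<lambda>t\<in>{0..}. L1 t \<omega>)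
       (\<Pi>\<^sub>M t\<in>{0..}. borel) (\<lambda>\<omega>. \<lambda>t\<in>{0..}. L2 t \<omega>) \<and>
     distr M (\<Pi>\<^sub>M t\<in>{0..}. borel) (\<lambda>\<omega>. \<lambda>t\<in>{0..}. L1 t \<omega>) =
       distr M (\<Pi>\<^sub>M t\<in>{0..}. borel) (\<lambda>\<omega>. \<lambda>t\<in>{0..}. L2 t \<omega>) \<and>
     (\<forall>t. L t \<in> borel_measurable M) \<and>
     (\<forall>t\<ge>0. \<forall>\<omega>\<in>space M. L t \<omega> = L1 t \<omega>) \<and>
     (AE \<omega> in M. \<forall>t<0. ((\<lambda>s. L2 s \<omega>) \<longlongrightarrow> - L t \<omega>) (at_left (- t)))"


section \<open>Integrals of deterministic functions\<close>

text \<open>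
  A list of triples \<open>(F, a, b)\<close> with \<open>a \<le> b\<close> encodes the step function with values \<open>F\<close> on
  \<open>{a<..b}\<close>, summed over the list.
\<close>

type_synonym 'd step = "((real^'d^'d) \<times> real \<times> real) list"

definition step_fun :: "'d::finite step \<Rightarrow> real \<Rightarrow> real^'d^'d" where
  "step_fun ks s = (\<Sum>(F, a, b)\<leftarrow>ks. indicator {a<..b} s *\<^sub>R F)"

definition step_integral ::
    "(real \<Rightarrow> 'w \<Rightarrow> real^'d) \<Rightarrow> 'd::finite step \<Rightarrow> 'w \<Rightarrow> real^'d" where
  "step_integral L ks \<omega> = (\<Sum>(F, a, b)\<leftarrow>ks. F *v (L b \<omega> - L a \<omega>))"

definition has_L2_integral ::
    "'w measure \<Rightarrow> (real \<Rightarrow> 'w \<Rightarrow> real^'d) \<Rightarrow> (real \<Rightarrow> real^'d^'d) \<Rightarrow> ('w \<Rightarrow> real^'d::finite) \<Rightarrow> bool"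
  where
  "has_L2_integral M L f I \<longleftrightarrow>
     f \<in> borel_measurable borel \<and> I \<in> borel_measurable M \<and>
     (\<exists>ks :: nat \<Rightarrow> 'd step.
        (\<forall>n. \<forall>(F, a, b)\<in>set (ks n). a \<le> b) \<and>
        (\<lambda>n. \<integral>\<^sup>+s. ennreal ((norm (step_fun (ks n) s - f s))\<^sup>2) \<partial>lborel) \<longlonglongrightarrow> 0 \<and>
        (\<lambda>n. \<integral>\<^sup>+\<omega>. ennreal ((norm (step_integral L (ks n) \<omega> - I \<omega>))\<^sup>2) \<partial>M) \<longlonglongrightarrow> 0)"

text \<open>The limit in mean of the truncated inverse Fourier integrals.\<close>

definition has_L2_inverse_fourier :: "(real \<Rightarrow> complex) \<Rightarrow> (real \<Rightarrow> complex) \<Rightarrow> bool" where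
  "has_L2_inverse_fourier F g \<longleftrightarrow>
     F \<in> borel_measurable borel \<and> (\<integral>\<^sup>+x. ennreal ((norm (F x))\<^sup>2) \<partial>lborel) < \<infinity> \<and>
     g \<in> borel_measurable borel \<and>
     ((\<lambda>R. \<integral>\<^sup>+t. ennreal ((norm (complex_of_real (1 / (2 * pi)) *
            (\<integral>x\<in>{-R..R}. exp (\<i> * complex_of_real (t * x)) * F x \<partial>lborel) - g t))\<^sup>2) \<partial>lborel)
        \<longlongrightarrow> 0) at_top"


section \<open>MCARMA processes and white noise\<close>

definition mcarma_kernel ::
    "(real^'d^'d) poly \<Rightarrow> (real^'d^'d) poly \<Rightarrow> (real \<Rightarrow> real^'d^'d) \<Rightarrow> bool" where
  "mcarma_kernel P Q g \<longleftrightarrow>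
     (\<forall>i j. has_L2_inverse_fourier
        (\<lambda>x. (matrix_inv (mpoly_eval P (\<i> * complex_of_real x)) **
               mpoly_eval Q (\<i> * complex_of_real x)) $ i $ j)
        (\<lambda>t. complex_of_real (g t $ i $ j)))"

definition mcarma_process ::
    "'w measure \<Rightarrow> (real \<Rightarrow> 'w \<Rightarrow> real^'d) \<Rightarrow> (real^'d^'d) poly \<Rightarrow> (real^'d^'d) poly \<Rightarrow>
       (real \<Rightarrow> 'w \<Rightarrow> real^'d) \<Rightarrow> bool" where
  "mcarma_process M L P Q Y \<longleftrightarrow>
     (\<exists>g. mcarma_kernel P Q g \<and>
       (\<forall>t. has_L2_integral M L (\<lambda>s. indicator {..t} s *\<^sub>R g (t - s)) (Y t)))"

definition covariance_matrix ::
    "'w measure \<Rightarrow> ('w \<Rightarrow> real^'d) \<Rightarrow> ('w \<Rightarrow> real^'d) \<Rightarrow> real^'d^'d" where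
  "covariance_matrix M U V =
     (\<chi> i j. \<integral>\<omega>. (U \<omega> - (\<integral>\<omega>. U \<omega> \<partial>M)) $ i * (V \<omega> - (\<integral>\<omega>. V \<omega> \<partial>M)) $ j \<partial>M)"

definition white_noise :: "'w measure \<Rightarrow> (int \<Rightarrow> 'w \<Rightarrow> real^'d) \<Rightarrow> bool" where
  "white_noise M Z \<longleftrightarrow>
     (\<forall>n. Z n \<in> borel_measurable M \<and> integrable M (\<lambda>\<omega>. (norm (Z n \<omega>))\<^sup>2) \<and>
          (\<integral>\<omega>. Z n \<omega> \<partial>M) = 0) \<and>
     (\<forall>m n. m \<noteq> n \<longrightarrow> covariance_matrix M (Z m) (Z n) = 0) \<and>
     (\<exists>S. \<forall>n. covariance_matrix M (Z n) (Z n) = S)"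

end

theory Submission
  imports Defs "HOL-Complex_Analysis.Cauchy_Integral_Formula"
begin

text \<open>
  Write \<open>m = pd\<close>. On the Fourier side the filter multiplies the transform of the kernel \<open>g\<close> by
  \<open>\<Phi>(exp (-\<Delta> z))\<close>, whose zeros cancel the poles of \<open>P(z)\<^sup>-\<^sup>1 Q(z)\<close>. The integrand of the inverse
  transform is then entire, and for \<open>t > m\<Delta>\<close> its contour can be pushed to \<open>Re z = -\<infinity>\<close>; hence the
  filtered kernel vanishes almost everywhere outside \<open>[0, m\<Delta>]\<close>. By the isometry of the stochastic
  integral the filtered process is a stationary process whose autocovariance vanishes from lag \<open>m\<close> on.
  Its Wold innovations \<open>Z\<^sub>n\<close>, the residuals of projecting on the strict past, are a white noise, and since
  the process at time \<open>n\<close> is orthogonal to its past up to time \<open>n - m\<close>, it is a combination of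
  \<open>Z\<^sub>n, \<dots>, Z\<^sub>n\<^sub>-\<^sub>m\<^sub>+\<^sub>1\<close>.
\<close>

section \<open>Square integrable functions\<close>

text \<open>Cramer's rule writes every entry of \<open>P(z)^-1 Q(z)\<close> over the common
  denominator \<open>det P(z)\<close> of degree \<open>m\<close>, which is why a scalar filter of
  degree \<open>m\<close> suffices: the factor \<open>1 - exp (\<Delta> (\<lambda>_i - z))\<close>
  vanishes at \<open>z = \<lambda>_i\<close>, so zeros are cancelled one linear factor at a time,
  whatever their multiplicity. The numerators have smaller degree because \<open>q < p\<close>, but
  in general this gives decay of order \<open>1 / |z|\<close> only. The inverse transform is
  therefore a limit in mean, while the contour shift computes pointwise limits of truncated
  integrals; Fatou's lemma reconciles the two. The order stays below \<open>m\<close> because at lag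
  \<open>m\<close> the two shifted kernels live on intervals with one common point, a null set. The
  innovations are built as processes on the given probability space. Their covariance matrix may be
  singular, so the moving average coefficients come from a consistent linear system and not from an
  inverse matrix.\<close>

definition sq_integrable :: "'a measure \<Rightarrow> ('a \<Rightarrow> real) \<Rightarrow> bool" where
  "sq_integrable M f \<longleftrightarrow> f \<in> borel_measurable M \<and> integrable M (\<lambda>x. (f x)\<^sup>2)"

text \<open>Square integrability is part of the notion because the Bochner integral of a
  non-integrable function is 0, so the last conjunct alone could hold for the wrong reason.\<close>

definition tendsto_L2 :: "'a measure \<Rightarrow> (nat \<Rightarrow> 'a \<Rightarrow> real) \<Rightarrow> ('a \<Rightarrow> real) \<Rightarrow> bool" where
  "tendsto_L2 M f F \<longleftrightarrow> (\<forall>n. sq_integrable M (f n)) \<and> sq_integrable M F \<and>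
     (\<lambda>n. \<integral>x. (f n x - F x)\<^sup>2 \<partial>M) \<longlonglongrightarrow> 0"

lemma sq_integrable_measurable [measurable_dest]:
  "sq_integrable M f \<Longrightarrow> f \<in> borel_measurable M"
  by (simp add: sq_integrable_def)

lemma sq_integrable_power2: "sq_integrable M f \<Longrightarrow> integrable M (\<lambda>x. (f x)\<^sup>2)"
  by (simp add: sq_integrable_def)

lemma sq_integrable_mult:
  assumes "sq_integrable M f" "sq_integrable M g"
  shows "integrable M (\<lambda>x. f x * g x)"
proof (rule Bochner_Integration.integrable_bound)
  show "integrable M (\<lambda>x. (f x)\<^sup>2 + (g x)\<^sup>2)"
    using assms by (simp add: sq_integrable_def)
  show "(\<lambda>x. f x * g x) \<in> borel_measurable M"
    using assms by (auto simp: sq_integrable_def)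
  have "\<bar>a * b\<bar> \<le> a\<^sup>2 + b\<^sup>2" for a b :: real
  proof -
    have "0 \<le> \<bar>a\<bar> * \<bar>b\<bar>" by simp
    then show ?thesis
      using sum_squares_bound[of "\<bar>a\<bar>" "\<bar>b\<bar>"] unfolding abs_mult power2_abs by linarith
  qed
  then show "AE x in M. norm (f x * g x) \<le> norm ((f x)\<^sup>2 + (g x)\<^sup>2)"
    by (intro AE_I2) (metis abs_of_nonneg real_norm_def sum_power2_ge_zero)
qed

lemma sq_integrable_zero [simp]: "sq_integrable M (\<lambda>x. 0)"
  by (simp add: sq_integrable_def)

lemma sq_integrable_cmult:
  "sq_integrable M f \<Longrightarrow> sq_integrable M (\<lambda>x. c * f x)"
  by (auto simp: sq_integrable_def power_mult_distrib)

lemma sq_integrable_add: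
  assumes "sq_integrable M f" "sq_integrable M g"
  shows "sq_integrable M (\<lambda>x. f x + g x)"
  using assms sq_integrable_mult[OF assms]
  by (auto simp: sq_integrable_def power2_sum mult.assoc)

lemma sq_integrable_diff:
  assumes "sq_integrable M f" "sq_integrable M g"
  shows "sq_integrable M (\<lambda>x. f x - g x)"
  using sq_integrable_add[OF assms(1) sq_integrable_cmult[OF assms(2), of "-1"]] by simp

lemma sq_integrable_sum:
  "(\<And>i. i \<in> I \<Longrightarrow> sq_integrable M (f i)) \<Longrightarrow> sq_integrable M (\<lambda>x. \<Sum>i\<in>I. f i x)"
  by (induction I rule: infinite_finite_induct) (auto intro: sq_integrable_add)

lemma (in finite_measure) sq_integrable_const: "sq_integrable M (\<lambda>x. c)"
  by (simp add: sq_integrable_def)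

lemma (in finite_measure) sq_integrable_imp_integrable:
  "sq_integrable M f \<Longrightarrow> integrable M f"
  using sq_integrable_mult[OF _ sq_integrable_const[of 1]] by simp

lemma sq_integrable_cong_AE:
  assumes "sq_integrable M f" "AE x in M. f x = g x" "g \<in> borel_measurable M"
  shows "sq_integrable M g"
proof -
  have "integrable M (\<lambda>x. (f x)\<^sup>2) \<longleftrightarrow> integrable M (\<lambda>x. (g x)\<^sup>2)"
    using assms by (intro integrable_cong_AE) (auto simp: sq_integrable_def)
  then show ?thesis
    using assms by (simp add: sq_integrable_def)
qed

lemma integral_square_add:
  assumes "sq_integrable M f" "sq_integrable M g"
  shows "(\<integral>x. (f x + g x)\<^sup>2 \<partial>M) = (\<integral>x. (f x)\<^sup>2 \<partial>M) + 2 * (\<integral>x. f x * g x \<partial>M) + (\<integral>x. (g x)\<^sup>2 \<partial>M)"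
  using sq_integrable_mult[OF assms] assms
  by (simp add: power2_sum sq_integrable_def mult.assoc)

text \<open>The quadratic \<open>a + 2 t b + t^2 c\<close> is the integral of a square, hence
  nonnegative for all \<open>t\<close>; this bounds its discriminant.\<close>

lemma Cauchy_Schwarz_integral:
  assumes f: "sq_integrable M f" and g: "sq_integrable M g"
  shows "\<bar>\<integral>x. f x * g x \<partial>M\<bar> \<le> sqrt (\<integral>x. (f x)\<^sup>2 \<partial>M) * sqrt (\<integral>x. (g x)\<^sup>2 \<partial>M)"
proof -
  define a b c where "a = (\<integral>x. (f x)\<^sup>2 \<partial>M)" and "b = (\<integral>x. f x * g x \<partial>M)" and "c = (\<integral>x. (g x)\<^sup>2 \<partial>M)"
  have quad: "0 \<le> a + 2 * t * b + t\<^sup>2 * c" for t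
  proof -
    have "0 \<le> (\<integral>x. (f x + t * g x)\<^sup>2 \<partial>M)"
      by simp
    also have "\<dots> = a + 2 * t * b + t\<^sup>2 * c"
      using integral_square_add[OF f sq_integrable_cmult[OF g, of t]]
      by (simp add: a_def b_def c_def power_mult_distrib mult.left_commute)
    finally show ?thesis .
  qed
  have "c \<ge> 0" "a \<ge> 0"
    by (simp_all add: a_def c_def)
  have "b\<^sup>2 \<le> a * c"
  proof (cases "c = 0")
    case True
    have "b = 0"
    proof (rule ccontr)
      assume "b \<noteq> 0"
      \<comment> \<open>With \<open>c = 0\<close> the expression is linear in \<open>t\<close>, and
        this value of \<open>t\<close> makes it -1.\<close>
      then show False
        using quad[of "- (a + 1) / (2 * b)"] True by (simp add: field_simps)
    qed
    then show ?thesis using True by simp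
  next
    case False
    \<comment> \<open>The vertex \<open>t = - b / c\<close> of the parabola, multiplied by
      \<open>c\<close> to clear the denominator.\<close>
    then have "0 \<le> (a + 2 * (- b / c) * b + (- b / c)\<^sup>2 * c) * c"
      using quad[of "- b / c"] \<open>c \<ge> 0\<close> by (intro mult_nonneg_nonneg) auto
    also have "\<dots> = a * c - b\<^sup>2"
      using False by (simp add: field_simps power2_eq_square)
    finally show ?thesis by simp
  qed
  then have "sqrt (b\<^sup>2) \<le> sqrt (a * c)"
    by (rule real_sqrt_le_mono)
  then show ?thesis
    by (simp add: real_sqrt_mult a_def b_def c_def)
qed

section \<open>Convergence in mean square\<close>

lemma tendsto_L2_sq_integrable:
  assumes "tendsto_L2 M f F"
  shows "sq_integrable M (f n)" "sq_integrable M F"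
  using assms by (auto simp: tendsto_L2_def)

text \<open>Continuity of the scalar product: writing \<open>f n = F + u\<close> and
  \<open>g n = G + v\<close> leaves three terms, each with a factor tending to 0 by Cauchy-Schwarz.
  Covariances of limits are computed through this.\<close>

lemma tendsto_L2_integral_mult:
  assumes f: "tendsto_L2 M f F" and g: "tendsto_L2 M g G"
  shows "(\<lambda>n. \<integral>x. f n x * g n x \<partial>M) \<longlonglongrightarrow> (\<integral>x. F x * G x \<partial>M)"
proof -
  note [simp] = tendsto_L2_sq_integrable[OF f] tendsto_L2_sq_integrable[OF g] sq_integrable_diff
  let ?u = "\<lambda>n x. f n x - F x" and ?v = "\<lambda>n x. g n x - G x"
  let ?r = "\<lambda>h. sqrt (\<integral>x. (h x)\<^sup>2 \<partial>M)"
  have lim: "(\<lambda>n. ?r (?u n)) \<longlonglongrightarrow> 0" "(\<lambda>n. ?r (?v n)) \<longlonglongrightarrow> 0"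
    using tendsto_real_sqrt f g by (fastforce simp: tendsto_L2_def)+
  have split: "(\<integral>x. f n x * g n x \<partial>M) - (\<integral>x. F x * G x \<partial>M)
      = (\<integral>x. ?u n x * ?v n x \<partial>M) + (\<integral>x. ?u n x * G x \<partial>M) + (\<integral>x. F x * ?v n x \<partial>M)" for n
  proof -
    have *: "integrable M (\<lambda>x. ?u n x * ?v n x)" "integrable M (\<lambda>x. ?u n x * G x)"
        "integrable M (\<lambda>x. F x * ?v n x)" "integrable M (\<lambda>x. F x * G x)"
      by (intro sq_integrable_mult; simp)+
    have "(\<integral>x. f n x * g n x \<partial>M)
        = (\<integral>x. ?u n x * ?v n x + ?u n x * G x + F x * ?v n x + F x * G x \<partial>M)"
      by (intro Bochner_Integration.integral_cong) (auto simp: algebra_simps)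
    then show ?thesis using * by simp
  qed
  have bound: "\<bar>(\<integral>x. f n x * g n x \<partial>M) - (\<integral>x. F x * G x \<partial>M)\<bar>
      \<le> ?r (?u n) * ?r (?v n) + ?r (?u n) * ?r G + ?r F * ?r (?v n)" for n
  proof -
    have "\<bar>\<integral>x. ?u n x * ?v n x \<partial>M\<bar> \<le> ?r (?u n) * ?r (?v n)"
      "\<bar>\<integral>x. ?u n x * G x \<partial>M\<bar> \<le> ?r (?u n) * ?r G"
      "\<bar>\<integral>x. F x * ?v n x \<partial>M\<bar> \<le> ?r F * ?r (?v n)"
      by (intro Cauchy_Schwarz_integral; simp)+
    then show ?thesis
      unfolding split by linarith
  qed
  have "(\<lambda>n. ?r (?u n) * ?r (?v n) + ?r (?u n) * ?r G + ?r F * ?r (?v n)) \<longlonglongrightarrow> 0 * 0 + 0 * ?r G + ?r F * 0"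
    by (intro tendsto_intros lim)
  then have "(\<lambda>n. (\<integral>x. f n x * g n x \<partial>M) - (\<integral>x. F x * G x \<partial>M)) \<longlonglongrightarrow> 0"
    by (rule Lim_null_comparison[rotated, OF tendsto_eq_rhs]) (auto simp: bound)
  then show ?thesis
    by (simp add: LIM_zero_iff)
qed

lemma tendsto_L2_const: "sq_integrable M F \<Longrightarrow> tendsto_L2 M (\<lambda>_. F) F"
  by (simp add: tendsto_L2_def)

lemma tendsto_L2_add:
  assumes f: "tendsto_L2 M f F" and g: "tendsto_L2 M g G"
  shows "tendsto_L2 M (\<lambda>n x. f n x + g n x) (\<lambda>x. F x + G x)"
proof -
  note [simp] = tendsto_L2_sq_integrable[OF f] tendsto_L2_sq_integrable[OF g] sq_integrable_diff
    sq_integrable_add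
  have *: "(\<integral>x. (f n x + g n x - (F x + G x))\<^sup>2 \<partial>M)
      \<le> 2 * (\<integral>x. (f n x - F x)\<^sup>2 \<partial>M) + 2 * (\<integral>x. (g n x - G x)\<^sup>2 \<partial>M)" for n
  proof -
    have i: "integrable M (\<lambda>x. (f n x - F x)\<^sup>2)" "integrable M (\<lambda>x. (g n x - G x)\<^sup>2)"
      by (simp_all add: sq_integrable_power2)
    have "(\<integral>x. (f n x + g n x - (F x + G x))\<^sup>2 \<partial>M)
        \<le> (\<integral>x. 2 * (f n x - F x)\<^sup>2 + 2 * (g n x - G x)\<^sup>2 \<partial>M)"
    proof (rule integral_mono)
      show "integrable M (\<lambda>x. (f n x + g n x - (F x + G x))\<^sup>2)"
        by (intro sq_integrable_power2) simp
      fix x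
      have "(a + b)\<^sup>2 \<le> 2 * a\<^sup>2 + 2 * b\<^sup>2" for a b :: real
        using sum_squares_bound[of a b] by (simp add: power2_sum)
      from this[of "f n x - F x" "g n x - G x"]
      show "(f n x + g n x - (F x + G x))\<^sup>2 \<le> 2 * (f n x - F x)\<^sup>2 + 2 * (g n x - G x)\<^sup>2"
        by (simp add: add_diff_add)
    qed (use i in simp)
    then show ?thesis using i by simp
  qed
  have "(\<lambda>n. 2 * (\<integral>x. (f n x - F x)\<^sup>2 \<partial>M) + 2 * (\<integral>x. (g n x - G x)\<^sup>2 \<partial>M)) \<longlonglongrightarrow> 2 * 0 + 2 * 0"
    using f g by (intro tendsto_intros) (auto simp: tendsto_L2_def)
  then have "(\<lambda>n. \<integral>x. (f n x + g n x - (F x + G x))\<^sup>2 \<partial>M) \<longlonglongrightarrow> 0"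
    by (rule Lim_null_comparison[rotated, OF tendsto_eq_rhs]) (auto simp: *)
  then show ?thesis by (simp add: tendsto_L2_def)
qed

lemma tendsto_L2_cmult:
  assumes "tendsto_L2 M f F"
  shows "tendsto_L2 M (\<lambda>n x. c * f n x) (\<lambda>x. c * F x)"
proof -
  have "(\<lambda>n. c\<^sup>2 * (\<integral>x. (f n x - F x)\<^sup>2 \<partial>M)) \<longlonglongrightarrow> c\<^sup>2 * 0"
    using assms by (intro tendsto_intros) (auto simp: tendsto_L2_def)
  then show ?thesis
    using assms
    by (simp add: tendsto_L2_def sq_integrable_cmult power_mult_distrib flip: right_diff_distrib)
qed

text \<open>Bridge from the extended nonnegative integrals of the definitions, whose finiteness
  carries information: one index at finite distance from \<open>F\<close> already makes
  \<open>F\<close> square integrable.\<close>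

lemma tendsto_L2_nn_integralI:
  assumes f: "\<And>n. sq_integrable M (f n)" and F: "F \<in> borel_measurable M"
    and lim: "(\<lambda>n. \<integral>\<^sup>+x. ennreal ((f n x - F x)\<^sup>2) \<partial>M) \<longlonglongrightarrow> 0"
  shows "tendsto_L2 M f F"
proof -
  have [measurable]: "f n \<in> borel_measurable M" for n
    using f by (simp add: sq_integrable_def)
  note [measurable] = F
  have fin: "integrable M (\<lambda>x. (f n x - F x)\<^sup>2) \<longleftrightarrow> (\<integral>\<^sup>+x. ennreal ((f n x - F x)\<^sup>2) \<partial>M) < \<infinity>" for n
    by (subst integrable_iff_bounded) simp
  have "\<forall>\<^sub>F n in sequentially. (\<integral>\<^sup>+x. ennreal ((f n x - F x)\<^sup>2) \<partial>M) < 1"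
    using order_tendstoD(2)[OF lim, of 1] by simp
  then obtain N where "(\<integral>\<^sup>+x. ennreal ((f N x - F x)\<^sup>2) \<partial>M) < 1"
    using eventually_happens' sequentially_bot by blast
  then have "integrable M (\<lambda>x. (f N x - F x)\<^sup>2)"
    unfolding fin by (rule order.strict_trans) simp
  then have "sq_integrable M (\<lambda>x. f N x - F x)"
    by (simp add: sq_integrable_def)
  from sq_integrable_diff[OF f[of N] this] have sqF: "sq_integrable M F"
    by simp
  have "integrable M (\<lambda>x. (f n x - F x)\<^sup>2)" for n
    using sq_integrable_diff[OF f[of n] sqF] by (simp add: sq_integrable_def)
  then have "(\<integral>\<^sup>+x. ennreal ((f n x - F x)\<^sup>2) \<partial>M) = ennreal (\<integral>x. (f n x - F x)\<^sup>2 \<partial>M)" for n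
    by (intro nn_integral_eq_integral) auto
  with lim have "(\<lambda>n. ennreal (\<integral>x. (f n x - F x)\<^sup>2 \<partial>M)) \<longlonglongrightarrow> ennreal 0"
    by simp
  then have "(\<lambda>n. \<integral>x. (f n x - F x)\<^sup>2 \<partial>M) \<longlonglongrightarrow> 0"
    by (subst (asm) tendsto_ennreal_iff) auto
  then show ?thesis
    using f sqF by (simp add: tendsto_L2_def)
qed

text \<open>Riesz-Fischer. Along a fast subsequence the increments are summable almost everywhere,
  which gives a candidate limit; Fatou's lemma along the subsequence then controls the distance from
  \<open>f n\<close> to it for the whole sequence.\<close>

lemma (in prob_space) L2_complete:
  assumes f: "\<And>n. sq_integrable M (f n)"
    and cauchy: "\<And>e. e > 0 \<Longrightarrow> \<exists>N. \<forall>m\<ge>N. \<forall>n\<ge>N. (\<integral>x. (f m x - f n x)\<^sup>2 \<partial>M) < e"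
  shows "\<exists>F. tendsto_L2 M f F"
proof -
  have [measurable]: "f n \<in> borel_measurable M" for n
    using f by (simp add: sq_integrable_def)
  note sqd = sq_integrable_diff[OF f f]
  have "\<exists>N. \<forall>m\<ge>N. \<forall>n\<ge>N. (\<integral>x. (f m x - f n x)\<^sup>2 \<partial>M) < (1/4) ^ k" for k
    by (rule cauchy) simp
  then obtain N where N: "\<And>k m n. m \<ge> N k \<Longrightarrow> n \<ge> N k \<Longrightarrow> (\<integral>x. (f m x - f n x)\<^sup>2 \<partial>M) < (1/4) ^ k"
    by metis
  \<comment> \<open>The sum keeps \<open>r k\<close> and \<open>r (Suc k)\<close> above
    \<open>N k\<close>; the summand \<open>k\<close> gives \<open>r k \<ge> k\<close>, so the
    subsequence goes to infinity.\<close>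
  define r where "r k = (\<Sum>i\<le>k. N i) + k" for k
  have r_ge: "r k \<ge> N k" "r k \<ge> k" "r (Suc k) \<ge> N k" for k
  proof -
    have "N k \<le> sum N {..k}"
      by (rule member_le_sum) auto
    then show "r k \<ge> N k" "r k \<ge> k" "r (Suc k) \<ge> N k"
      by (simp_all add: r_def)
  qed
  define d where "d k x = f (r (Suc k)) x - f (r k) x" for k x
  have [measurable]: "d k \<in> borel_measurable M" for k
    by (simp add: d_def[abs_def])
  have d_L1: "(\<integral>\<^sup>+x. ennreal \<bar>d k x\<bar> \<partial>M) \<le> ennreal ((1/2) ^ k)" for k
  proof -
    have sq: "sq_integrable M (\<lambda>x. \<bar>d k x\<bar>)"
      using sqd by (simp add: sq_integrable_def d_def[abs_def])
    \<comment> \<open>On a probability space the L1 norm is at most the L2 norm, so squared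
      distances below \<open>(1/4)^k\<close> become \<open>(1/2)^k\<close>.\<close>
    have "(\<integral>x. \<bar>d k x\<bar> \<partial>M) \<le> sqrt (\<integral>x. (d k x)\<^sup>2 \<partial>M)"
      using Cauchy_Schwarz_integral[OF sq sq_integrable_const[of 1]] by (simp add: prob_space)
    also have "\<dots> \<le> sqrt ((1/4) ^ k)"
      using N[of k "r (Suc k)" "r k"] r_ge by (intro real_sqrt_le_mono less_imp_le) (simp add: d_def)
    also have "\<dots> = (1/2) ^ k"
      by (simp add: real_sqrt_power real_sqrt_divide)
    finally show ?thesis
      using sq_integrable_imp_integrable[OF sq]
      by (subst nn_integral_eq_integral) (auto intro: ennreal_leI)
  qed
  have "(\<integral>\<^sup>+x. (\<Sum>k. ennreal \<bar>d k x\<bar>) \<partial>M) = (\<Sum>k. \<integral>\<^sup>+x. ennreal \<bar>d k x\<bar> \<partial>M)"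
    by (rule nn_integral_suminf) simp
  also have "\<dots> \<le> (\<Sum>k. ennreal ((1/2) ^ k))"
    by (intro suminf_le d_L1) auto
  also have "\<dots> = ennreal (\<Sum>k. (1/2) ^ k)"
    by (intro suminf_ennreal2) (auto intro: summable_geometric)
  finally have "(\<integral>\<^sup>+x. (\<Sum>k. ennreal \<bar>d k x\<bar>) \<partial>M) \<noteq> \<infinity>"
    using le_less_trans ennreal_less_top by (metis infinity_ennreal_def less_irrefl)
  then have "AE x in M. (\<Sum>k. ennreal \<bar>d k x\<bar>) \<noteq> \<infinity>"
    by (intro nn_integral_PInf_AE) auto
  then have conv: "AE x in M. convergent (\<lambda>k. f (r k) x)"
  proof eventually_elim
    case (elim x)
    then have "summable (\<lambda>k. \<bar>d k x\<bar>)"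
      by (intro summable_suminf_not_top) auto
    then have "summable (\<lambda>k. d k x)"
      by (rule summable_rabs_cancel)
    then have "convergent (\<lambda>n. \<Sum>k<n. d k x)"
      by (simp add: summable_iff_convergent)
    then have "convergent (\<lambda>n. (\<Sum>k<n. d k x) + f (r 0) x)"
      by (intro convergent_add convergent_const)
    moreover have "(\<Sum>k<n. d k x) + f (r 0) x = f (r n) x" for n
      unfolding d_def by (subst sum_lessThan_telescope) simp
    ultimately show ?case by simp
  qed
  define F where "F x = lim (\<lambda>k. f (r k) x)" for x
  have [measurable]: "F \<in> borel_measurable M"
    unfolding F_def[abs_def] by (rule borel_measurable_lim_metric) simp
  have F: "AE x in M. (\<lambda>k. f (r k) x) \<longlonglongrightarrow> F x"
    using conv by eventually_elim (simp add: F_def convergent_LIMSEQ_iff)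
  have bound: "(\<integral>\<^sup>+x. ennreal ((f n x - F x)\<^sup>2) \<partial>M) \<le> ennreal ((1/4) ^ k)" if n: "n \<ge> N k" for k n
  proof -
    have "(\<integral>\<^sup>+x. ennreal ((f n x - F x)\<^sup>2) \<partial>M)
        = (\<integral>\<^sup>+x. liminf (\<lambda>j. ennreal ((f n x - f (r j) x)\<^sup>2)) \<partial>M)"
    proof (rule nn_integral_cong_AE)
      show "AE x in M. ennreal ((f n x - F x)\<^sup>2) = liminf (\<lambda>j. ennreal ((f n x - f (r j) x)\<^sup>2))"
        using F
      proof eventually_elim
        case (elim x)
        then have "(\<lambda>j. ennreal ((f n x - f (r j) x)\<^sup>2)) \<longlonglongrightarrow> ennreal ((f n x - F x)\<^sup>2)"
          by (intro tendsto_intros)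
        then show ?case
          by (rule lim_imp_Liminf[OF sequentially_bot, symmetric])
      qed
    qed
    also have "\<dots> \<le> liminf (\<lambda>j. \<integral>\<^sup>+x. ennreal ((f n x - f (r j) x)\<^sup>2) \<partial>M)"
      by (intro nn_integral_liminf) simp
    also have "\<dots> \<le> ennreal ((1/4) ^ k)"
    proof -
      have "(\<integral>\<^sup>+x. ennreal ((f n x - f (r j) x)\<^sup>2) \<partial>M) \<le> ennreal ((1/4) ^ k)" if "j \<ge> N k" for j
        using N[OF n, of "r j"] r_ge(2)[of j] that sqd[of n "r j"]
        by (subst nn_integral_eq_integral) (auto simp: sq_integrable_def intro!: ennreal_leI)
      then have "\<forall>\<^sub>F j in sequentially. (\<integral>\<^sup>+x. ennreal ((f n x - f (r j) x)\<^sup>2) \<partial>M) \<le> ennreal ((1/4) ^ k)"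
        using eventually_sequentially by blast
      then show ?thesis
        by (intro order_trans[OF Liminf_mono Liminf_const[THEN eq_refl]]) auto
    qed
    finally show ?thesis .
  qed
  have "(\<lambda>n. \<integral>\<^sup>+x. ennreal ((f n x - F x)\<^sup>2) \<partial>M) \<longlonglongrightarrow> 0"
  proof (rule order_tendstoI)
    fix a :: ennreal assume "0 < a"
    have "(\<lambda>k. ennreal ((1/4) ^ k)) \<longlonglongrightarrow> ennreal 0"
      by (intro tendsto_ennrealI LIMSEQ_power_zero) simp
    then have "\<forall>\<^sub>F k in sequentially. ennreal ((1/4) ^ k) < a"
      using \<open>0 < a\<close> by (intro order_tendstoD(2)) auto
    then obtain k where "ennreal ((1/4) ^ k) < a"
      using eventually_happens' sequentially_bot by blast
    then show "\<forall>\<^sub>F n in sequentially. (\<integral>\<^sup>+x. ennreal ((f n x - F x)\<^sup>2) \<partial>M) < a"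
      using bound[of k] eventually_sequentially le_less_trans by blast
  qed auto
  then show ?thesis
    using tendsto_L2_nn_integralI[of M f F] f by auto
qed

section \<open>Finitely correlated stationary processes\<close>

text \<open>
  The coefficients of a member of \<open>lag_span\<close> do not depend on the time \<open>n\<close>, so one minimising sequence
  for the prediction error at time \<open>0\<close> yields the innovations at all times.
\<close>

inductive_set lag_span :: "(int \<Rightarrow> 'i \<Rightarrow> 'w \<Rightarrow> real) \<Rightarrow> nat \<Rightarrow> (int \<Rightarrow> 'w \<Rightarrow> real) set"
  for x :: "int \<Rightarrow> 'i \<Rightarrow> 'w \<Rightarrow> real" and K :: nat where
  zero: "(\<lambda>n \<omega>. 0) \<in> lag_span x K"
| add_lag: "U \<in> lag_span x K \<Longrightarrow> K \<le> k \<Longrightarrow> (\<lambda>n \<omega>. U n \<omega> + a * x (n - int k) i \<omega>) \<in> lag_span x K"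

lemma lag_span_add:
  assumes "U \<in> lag_span x K" "V \<in> lag_span x K"
  shows "(\<lambda>n \<omega>. U n \<omega> + V n \<omega>) \<in> lag_span x K"
  using assms(2)
proof induction
  case (add_lag V k a i)
  from lag_span.add_lag[OF add_lag.IH add_lag.hyps(2), of a i] show ?case
    by (simp add: add.assoc)
qed (simp add: assms(1))

lemma lag_span_cmult:
  assumes "U \<in> lag_span x K"
  shows "(\<lambda>n \<omega>. c * U n \<omega>) \<in> lag_span x K"
  using assms
proof induction
  case (add_lag V k a i)
  from lag_span.add_lag[OF add_lag.IH add_lag.hyps(2), of "c * a" i] show ?case
    by (simp add: distrib_left mult.assoc)
qed (simp add: lag_span.zero)

lemma lag_span_mono:
  assumes "U \<in> lag_span x K" "K' \<le> K"
  shows "U \<in> lag_span x K'"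
  using assms(1) by induction (use assms(2) in \<open>auto intro: lag_span.intros\<close>)

lemma lag_span_lag: "K \<le> k \<Longrightarrow> (\<lambda>n. x (n - int k) i) \<in> lag_span x K"
  using lag_span.add_lag[OF lag_span.zero, of K k 1 x i] by simp

lemma lag_span_shift:
  assumes "U \<in> lag_span x K"
  shows "(\<lambda>n. U (n - int j)) \<in> lag_span x (K + j)"
  using assms
proof induction
  case (add_lag V k a i)
  from lag_span.add_lag[OF add_lag.IH, of "k + j" a i] add_lag.hyps(2) show ?case
    by (simp add: algebra_simps)
qed (rule lag_span.zero)

text \<open>One sequence of coefficient patterns has to converge at every time simultaneously, so
  members are limits of whole processes and stay jointly stationary with \<open>x\<close>; closing
  each time separately would lose the link between different times.\<close>

definition lag_closure ::
    "'w measure \<Rightarrow> (int \<Rightarrow> 'i \<Rightarrow> 'w \<Rightarrow> real) \<Rightarrow> nat \<Rightarrow> (int \<Rightarrow> 'w \<Rightarrow> real) set" where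
  "lag_closure M x K = {U. \<exists>V. (\<forall>N. V N \<in> lag_span x K) \<and> (\<forall>n. tendsto_L2 M (\<lambda>N. V N n) (U n))}"

lemma lag_closureE:
  assumes "U \<in> lag_closure M x K"
  obtains V where "\<And>N. V N \<in> lag_span x K" "\<And>n. tendsto_L2 M (\<lambda>N. V N n) (U n)"
  using assms by (auto simp: lag_closure_def)

lemma lag_closureI:
  assumes "\<And>N. V N \<in> lag_span x K" "\<And>n. tendsto_L2 M (\<lambda>N. V N n) (U n)"
  shows "U \<in> lag_closure M x K"
  using assms by (auto simp: lag_closure_def)

lemma lag_closure_sq_integrable: "U \<in> lag_closure M x K \<Longrightarrow> sq_integrable M (U n)"
  by (meson lag_closureE tendsto_L2_sq_integrable)

lemma lag_closure_add:
  assumes "U \<in> lag_closure M x K" "V \<in> lag_closure M x K"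
  shows "(\<lambda>n \<omega>. U n \<omega> + V n \<omega>) \<in> lag_closure M x K"
proof -
  obtain u where u: "\<And>N. u N \<in> lag_span x K" "\<And>n. tendsto_L2 M (\<lambda>N. u N n) (U n)"
    using lag_closureE[OF assms(1)] by blast
  obtain v where v: "\<And>N. v N \<in> lag_span x K" "\<And>n. tendsto_L2 M (\<lambda>N. v N n) (V n)"
    using lag_closureE[OF assms(2)] by blast
  show ?thesis
    by (rule lag_closureI[of "\<lambda>N n \<omega>. u N n \<omega> + v N n \<omega>"])
      (use u v in \<open>auto intro: lag_span_add tendsto_L2_add\<close>)
qed

lemma lag_closure_cmult:
  assumes "U \<in> lag_closure M x K"
  shows "(\<lambda>n \<omega>. c * U n \<omega>) \<in> lag_closure M x K"
proof -
  obtain u where u: "\<And>N. u N \<in> lag_span x K" "\<And>n. tendsto_L2 M (\<lambda>N. u N n) (U n)"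
    using lag_closureE[OF assms(1)] by blast
  show ?thesis
    by (rule lag_closureI[of "\<lambda>N n \<omega>. c * u N n \<omega>"])
      (use u in \<open>auto intro: lag_span_cmult tendsto_L2_cmult\<close>)
qed

lemma lag_closure_diff:
  assumes "U \<in> lag_closure M x K" "V \<in> lag_closure M x K"
  shows "(\<lambda>n \<omega>. U n \<omega> - V n \<omega>) \<in> lag_closure M x K"
  using lag_closure_add[OF assms(1) lag_closure_cmult[OF assms(2), of "-1"]] by simp

lemma lag_closure_shift:
  assumes "U \<in> lag_closure M x K"
  shows "(\<lambda>n. U (n - int j)) \<in> lag_closure M x (K + j)"
proof -
  obtain u where u: "\<And>N. u N \<in> lag_span x K" "\<And>n. tendsto_L2 M (\<lambda>N. u N n) (U n)"
    using lag_closureE[OF assms(1)] by blast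
  show ?thesis
    by (rule lag_closureI[of "\<lambda>N n. u N (n - int j)"]) (use u in \<open>auto intro: lag_span_shift\<close>)
qed

lemma lag_closure_mono:
  assumes "U \<in> lag_closure M x K" "K' \<le> K"
  shows "U \<in> lag_closure M x K'"
  using assms lag_span_mono[OF _ assms(2)] unfolding lag_closure_def by blast

lemma lag_closure_sum:
  assumes "\<And>s. s \<in> S \<Longrightarrow> U s \<in> lag_closure M x K" 
  shows "(\<lambda>n \<omega>. \<Sum>s\<in>S. U s n \<omega>) \<in> lag_closure M x K"
proof -
  have z: "(\<lambda>n \<omega>. 0) \<in> lag_closure M x K"
    by (rule lag_closureI[of "\<lambda>_ _ _. 0"]) (auto intro: lag_span.zero tendsto_L2_const)
  show ?thesis
    using assms by (induction S rule: infinite_finite_induct) (auto intro: lag_closure_add z)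
qed

text \<open>The range of a symmetric matrix is the orthogonal complement of its kernel, so
  orthogonality of \<open>r\<close> to the kernel gives solvability even when \<open>S\<close> is
  singular.\<close>

lemma symmetric_form_solvable:
  fixes S :: "'i::finite \<Rightarrow> 'i \<Rightarrow> real" and r :: "'i \<Rightarrow> real"
  assumes sym: "\<And>i j. S i j = S j i"
    and ker: "\<And>v. (\<And>j. (\<Sum>i\<in>UNIV. v i * S i j) = 0) \<Longrightarrow> (\<Sum>i\<in>UNIV. v i * r i) = 0"
  shows "\<exists>c. \<forall>j. (\<Sum>i\<in>UNIV. c i * S i j) = r j"
proof -
  define f :: "real^'i \<Rightarrow> real^'i" where "f v = (\<chi> j. \<Sum>i\<in>UNIV. v $ i * S i j)" for v
  have lin: "linear f"
    by (rule linearI) (auto simp: f_def vec_eq_iff sum.distrib distrib_right sum_distrib_left mult.assoc)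
  have self: "f v \<bullet> w = v \<bullet> f w" for v w
  proof -
    have "f v \<bullet> w = (\<Sum>j\<in>UNIV. \<Sum>i\<in>UNIV. v $ i * S i j * w $ j)"
      by (simp add: f_def inner_vec_def sum_distrib_right)
    also have "\<dots> = (\<Sum>i\<in>UNIV. \<Sum>j\<in>UNIV. v $ i * S i j * w $ j)"
      by (rule sum.swap)
    also have "\<dots> = (\<Sum>i\<in>UNIV. \<Sum>j\<in>UNIV. v $ i * (w $ j * S j i))"
      by (intro sum.cong refl) (metis sym mult.assoc mult.commute)
    also have "\<dots> = v \<bullet> f w"
      by (simp add: f_def inner_vec_def sum_distrib_left)
    finally show ?thesis .
  qed
  define R :: "real^'i" where "R = (\<chi> i. r i)"
  obtain y z where yz: "y \<in> span (range f)" "\<And>w. w \<in> span (range f) \<Longrightarrow> orthogonal z w" "R = y + z"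
    using orthogonal_subspace_decomp_exists[of "range f" R] by metis
  \<comment> \<open>\<open>z\<close> is orthogonal to the range, in particular to
    \<open>f (f z)\<close>, and self-adjointness turns this into
    \<open>f z \<bullet> f z = 0\<close>.\<close>
  have "f z = 0"
  proof -
    have "orthogonal z (f (f z))"
      by (intro yz(2) span_base) simp
    then show ?thesis
      using self[of z "f z"] by (simp add: orthogonal_def)
  qed
  then have "(\<Sum>i\<in>UNIV. z $ i * r i) = 0"
    by (intro ker) (simp add: f_def vec_eq_iff)
  then have "z \<bullet> R = 0"
    by (simp add: inner_vec_def R_def)
  moreover have "z \<bullet> y = 0"
    using yz(1,2) by (simp add: orthogonal_def)
  ultimately have "z = 0"
    using yz(3) by (simp add: inner_add_right)
  moreover have "y \<in> range f"
    using yz(1) linear_subspace_image[OF lin subspace_UNIV] by (metis span_eq_iff)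
  ultimately obtain c where "R = f c"
    using yz(3) by auto
  then show ?thesis
    by (intro exI[of _ "\<lambda>i. c $ i"]) (simp add: R_def f_def vec_eq_iff)
qed

text \<open>For small \<open>t\<close> the linear term dominates the quadratic one, so a nonzero
  slope would produce negative values.\<close>

lemma quadratic_nonneg_imp_zero:
  fixes s v :: real
  assumes "\<And>t. 0 \<le> 2 * t * s + t\<^sup>2 * v" and "0 \<le> v"
  shows "s = 0"
proof (rule ccontr)
  assume s: "s \<noteq> 0"
  \<comment> \<open>A denominator that stays positive when \<open>v = 0\<close>.\<close>
  define w where "w = v + 1"
  have w: "w > 0" and v: "v = w - 1"
    using assms(2) by (auto simp: w_def)
  have "2 * (- s / w) * s + (- s / w)\<^sup>2 * v = - (s\<^sup>2 * (w + 1) / w\<^sup>2)"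
    using w unfolding v by (simp add: field_simps power2_eq_square)
  moreover have "s\<^sup>2 * (w + 1) / w\<^sup>2 > 0"
    using s w by (intro divide_pos_pos mult_pos_pos) auto
  ultimately show False
    using assms(1)[of "- s / w"] by linarith
qed

text \<open>Only first and second moments enter. The bound \<open>n - k \<ge> int m\<close> includes
  lag \<open>m\<close> itself, which makes the order at most \<open>m - 1\<close>.\<close>

locale finitely_correlated = prob_space M for M :: "'w measure" +
  fixes x :: "int \<Rightarrow> 'i::finite \<Rightarrow> 'w \<Rightarrow> real" and m :: nat
  assumes sq: "sq_integrable M (x n i)"
    and mean: "expectation (x n i) = 0"
    and stationary: "expectation (\<lambda>\<omega>. x (n + h) i \<omega> * x (k + h) j \<omega>) = expectation (\<lambda>\<omega>. x n i \<omega> * x k j \<omega>)"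
    and uncorrelated: "n - k \<ge> int m \<Longrightarrow> expectation (\<lambda>\<omega>. x n i \<omega> * x k j \<omega>) = 0"
begin

section \<open>Stationarity and orthogonality in the closed span\<close>

lemma lag_span_sq_integrable: "U \<in> lag_span x K \<Longrightarrow> sq_integrable M (U n)"
proof (induction rule: lag_span.induct)
  case (add_lag U k a i)
  then show ?case
    by (intro sq_integrable_add sq_integrable_cmult sq)
qed simp

lemma lag_span_closure: "U \<in> lag_span x K \<Longrightarrow> U \<in> lag_closure M x K"
  by (rule lag_closureI[of "\<lambda>_. U"]) (auto intro: tendsto_L2_const lag_span_sq_integrable)

lemma integral_add_lag:
  assumes "sq_integrable M u" "sq_integrable M v"
  shows "expectation (\<lambda>\<omega>. u \<omega> * (v \<omega> + a * x n i \<omega>))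
       = expectation (\<lambda>\<omega>. u \<omega> * v \<omega>) + a * expectation (\<lambda>\<omega>. u \<omega> * x n i \<omega>)"
  using sq_integrable_mult[OF assms] sq_integrable_mult[OF assms(1) sq[of n i]]
  by (simp add: distrib_left mult.left_commute)

lemma integral_add_lag':
  assumes "sq_integrable M u" "sq_integrable M v"
  shows "expectation (\<lambda>\<omega>. (v \<omega> + a * x n i \<omega>) * u \<omega>)
       = expectation (\<lambda>\<omega>. v \<omega> * u \<omega>) + a * expectation (\<lambda>\<omega>. x n i \<omega> * u \<omega>)"
  using integral_add_lag[OF assms] by (simp add: mult.commute)

lemma lag_span_stationary:
  assumes U: "U \<in> lag_span x K" and V: "V \<in> lag_span x K'"
  shows "expectation (\<lambda>\<omega>. U (n + h) \<omega> * V (k + h) \<omega>) = expectation (\<lambda>\<omega>. U n \<omega> * V k \<omega>)"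
  using V
proof induction
  case (add_lag V k' a i)
  have "expectation (\<lambda>\<omega>. U (n + h) \<omega> * x (k - int k' + h) i \<omega>) = expectation (\<lambda>\<omega>. U n \<omega> * x (k - int k') i \<omega>)"
    using U
  proof induction
    case (add_lag U l b j)
    have eq: "n + h - int l = n - int l + h" by simp
    show ?case
      using add_lag stationary[of "n - int l" h j "k - int k'" i]
      by (simp add: integral_add_lag'[OF sq lag_span_sq_integrable] eq)
  qed simp
  moreover have "k - int k' + h = k + h - int k'" by simp
  ultimately show ?case
    using add_lag U by (simp add: integral_add_lag[OF lag_span_sq_integrable lag_span_sq_integrable])
qed simp

lemma lag_closure_stationary:
  assumes U: "U \<in> lag_closure M x K" and V: "V \<in> lag_closure M x K'"
  shows "expectation (\<lambda>\<omega>. U (n + h) \<omega> * V (k + h) \<omega>) = expectation (\<lambda>\<omega>. U n \<omega> * V k \<omega>)"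
proof -
  obtain u where u: "\<And>N. u N \<in> lag_span x K" "\<And>n. tendsto_L2 M (\<lambda>N. u N n) (U n)"
    using lag_closureE[OF assms(1)] by blast
  obtain v where v: "\<And>N. v N \<in> lag_span x K'" "\<And>n. tendsto_L2 M (\<lambda>N. v N n) (V n)"
    using lag_closureE[OF assms(2)] by blast
  have "(\<lambda>N. expectation (\<lambda>\<omega>. u N (n + h) \<omega> * v N (k + h) \<omega>)) \<longlonglongrightarrow> expectation (\<lambda>\<omega>. U (n + h) \<omega> * V (k + h) \<omega>)"
    by (rule tendsto_L2_integral_mult) (rule u v)+
  moreover have "(\<lambda>N. expectation (\<lambda>\<omega>. u N n \<omega> * v N k \<omega>)) \<longlonglongrightarrow> expectation (\<lambda>\<omega>. U n \<omega> * V k \<omega>)"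
    by (rule tendsto_L2_integral_mult) (rule u v)+
  ultimately show ?thesis
    using LIMSEQ_unique lag_span_stationary[OF u(1) v(1)] by simp
qed

text \<open>Orthogonality to the generators passes to finite combinations by linearity and to the
  closure by continuity of the scalar product.\<close>

lemma lag_closure_orthogonal:
  assumes W: "sq_integrable M W" and U: "U \<in> lag_closure M x K"
    and orth: "\<And>k i. K \<le> k \<Longrightarrow> expectation (\<lambda>\<omega>. W \<omega> * x (n - int k) i \<omega>) = 0"
  shows "expectation (\<lambda>\<omega>. W \<omega> * U n \<omega>) = 0"
proof -
  have span: "expectation (\<lambda>\<omega>. W \<omega> * V n \<omega>) = 0" if "V \<in> lag_span x K" for V
    using that
  proof induction
    case (add_lag V k a i)
    then show ?case
      by (simp add: integral_add_lag[OF W lag_span_sq_integrable] orth)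
  qed simp
  obtain u where u: "\<And>N. u N \<in> lag_span x K" "\<And>n. tendsto_L2 M (\<lambda>N. u N n) (U n)"
    using lag_closureE[OF U] by blast
  have "(\<lambda>N. expectation (\<lambda>\<omega>. W \<omega> * u N n \<omega>)) \<longlonglongrightarrow> expectation (\<lambda>\<omega>. W \<omega> * U n \<omega>)"
    by (rule tendsto_L2_integral_mult[OF tendsto_L2_const[OF W] u(2)])
  then show ?thesis
    using LIMSEQ_unique[OF _ tendsto_const] by (simp add: span[OF u(1)])
qed

text \<open>The projection theorem for the closed span of the strict past: the parallelogram
  identity makes a minimising sequence converge, and a variational argument makes the residual
  orthogonal.\<close>

lemma innovation_exists:
  "\<exists>z \<in> lag_closure M x 0. (\<lambda>n \<omega>. x n i \<omega> - z n \<omega>) \<in> lag_closure M x 1 \<and>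
     (\<forall>n k j. k < n \<longrightarrow> expectation (\<lambda>\<omega>. z n \<omega> * x k j \<omega>) = 0)"
proof -
  let ?q = "\<lambda>U. expectation (\<lambda>\<omega>. (x 0 i \<omega> - U 0 \<omega>)\<^sup>2)"
  have X: "(\<lambda>n. x n i) \<in> lag_span x 0"
    using lag_span_lag[of 0 0 x i] by simp
  have diff: "(\<lambda>n \<omega>. x n i \<omega> - U n \<omega>) \<in> lag_span x 0" if "U \<in> lag_span x 1" for U
    using lag_span_add[OF X lag_span_cmult[OF lag_span_mono[OF that, of 0], of "-1"]] by simp
  define \<delta> where "\<delta> = Inf (?q ` lag_span x 1)"
  have bdd: "bdd_below (?q ` lag_span x 1)"
    by (rule bdd_belowI[of _ 0]) auto
  have ne: "?q ` lag_span x 1 \<noteq> {}"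
    using lag_span.zero by blast
  have ge: "\<delta> \<le> ?q U" if "U \<in> lag_span x 1" for U
    unfolding \<delta>_def by (rule cInf_lower) (use that bdd in auto)
  have "\<exists>U\<in>lag_span x 1. ?q U < \<delta> + 1 / real (Suc N)" for N
    using cInf_lessD[OF ne, of "\<delta> + 1 / real (Suc N)"] by (auto simp: \<delta>_def)
  then obtain U where U: "\<And>N. U N \<in> lag_span x 1" and less: "\<And>N. ?q (U N) < \<delta> + 1 / real (Suc N)"
    by metis
  have close: "expectation (\<lambda>\<omega>. (U N n \<omega> - U N' n \<omega>)\<^sup>2) \<le> 2 / real (Suc N) + 2 / real (Suc N')" for N N' n
  proof -
    let ?a = "\<lambda>\<omega>. x 0 i \<omega> - U N 0 \<omega>" and ?b = "\<lambda>\<omega>. x 0 i \<omega> - U N' 0 \<omega>"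
    let ?mid = "\<lambda>n \<omega>. 1 / 2 * (U N n \<omega> + U N' n \<omega>)"
    have D: "(\<lambda>n \<omega>. U N n \<omega> - U N' n \<omega>) \<in> lag_span x 1"
      using lag_span_add[OF U lag_span_cmult[OF U, of "-1"]] by simp
    have mid: "?mid \<in> lag_span x 1"
      by (intro lag_span_cmult lag_span_add U)
    \<comment> \<open>Stationarity carries distances at time \<open>n\<close> back to time 0, where
      the sequence is minimising.\<close>
    have "expectation (\<lambda>\<omega>. (U N n \<omega> - U N' n \<omega>)\<^sup>2) = expectation (\<lambda>\<omega>. (U N 0 \<omega> - U N' 0 \<omega>)\<^sup>2)"
      using lag_span_stationary[OF D D, of 0 n 0] by (simp add: power2_eq_square)
    \<comment> \<open>Parallelogram identity; the midpoint is again a competitor, so its error is at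
      least \<open>\<delta>\<close>.\<close>
    also have "\<dots> = expectation (\<lambda>\<omega>. 2 * (?a \<omega>)\<^sup>2 + 2 * (?b \<omega>)\<^sup>2 - 4 * (x 0 i \<omega> - ?mid 0 \<omega>)\<^sup>2)"
      by (intro Bochner_Integration.integral_cong) (auto simp: power2_eq_square field_simps)
    also have "\<dots> = 2 * ?q (U N) + 2 * ?q (U N') - 4 * ?q ?mid"
    proof -
      have "integrable M (\<lambda>\<omega>. (?a \<omega>)\<^sup>2)" "integrable M (\<lambda>\<omega>. (?b \<omega>)\<^sup>2)"
        "integrable M (\<lambda>\<omega>. (x 0 i \<omega> - ?mid 0 \<omega>)\<^sup>2)"
        using lag_span_sq_integrable[OF diff[OF U]] lag_span_sq_integrable[OF diff[OF mid]]
        by (auto intro!: sq_integrable_power2)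
      then show ?thesis by simp
    qed
    also have "\<dots> \<le> 2 / real (Suc N) + 2 / real (Suc N')"
      using ge[OF mid] less[of N] less[of N'] by (simp del: of_nat_Suc)
    finally show ?thesis .
  qed
  have "\<exists>P. tendsto_L2 M (\<lambda>N. U N n) P" for n
  proof (rule L2_complete)
    fix e :: real assume "e > 0"
    then obtain K where K: "1 / real (Suc K) < e / 4"
      using reals_Archimedean[of "e / 4"] by (auto simp: inverse_eq_divide)
    have "expectation (\<lambda>\<omega>. (U N n \<omega> - U N' n \<omega>)\<^sup>2) < e" if "N \<ge> K" "N' \<ge> K" for N N'
    proof -
      have "1 / real (Suc N) \<le> 1 / real (Suc K)" "1 / real (Suc N') \<le> 1 / real (Suc K)"
        using that by (auto intro!: divide_left_mono)
      then show ?thesis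
        using close[of N n N'] K by (simp del: of_nat_Suc)
    qed
    then show "\<exists>K. \<forall>N\<ge>K. \<forall>N'\<ge>K. expectation (\<lambda>\<omega>. (U N n \<omega> - U N' n \<omega>)\<^sup>2) < e"
      by blast
  qed (rule lag_span_sq_integrable[OF U])
  then obtain P where P: "\<And>n. tendsto_L2 M (\<lambda>N. U N n) (P n)"
    by metis
  have clP: "P \<in> lag_closure M x 1"
    by (rule lag_closureI[of U]) (rule U P)+
  define z where "z n \<omega> = x n i \<omega> - P n \<omega>" for n \<omega>
  have z: "z \<in> lag_closure M x 0"
    unfolding z_def[abs_def] 
    by (intro lag_closure_diff lag_span_closure[OF X] lag_closure_mono[OF clP]) simp
  have orth: "expectation (\<lambda>\<omega>. z 0 \<omega> * V 0 \<omega>) = 0" if V: "V \<in> lag_span x 1" for V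
  proof -
    let ?v = "expectation (\<lambda>\<omega>. (V 0 \<omega>)\<^sup>2)" and ?s = "expectation (\<lambda>\<omega>. z 0 \<omega> * V 0 \<omega>)"
    have sqV: "sq_integrable M (V 0)" by (rule lag_span_sq_integrable[OF V])
    have zsq: "sq_integrable M (z 0)" by (rule lag_closure_sq_integrable[OF z])
    have lim: "tendsto_L2 M (\<lambda>N \<omega>. x 0 i \<omega> + - 1 * U N 0 \<omega>) (\<lambda>\<omega>. x 0 i \<omega> + - 1 * P 0 \<omega>)"
      by (intro tendsto_L2_add tendsto_L2_cmult P tendsto_L2_const sq)
    then have lim: "tendsto_L2 M (\<lambda>N \<omega>. x 0 i \<omega> - U N 0 \<omega>) (z 0)"
      by (simp add: z_def[abs_def])
    have zz: "expectation (\<lambda>\<omega>. (z 0 \<omega>)\<^sup>2) \<le> \<delta>"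
    proof (rule LIMSEQ_le)
      show "(\<lambda>N. ?q (U N)) \<longlonglongrightarrow> expectation (\<lambda>\<omega>. (z 0 \<omega>)\<^sup>2)"
        using tendsto_L2_integral_mult[OF lim lim] by (simp add: power2_eq_square)
      have "(\<lambda>N. \<delta> + 1 / real (Suc N)) \<longlonglongrightarrow> \<delta> + 0"
        by (intro tendsto_intros LIMSEQ_Suc lim_1_over_n)
      then show "(\<lambda>N. \<delta> + 1 / real (Suc N)) \<longlonglongrightarrow> \<delta>" by simp
    qed (use less less_imp_le in blast)
    have quad: "0 \<le> 2 * t * ?s + t\<^sup>2 * ?v" for t
    proof -
      have "tendsto_L2 M (\<lambda>N \<omega>. x 0 i \<omega> - U N 0 \<omega> + t * V 0 \<omega>) (\<lambda>\<omega>. z 0 \<omega> + t * V 0 \<omega>)"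
        by (intro tendsto_L2_add lim tendsto_L2_const sq_integrable_cmult sqV)
      from tendsto_L2_integral_mult[OF this this]
      have "(\<lambda>N. expectation (\<lambda>\<omega>. (x 0 i \<omega> - U N 0 \<omega> + t * V 0 \<omega>)\<^sup>2))
          \<longlonglongrightarrow> expectation (\<lambda>\<omega>. (z 0 \<omega> + t * V 0 \<omega>)\<^sup>2)"
        by (simp add: power2_eq_square)
      moreover have "\<delta> \<le> expectation (\<lambda>\<omega>. (x 0 i \<omega> - U N 0 \<omega> + t * V 0 \<omega>)\<^sup>2)" for N
      proof -
        have "(\<lambda>n \<omega>. U N n \<omega> + - t * V n \<omega>) \<in> lag_span x 1"
          by (intro lag_span_add lag_span_cmult U V)
        from ge[OF this] show ?thesis by (simp add: algebra_simps)
      qed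
      ultimately have "\<delta> \<le> expectation (\<lambda>\<omega>. (z 0 \<omega> + t * V 0 \<omega>)\<^sup>2)"
        using LIMSEQ_le_const by blast
      also have "\<dots> = expectation (\<lambda>\<omega>. (z 0 \<omega>)\<^sup>2) + 2 * t * ?s + t\<^sup>2 * ?v"
        using integral_square_add[OF zsq sq_integrable_cmult[OF sqV, of t]]
        by (simp add: power_mult_distrib mult.left_commute)
      finally show ?thesis using zz by linarith
    qed
    show ?thesis
      by (rule quadratic_nonneg_imp_zero[OF quad]) simp
  qed
  have "expectation (\<lambda>\<omega>. z n \<omega> * x k j \<omega>) = 0" if "k < n" for n k j
  proof -
    \<comment> \<open>Seen from \<open>n\<close>, time \<open>k\<close> is a lag of at least 1;
      stationarity then reduces the claim to time 0.\<close>
    let ?V = "\<lambda>l. x (l - int (nat (n - k))) j"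
    have V: "?V \<in> lag_span x 1"
      by (rule lag_span_lag) (use that in simp)
    have "expectation (\<lambda>\<omega>. z (0 + n) \<omega> * ?V (0 + n) \<omega>) = expectation (\<lambda>\<omega>. z 0 \<omega> * ?V 0 \<omega>)"
      by (rule lag_closure_stationary[OF z lag_span_closure[OF V]])
    then show ?thesis
      using orth[OF V] that by simp
  qed
  moreover have "(\<lambda>n \<omega>. x n i \<omega> - z n \<omega>) \<in> lag_closure M x 1"
    using clP by (simp add: z_def)
  ultimately show ?thesis using z by blast
qed

text \<open>The sum is the projection of \<open>x n i\<close> on the innovations at the times
  \<open>n, ..., n - m + 1\<close>. The residual is orthogonal to \<open>x\<close> at all times up
  to \<open>n\<close> and yet lies in the closed span of these variables, so it vanishes.\<close>

theorem moving_average_representation: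
  assumes "m > 0"
  obtains z :: "int \<Rightarrow> 'i \<Rightarrow> 'w \<Rightarrow> real" and c
  where "\<And>n i. sq_integrable M (z n i)" "\<And>n i. expectation (z n i) = 0"
    "\<And>n k i j. n \<noteq> k \<Longrightarrow> expectation (\<lambda>\<omega>. z n i \<omega> * z k j \<omega>) = 0"
    "\<And>n i j. expectation (\<lambda>\<omega>. z n i \<omega> * z n j \<omega>) = expectation (\<lambda>\<omega>. z 0 i \<omega> * z 0 j \<omega>)"
    "\<And>n i. AE \<omega> in M. x n i \<omega> = (\<Sum>k<m. \<Sum>j\<in>UNIV. c k i j * z (n - int k) j \<omega>)"
proof -
  obtain y where y: "\<And>i. y i \<in> lag_closure M x 0"
    and past: "\<And>i. (\<lambda>n \<omega>. x n i \<omega> - y i n \<omega>) \<in> lag_closure M x 1"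
    and orth: "\<And>i n k j. k < n \<Longrightarrow> expectation (\<lambda>\<omega>. y i n \<omega> * x k j \<omega>) = 0"
  proof -
    have "\<forall>i. \<exists>z. z \<in> lag_closure M x 0 \<and> (\<lambda>n \<omega>. x n i \<omega> - z n \<omega>) \<in> lag_closure M x 1 \<and>
        (\<forall>n k j. k < n \<longrightarrow> expectation (\<lambda>\<omega>. z n \<omega> * x k j \<omega>) = 0)"
      using innovation_exists unfolding Bex_def by blast
    from choice[OF this] obtain f where f: "\<forall>i. f i \<in> lag_closure M x 0 \<and>
        (\<lambda>n \<omega>. x n i \<omega> - f i n \<omega>) \<in> lag_closure M x 1 \<and>
        (\<forall>n k j. k < n \<longrightarrow> expectation (\<lambda>\<omega>. f i n \<omega> * x k j \<omega>) = 0)" by blast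
    show ?thesis
      by (rule that[of f]) (use f in simp_all)
  qed
  have ysq: "sq_integrable M (y i n)" for i n
    by (rule lag_closure_sq_integrable[OF y])
  have y_stat: "expectation (\<lambda>\<omega>. y i n \<omega> * y j (n - int k) \<omega>) = expectation (\<lambda>\<omega>. y i 0 \<omega> * y j (- int k) \<omega>)" for i j n k
    using lag_closure_stationary[OF y[of i] y[of j], where n = 0 and h = n and k = "- int k"] by simp
  have xcl: "(\<lambda>n. x n i) \<in> lag_closure M x 0" for i
    using lag_span_closure[OF lag_span_lag[of 0 0 x i]] by simp
  have white: "expectation (\<lambda>\<omega>. y i n \<omega> * y j k \<omega>) = 0" if "k < n" for i j n k
    by (rule lag_closure_orthogonal[OF ysq y]) (use that in \<open>auto intro: orth\<close>)
  have white': "expectation (\<lambda>\<omega>. y i n \<omega> * y j k \<omega>) = 0" if "k \<noteq> n" for i j n k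
  proof (cases "k < n")
    case False
    then have "n < k" using that by simp
    from white[OF this, of j i] show ?thesis by (simp add: mult.commute)
  qed (rule white)
  have y_mean: "expectation (y i n) = 0" for i n
  proof -
    have "expectation (\<lambda>\<omega>. 1 * y i n \<omega>) = 0"
      by (rule lag_closure_orthogonal[OF sq_integrable_const y]) (simp add: mean)
    then show ?thesis by simp
  qed
  define S where "S i j = expectation (\<lambda>\<omega>. y i 0 \<omega> * y j 0 \<omega>)" for i j
  have S: "expectation (\<lambda>\<omega>. y i n \<omega> * y j n \<omega>) = S i j" for i j n
    using y_stat[of i n j 0] by (simp add: S_def)
  define r where "r k i j = expectation (\<lambda>\<omega>. x 0 i \<omega> * y j (- int k) \<omega>)" for k i j
  have r: "expectation (\<lambda>\<omega>. x n i \<omega> * y j (n - int k) \<omega>) = r k i j" for i j n k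
    using lag_closure_stationary[OF xcl[of i] y[of j], where n = 0 and h = n and k = "- int k"] by (simp add: r_def)
  \<comment> \<open>The normal equations for regressing \<open>x\<close> on the innovations at lag
    \<open>k\<close>. They are consistent even for singular \<open>S\<close>: a combination of
    innovations with zero variance has zero covariance with \<open>x\<close>.\<close>
  have "\<exists>c. \<forall>j. (\<Sum>l\<in>UNIV. c l * S l j) = r k i j" for k i
  proof (rule symmetric_form_solvable)
    show "S i j = S j i" for i j
      by (simp add: S_def mult.commute)
    fix v :: "'i \<Rightarrow> real" assume v: "\<And>j. (\<Sum>i\<in>UNIV. v i * S i j) = 0"
    let ?W = "\<lambda>\<omega>. \<Sum>j\<in>UNIV. v j * y j (- int k) \<omega>"
    have W: "sq_integrable M ?W"
      by (intro sq_integrable_sum sq_integrable_cmult ysq)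
    have "expectation (\<lambda>\<omega>. (?W \<omega>)\<^sup>2) = expectation (\<lambda>\<omega>. \<Sum>i\<in>UNIV. \<Sum>j\<in>UNIV. v j * (v i * (y i (- int k) \<omega> * y j (- int k) \<omega>)))"
      by (intro Bochner_Integration.integral_cong) (auto simp: power2_eq_square sum_product ac_simps)
    also have "\<dots> = (\<Sum>i\<in>UNIV. \<Sum>j\<in>UNIV. v j * (v i * S i j))"
      using sq_integrable_mult[OF ysq ysq] by (simp add: S)
    also have "\<dots> = (\<Sum>j\<in>UNIV. v j * (\<Sum>i\<in>UNIV. v i * S i j))"
      by (subst sum.swap) (simp add: sum_distrib_left)
    finally have "expectation (\<lambda>\<omega>. (?W \<omega>)\<^sup>2) = 0"
      using v by simp
    then have "\<bar>expectation (\<lambda>\<omega>. x 0 i \<omega> * ?W \<omega>)\<bar> \<le> 0"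
      using Cauchy_Schwarz_integral[OF sq[of 0 i] W] by simp
    moreover have "expectation (\<lambda>\<omega>. x 0 i \<omega> * ?W \<omega>) = (\<Sum>j\<in>UNIV. v j * r k i j)"
      using sq_integrable_mult[OF sq ysq]
      by (simp add: sum_distrib_left mult.left_commute r_def)
    ultimately show "(\<Sum>j\<in>UNIV. v j * r k i j) = 0" by simp
  qed
  then obtain c where c: "\<And>k i j. (\<Sum>l\<in>UNIV. c k i l * S l j) = r k i j"
    by metis
  have representation: "AE \<omega> in M. x n i \<omega> = (\<Sum>k<m. \<Sum>j\<in>UNIV. c k i j * y j (n - int k) \<omega>)" for n i
  proof -
    define T where "T = (\<lambda>n \<omega>. \<Sum>k<m. \<Sum>j\<in>UNIV. c k i j * y j (n - int k) \<omega>)"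
    define W where "W = (\<lambda>n \<omega>. x n i \<omega> - T n \<omega>)"
    have ycl: "(\<lambda>n. y j (n - int k)) \<in> lag_closure M x 0" for j k
      using lag_closure_mono[OF lag_closure_shift[OF y]] by blast
    have W: "W \<in> lag_closure M x 0"
      unfolding W_def T_def
      by (intro lag_closure_diff xcl lag_closure_sum lag_closure_cmult ycl)
    have Wsq: "sq_integrable M (W n)"
      by (rule lag_closure_sq_integrable[OF W])
    have exp_W: "expectation (\<lambda>\<omega>. W n \<omega> * u \<omega>) = expectation (\<lambda>\<omega>. x n i \<omega> * u \<omega>)
       - (\<Sum>k<m. \<Sum>j\<in>UNIV. c k i j * expectation (\<lambda>\<omega>. y j (n - int k) \<omega> * u \<omega>))" if "sq_integrable M u" for u
      using sq_integrable_mult[OF sq that] sq_integrable_mult[OF ysq that]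
      by (simp add: W_def T_def left_diff_distrib sum_distrib_right mult.assoc)
    \<comment> \<open>Whiteness leaves only the term of lag \<open>k\<close>, and there the normal
      equations apply.\<close>
    have W_y: "expectation (\<lambda>\<omega>. W n \<omega> * y j (n - int k) \<omega>) = 0" if "k < m" for j k
    proof -
      have "(\<Sum>k'<m. \<Sum>l\<in>UNIV. c k' i l * expectation (\<lambda>\<omega>. y l (n - int k') \<omega> * y j (n - int k) \<omega>))
          = (\<Sum>k'<m. if k' = k then r k i j else 0)"
        by (intro sum.cong refl) (auto simp: white' S c)
      also have "\<dots> = r k i j"
        using that by simp
      finally show ?thesis
        by (simp add: exp_W[OF ysq] r)
    qed
    \<comment> \<open>From lag \<open>m\<close> on both parts of \<open>W\<close> contribute
      nothing: \<open>x (n - k)\<close> is uncorrelated with \<open>x n\<close>, and it precedes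
      every innovation in the sum.\<close>
    have W_far: "expectation (\<lambda>\<omega>. W n \<omega> * x (n - int k) j \<omega>) = 0" if "k \<ge> m" for k j
      using that by (simp add: exp_W[OF sq] uncorrelated orth)
    \<comment> \<open>Backwards from lag \<open>m\<close>: \<open>x\<close> at a given lag is the innovation there plus a limit of combinations of larger lags.\<close>
    have W_x: "expectation (\<lambda>\<omega>. W n \<omega> * x (n - int (m - d)) j \<omega>) = 0" if "d \<le> m" for d j
      using that
    proof (induction d arbitrary: j rule: less_induct)
      case (less d)
      let ?k = "m - d"
      have far: "expectation (\<lambda>\<omega>. W n \<omega> * x (n - int k) j \<omega>) = 0" if k: "k > ?k" for k j
      proof (cases "k \<ge> m")
        case False
        then have "m - k < d" "m - k \<le> m" "m - (m - k) = k" using k by auto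
        with less.IH[of "m - k" j] show ?thesis by simp
      qed (rule W_far)
      show ?case
      proof (cases "d = 0")
        case False
        have "(\<lambda>n \<omega>. x (n - int ?k) j \<omega> - y j (n - int ?k) \<omega>) \<in> lag_closure M x (1 + ?k)"
          by (rule lag_closure_shift[OF past])
        from lag_closure_orthogonal[OF Wsq this, of n] far
        have "expectation (\<lambda>\<omega>. W n \<omega> * (x (n - int ?k) j \<omega> - y j (n - int ?k) \<omega>)) = 0"
          by simp
        moreover have "expectation (\<lambda>\<omega>. W n \<omega> * y j (n - int ?k) \<omega>) = 0"
          by (rule W_y) (use False less.prems in simp)
        ultimately show ?thesis
          using sq_integrable_mult[OF Wsq sq] sq_integrable_mult[OF Wsq ysq]
          by (simp add: right_diff_distrib)
      qed (use W_far in simp)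
    qed
    have "expectation (\<lambda>\<omega>. W n \<omega> * x (n - int k) j \<omega>) = 0" for k j
      using W_far[of k j] W_x[of "m - k" j] by (cases "k \<ge> m") auto
    then have "expectation (\<lambda>\<omega>. W n \<omega> * W n \<omega>) = 0"
      by (intro lag_closure_orthogonal[OF Wsq W])
    then have "AE \<omega> in M. (W n \<omega>)\<^sup>2 = 0"
      using sq_integrable_power2[OF Wsq]
      by (subst (asm) integral_nonneg_eq_0_iff_AE) (auto simp: power2_eq_square)
    then show ?thesis
      by (simp add: W_def T_def)
  qed
  show ?thesis
    by (rule that[of "\<lambda>n i. y i n" c]) (simp_all add: ysq y_mean white' S representation)
qed

end

section \<open>Second moments of Levy processes\<close>

text \<open>Cauchy's functional equation. The defect \<open>g t = f t - t * f 1\<close> is additive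
  and vanishes at \<open>1 / N\<close>, hence has period \<open>1 / N\<close> and is bounded by its
  values on \<open>[0, d]\<close>; a bounded additive function is 0.\<close>

lemma additive_bounded_imp_linear:
  fixes f :: "real \<Rightarrow> real"
  assumes add: "\<And>s h. 0 \<le> s \<Longrightarrow> 0 \<le> h \<Longrightarrow> f (s + h) = f s + f h"
    and bdd: "\<And>t. 0 \<le> t \<Longrightarrow> t \<le> d \<Longrightarrow> \<bar>f t\<bar> \<le> B" and d: "d > 0" and t: "t \<ge> 0"
  shows "f t = t * f 1"
proof -
  define g where "g t = f t - t * f 1" for t
  have g_add: "g (s + h) = g s + g h" if "0 \<le> s" "0 \<le> h" for s h
    using add[OF that] by (simp add: g_def distrib_right)
  have g0: "g 0 = 0"
    using g_add[of 0 0] by simp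
  have g_mult: "g (real n * s) = real n * g s" if "s \<ge> 0" for n s
  proof (induction n)
    case (Suc n)
    have "g (real (Suc n) * s) = g (real n * s + s)"
      by (simp add: distrib_right add.commute)
    also have "\<dots> = g (real n * s) + g s"
      using that by (intro g_add) auto
    finally show ?case using Suc by (simp add: distrib_right)
  qed (simp add: g0)
  obtain N :: nat where N: "N > 0" "1 / real N < d"
    using real_arch_inverse[of d] d by (auto simp: inverse_eq_divide)
  have "real N * g (1 / real N) = 0"
    using g_mult[of "1 / real N" N] N by (simp add: g_def)
  then have gN: "g (1 / real N) = 0"
    using N by simp
  define B' where "B' = B + d * \<bar>f 1\<bar>"
  have small: "\<bar>g s\<bar> \<le> B'" if "0 \<le> s" "s \<le> d" for s
  proof -
    have "\<bar>g s\<bar> \<le> \<bar>f s\<bar> + \<bar>s * f 1\<bar>"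
      by (simp add: g_def)
    also have "\<bar>s * f 1\<bar> \<le> d * \<bar>f 1\<bar>"
      using that by (simp add: abs_mult mult_right_mono)
    finally show ?thesis
      using bdd[OF that] by (simp add: B'_def)
  qed
  have all: "\<bar>g s\<bar> \<le> B'" if "0 \<le> s" for s
  proof -
    define k where "k = nat \<lfloor>s * real N\<rfloor>"
    have k: "real k \<le> s * real N" "s * real N < real k + 1"
      using that by (auto simp: k_def)
    define e where "e = s - real k * (1 / real N)"
    have e: "0 \<le> e" "e \<le> d"
    proof -
      have "e * real N < 1"
        using k N by (simp add: e_def left_diff_distrib)
      then have "e < 1 / real N"
        using N by (simp add: field_simps)
      then show "e \<le> d" using N by simp
      show "0 \<le> e"
        using k N by (simp add: e_def field_simps)
    qed
    have "g s = g (real k * (1 / real N) + e)"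
      by (simp add: e_def)
    also have "\<dots> = real k * g (1 / real N) + g e"
      using e g_mult[of "1 / real N" k] by (subst g_add) auto
    finally show ?thesis
      using small[OF e] gN by simp
  qed
  have "g t = 0"
  proof (rule ccontr)
    assume "g t \<noteq> 0"
    then obtain n :: nat where "B' < real n * \<bar>g t\<bar>"
      using reals_Archimedean3[of "\<bar>g t\<bar>"] by auto
    then show False
      using all[of "real n * t"] t g_mult[OF t, of n] by (simp add: abs_mult)
  qed
  then show ?thesis by (simp add: g_def)
qed

text \<open>Fubini: \<open>U + v\<close> is square integrable for almost every value \<open>v\<close> of \<open>V\<close>.\<close>

lemma (in prob_space) indep_var_sq_integrable:
  assumes ind: "indep_var borel U borel V" and sum: "sq_integrable M (\<lambda>\<omega>. U \<omega> + V \<omega>)"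
  shows "sq_integrable M U"
proof -
  have [measurable]: "U \<in> borel_measurable M" "V \<in> borel_measurable M"
    using indep_var_rv1[OF ind] indep_var_rv2[OF ind] by auto
  interpret U: prob_space "distr M borel U" by (rule prob_space_distr) simp
  interpret V: prob_space "distr M borel V" by (rule prob_space_distr) simp
  interpret P: pair_sigma_finite "distr M borel U" "distr M borel V" ..
  have eq: "distr M borel U \<Otimes>\<^sub>M distr M borel V = distr M (borel \<Otimes>\<^sub>M borel) (\<lambda>\<omega>. (U \<omega>, V \<omega>))"
    using ind by (simp add: indep_var_distribution_eq)
  have "(\<integral>\<^sup>+v. \<integral>\<^sup>+u. ennreal ((u + v)\<^sup>2) \<partial>distr M borel U \<partial>distr M borel V)
      = (\<integral>\<^sup>+z. ennreal ((fst z + snd z)\<^sup>2) \<partial>(distr M borel U \<Otimes>\<^sub>M distr M borel V))"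
    by (subst P.nn_integral_snd[symmetric]) (auto simp: case_prod_beta')
  also have "\<dots> = (\<integral>\<^sup>+\<omega>. ennreal ((U \<omega> + V \<omega>)\<^sup>2) \<partial>M)"
    unfolding eq by (subst nn_integral_distr) auto
  also have "\<dots> < \<infinity>"
    using sum by (simp add: sq_integrable_def integrable_iff_bounded)
  finally have "AE v in distr M borel V. (\<integral>\<^sup>+u. ennreal ((u + v)\<^sup>2) \<partial>distr M borel U) \<noteq> \<infinity>"
    by (intro nn_integral_PInf_AE) auto
  then obtain v where v: "(\<integral>\<^sup>+u. ennreal ((u + v)\<^sup>2) \<partial>distr M borel U) \<noteq> \<infinity>"
    using V.AE_False by (metis (mono_tags, lifting) eventually_mono)
  have "(\<integral>\<^sup>+\<omega>. ennreal ((U \<omega> + v)\<^sup>2) \<partial>M) < \<infinity>"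
    using v by (subst (asm) nn_integral_distr) (auto simp: top.not_eq_extremum)
  then have "sq_integrable M (\<lambda>\<omega>. U \<omega> + v)"
    by (simp add: sq_integrable_def integrable_iff_bounded)
  from sq_integrable_diff[OF this sq_integrable_const[of v]] show ?thesis by simp
qed

locale sq_levy = prob_space M for M :: "'w measure" +
  fixes X :: "real \<Rightarrow> 'w \<Rightarrow> real^'d"
  assumes levy: "levy_process M X"
    and sq1: "sq_integrable M (\<lambda>\<omega>. X 1 \<omega> $ i)"
    and mean1: "expectation (\<lambda>\<omega>. X 1 \<omega> $ i) = 0"
begin

section \<open>Moments of a one-sided Levy process\<close>

lemma measurable_X [measurable]: "0 \<le> t \<Longrightarrow> X t \<in> borel_measurable M"
  using levy by (simp add: levy_process_def)

lemma measurable_component: "0 \<le> t \<Longrightarrow> (\<lambda>\<omega>. X t \<omega> $ i) \<in> borel_measurable M"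
  by (rule measurable_compose[OF measurable_X]) simp_all

lemma start: "AE \<omega> in M. X 0 \<omega> = 0"
  using levy by (simp add: levy_process_def)

lemma sq0: "sq_integrable M (\<lambda>\<omega>. X 0 \<omega> $ i)"
  by (rule sq_integrable_cong_AE[OF sq_integrable_zero])
    (use start in \<open>auto elim!: eventually_mono intro: measurable_component\<close>)

lemma indep_increments:
  assumes "0 \<le> a" "a \<le> b" "b \<le> c" "c \<le> d"
  shows "indep_var borel (\<lambda>\<omega>. X b \<omega> $ i - X a \<omega> $ i) borel (\<lambda>\<omega>. X d \<omega> $ j - X c \<omega> $ j)"
proof -
  \<comment> \<open>Three consecutive increments; the middle one bridges the gap from
    \<open>b\<close> to \<open>c\<close>, and only those with index 0 and 2 are kept.\<close>
  define t :: "nat \<Rightarrow> real" where "t k = (if k = 0 then a else if k = 1 then b else if k = 2 then c else d)" for k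
  have "\<forall>k<3. t k \<le> t (Suc k)" "0 \<le> t 0"
    using assms by (auto simp: t_def less_Suc_eq numeral_3_eq_3)
  then have "indep_vars (\<lambda>_. borel) (\<lambda>k \<omega>. X (t (Suc k)) \<omega> - X (t k) \<omega>) {..<3}"
    using levy unfolding levy_process_def by blast
  then have "indep_var (PiM {0} (\<lambda>_. borel)) (\<lambda>\<omega>. \<lambda>k\<in>{0}. X (t (Suc k)) \<omega> - X (t k) \<omega>)
      (PiM {2} (\<lambda>_. borel)) (\<lambda>\<omega>. \<lambda>k\<in>{2}. X (t (Suc k)) \<omega> - X (t k) \<omega>)"
    by (rule indep_var_restrict) auto
  moreover have "(\<lambda>f. f 0 $ i) \<in> borel_measurable (PiM {0::nat} (\<lambda>_. borel :: (real^'d) measure))"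
    "(\<lambda>f. f 2 $ j) \<in> borel_measurable (PiM {2::nat} (\<lambda>_. borel :: (real^'d) measure))"
    by (rule measurable_compose[OF _ borel_measurable_nth], rule measurable_component_singleton, simp)+
  ultimately have "indep_var borel ((\<lambda>f. f 0 $ i) \<circ> (\<lambda>\<omega>. \<lambda>k\<in>{0}. X (t (Suc k)) \<omega> - X (t k) \<omega>))
      borel ((\<lambda>f. f 2 $ j) \<circ> (\<lambda>\<omega>. \<lambda>k\<in>{2}. X (t (Suc k)) \<omega> - X (t k) \<omega>))"
    by (rule indep_var_compose)
  then show ?thesis by (simp add: o_def t_def)
qed

lemma increment_distr:
  assumes "0 \<le> s" "0 \<le> h"
  shows "distr M borel (\<lambda>\<omega>. X (s + h) \<omega> - X s \<omega>) = distr M borel (X h)"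
  using levy assms by (simp add: levy_process_def)

lemma integral_increment:
  fixes \<phi> :: "real^'d \<Rightarrow> real"
  assumes "0 \<le> s" "0 \<le> h" and [measurable]: "\<phi> \<in> borel_measurable borel"
  shows "expectation (\<lambda>\<omega>. \<phi> (X (s + h) \<omega> - X s \<omega>)) = expectation (\<lambda>\<omega>. \<phi> (X h \<omega>))"
proof -
  have "expectation (\<lambda>\<omega>. \<phi> (X (s + h) \<omega> - X s \<omega>)) = (\<integral>v. \<phi> v \<partial>distr M borel (\<lambda>\<omega>. X (s + h) \<omega> - X s \<omega>))"
    using assms by (subst integral_distr) auto
  also have "\<dots> = expectation (\<lambda>\<omega>. \<phi> (X h \<omega>))"
    using assms by (subst increment_distr) (auto simp: integral_distr)
  finally show ?thesis .
qed

lemma sq_integrable_increment: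
  assumes "0 \<le> s" "0 \<le> h"
  shows "sq_integrable M (\<lambda>\<omega>. X (s + h) \<omega> $ i - X s \<omega> $ i) \<longleftrightarrow> sq_integrable M (\<lambda>\<omega>. X h \<omega> $ i)"
proof -
  have "integrable M (\<lambda>\<omega>. ((X (s + h) \<omega> - X s \<omega>) $ i)\<^sup>2)
      \<longleftrightarrow> integrable (distr M borel (\<lambda>\<omega>. X (s + h) \<omega> - X s \<omega>)) (\<lambda>v. (v $ i)\<^sup>2)"
    using assms by (subst integrable_distr_eq) auto
  also have "\<dots> \<longleftrightarrow> integrable M (\<lambda>\<omega>. (X h \<omega> $ i)\<^sup>2)"
    using assms by (subst increment_distr) (auto simp: integrable_distr_eq)
  finally show ?thesis
    using assms by (auto simp: sq_integrable_def intro!: borel_measurable_diff measurable_component)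
qed

text \<open>For \<open>t \<le> 1\<close> the variable \<open>X 1 - X 0\<close> is a sum of two
  independent increments, one of them \<open>X t - X 0\<close>, which therefore inherits square
  integrability. Larger times are reached by \<open>n\<close> increments of length
  \<open>t / n \<le> 1\<close>.\<close>

lemma sq: "0 \<le> t \<Longrightarrow> sq_integrable M (\<lambda>\<omega>. X t \<omega> $ i)"
proof -
  have small: "sq_integrable M (\<lambda>\<omega>. X t \<omega> $ i)" if t: "0 \<le> t" "t \<le> 1" for t
  proof -
    have "sq_integrable M (\<lambda>\<omega>. X t \<omega> $ i - X 0 \<omega> $ i)"
      by (rule indep_var_sq_integrable[OF indep_increments[of 0 t t 1 i i]])
        (use t sq_integrable_diff[OF sq1[of i] sq0[of i]] in auto)
    from sq_integrable_add[OF this sq0[of i]] show ?thesis by simp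
  qed
  assume t: "0 \<le> t"
  \<comment> \<open>The \<open>Suc\<close> keeps the divisor positive when
    \<open>t = 0\<close>.\<close>
  define n where "n = Suc (nat \<lceil>t\<rceil>)"
  have n: "n > 0" "t \<le> real n"
    by (auto simp: n_def) linarith
  define u where "u = t / real n"
  have u: "0 \<le> u" "u \<le> 1"
    using n t by (auto simp: u_def)
  have "sq_integrable M (\<lambda>\<omega>. X (real k * u) \<omega> $ i)" for k
  proof (induction k)
    case (Suc k)
    have "sq_integrable M (\<lambda>\<omega>. X (real k * u + u) \<omega> $ i - X (real k * u) \<omega> $ i)"
      using u small by (subst sq_integrable_increment) auto
    from sq_integrable_add[OF this Suc] show ?case
      by (simp add: distrib_right add.commute)
  qed (simp add: sq0)
  from this[of n] show ?thesis
    using n by (simp add: u_def)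
qed

definition mu :: "'d \<Rightarrow> real \<Rightarrow> real" where
  "mu i t = expectation (\<lambda>\<omega>. X t \<omega> $ i)"

definition second :: "'d \<Rightarrow> 'd \<Rightarrow> real \<Rightarrow> real" where
  "second i j t = expectation (\<lambda>\<omega>. X t \<omega> $ i * X t \<omega> $ j)"

lemma integrable_X: "0 \<le> t \<Longrightarrow> integrable M (\<lambda>\<omega>. X t \<omega> $ i)"
  by (rule sq_integrable_imp_integrable[OF sq])

lemma mu_add:
  assumes "0 \<le> s" "0 \<le> h"
  shows "mu i (s + h) = mu i s + mu i h"
  using integral_increment[OF assms, of "\<lambda>v. v $ i"] integrable_X[of s i] integrable_X[of "s + h" i] assms
  by (simp add: mu_def)

lemma past_increment:
  assumes "0 \<le> s" "0 \<le> h"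
  shows "expectation (\<lambda>\<omega>. X s \<omega> $ i * (X (s + h) \<omega> $ j - X s \<omega> $ j)) = mu i s * mu j h"
proof -
  \<comment> \<open>Independence concerns increments, so \<open>X s\<close> is replaced by
    \<open>X s - X 0\<close>, which is almost surely the same.\<close>
  have "expectation (\<lambda>\<omega>. X s \<omega> $ i * (X (s + h) \<omega> $ j - X s \<omega> $ j))
      = expectation (\<lambda>\<omega>. (X s \<omega> $ i - X 0 \<omega> $ i) * (X (s + h) \<omega> $ j - X s \<omega> $ j))"
    using assms by (intro integral_cong_AE) (use start in \<open>auto elim!: eventually_mono intro!: borel_measurable_times borel_measurable_diff measurable_component\<close>)
  also have "\<dots> = expectation (\<lambda>\<omega>. X s \<omega> $ i - X 0 \<omega> $ i) * expectation (\<lambda>\<omega>. X (s + h) \<omega> $ j - X s \<omega> $ j)"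
    using assms by (intro indep_var_lebesgue_integral indep_increments)
      (auto intro!: Bochner_Integration.integrable_diff integrable_X)
  also have "expectation (\<lambda>\<omega>. X s \<omega> $ i - X 0 \<omega> $ i) = mu i s"
    unfolding mu_def using assms by (intro integral_cong_AE) (use start in \<open>auto elim!: eventually_mono intro!: borel_measurable_times borel_measurable_diff measurable_component\<close>)
  also have "expectation (\<lambda>\<omega>. X (s + h) \<omega> $ j - X s \<omega> $ j) = mu j h"
    using integral_increment[OF assms, of "\<lambda>v. v $ j"] by (simp add: mu_def)
  finally show ?thesis .
qed

lemma second_add:
  assumes "0 \<le> s" "0 \<le> h"
  shows "second i j (s + h) = second i j s + mu i s * mu j h + mu i h * mu j s + second i j h"
proof -
  let ?D = "\<lambda>i \<omega>. X (s + h) \<omega> $ i - X s \<omega> $ i"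
  have D: "sq_integrable M (?D i)" and Xs: "sq_integrable M (\<lambda>\<omega>. X s \<omega> $ i)" for i
    using assms sq by (auto intro: sq_integrable_diff)
  have "second i j (s + h) = expectation (\<lambda>\<omega>. X s \<omega> $ i * X s \<omega> $ j + X s \<omega> $ i * ?D j \<omega>
      + X s \<omega> $ j * ?D i \<omega> + ?D i \<omega> * ?D j \<omega>)"
    unfolding second_def by (intro Bochner_Integration.integral_cong) (auto simp: algebra_simps)
  also have "\<dots> = second i j s + mu i s * mu j h + mu j s * mu i h + expectation (\<lambda>\<omega>. ?D i \<omega> * ?D j \<omega>)"
    using sq_integrable_mult[OF Xs Xs] sq_integrable_mult[OF Xs D] sq_integrable_mult[OF D D]
    by (simp add: past_increment[OF assms] second_def)
  also have "expectation (\<lambda>\<omega>. ?D i \<omega> * ?D j \<omega>) = second i j h"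
    using integral_increment[OF assms, of "\<lambda>v. v $ i * v $ j"] by (simp add: second_def)
  finally show ?thesis by (simp add: mult.commute)
qed

text \<open>
  The mean is additive, but linear only if it is locally bounded: Chebyshev, with the variance
  bounded by that at time \<open>1\<close>, together with stochastic continuity at \<open>0\<close> gives the bound.
\<close>

lemma mu_zero: assumes "0 \<le> t" shows "mu i t = 0"
proof -
  \<comment> \<open>Unlike the mean, the variance is nonnegative as well as additive, hence monotone
    in time.\<close>
  define V where "V t = second i i t - (mu i t)\<^sup>2" for t
  have V_eq: "V t = variance (\<lambda>\<omega>. X t \<omega> $ i)" if "0 \<le> t" for t
    using variance_eq[OF integrable_X[OF that, of i] sq_integrable_power2[OF sq[OF that, of i]]]
    by (simp add: V_def second_def mu_def power2_eq_square)
  have V_nonneg: "0 \<le> V t" if "0 \<le> t" for t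
    using V_eq[OF that] by simp
  have V_add: "V (s + h) = V s + V h" if "0 \<le> s" "0 \<le> h" for s h
    using that by (simp add: V_def second_add mu_add power2_eq_square algebra_simps)
  have V_le: "V t \<le> V 1" if "0 \<le> t" "t \<le> 1" for t
    using V_add[of t "1 - t"] V_nonneg[of "1 - t"] that by simp
  \<comment> \<open>With this \<open>a\<close> Chebyshev's bound \<open>V 1 / a^2\<close> is at most
    1/4; adding 1 keeps \<open>a\<close> positive when the variance is 0.\<close>
  define a where "a = 2 * sqrt (V 1) + 1"
  have a: "a > 0" "V 1 / a\<^sup>2 \<le> 1 / 4"
  proof -
    have "0 \<le> sqrt (V 1)" using V_nonneg[of 1] by simp
    then show "a > 0" unfolding a_def by linarith
    have "(2 * sqrt (V 1))\<^sup>2 \<le> a\<^sup>2"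
      unfolding a_def using \<open>0 \<le> sqrt (V 1)\<close> by (intro power_mono) auto
    then have "4 * V 1 \<le> a\<^sup>2"
      using V_nonneg[of 1] by (simp add: power_mult_distrib)
    then show "V 1 / a\<^sup>2 \<le> 1 / 4"
      using \<open>a > 0\<close> by (simp add: field_simps)
  qed
  have "((\<lambda>s. prob {\<omega>\<in>space M. norm (X s \<omega> - X 0 \<omega>) > 1}) \<longlongrightarrow> 0) (at 0 within {0..})"
    using levy unfolding levy_process_def by simp
  then have "\<forall>\<^sub>F s in at 0 within {0..}. prob {\<omega>\<in>space M. norm (X s \<omega> - X 0 \<omega>) > 1} < 1 / 4"
    by (rule order_tendstoD) simp
  then obtain d where d: "d > 0"
    and small: "\<And>s. 0 \<le> s \<Longrightarrow> s \<noteq> 0 \<Longrightarrow> \<bar>s\<bar> < d \<Longrightarrow> prob {\<omega>\<in>space M. norm (X s \<omega> - X 0 \<omega>) > 1} < 1 / 4"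
    by (auto simp: eventually_at dist_real_def)
  have "\<bar>mu i s\<bar> \<le> 1 + a" if s: "0 \<le> s" "s \<le> min (d / 2) 1" for s
  proof (cases "s = 0")
    case True
    have "mu i 0 = 0" using mu_add[of 0 0] by simp
    then show ?thesis using True a by simp
  next
    case False
    note [measurable] = measurable_X[OF s(1)] measurable_X[of 0]
    let ?A = "{\<omega>\<in>space M. norm (X s \<omega> - X 0 \<omega>) > 1}"
    let ?B = "{\<omega>\<in>space M. a \<le> \<bar>X s \<omega> $ i - mu i s\<bar>}"
    let ?C = "{\<omega>\<in>space M. X 0 \<omega> \<noteq> 0}"
    have sets: "?A \<in> events" "?B \<in> events" "?C \<in> events"
      by measurable
    have "prob ?A < 1 / 4"
      by (rule small) (use s False d in auto)
    moreover have "prob ?B \<le> 1 / 4"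
    proof -
      have "prob ?B \<le> variance (\<lambda>\<omega>. X s \<omega> $ i) / a\<^sup>2"
        unfolding mu_def using s sq[of s i] a
        by (intro Chebyshev_inequality) (auto simp: sq_integrable_def)
      also have "\<dots> \<le> V 1 / a\<^sup>2"
        using V_le[of s] V_eq[of s] s by (intro divide_right_mono) auto
      finally show ?thesis using a(2) by linarith
    qed
    moreover have "prob ?C = 0"
      using start sets by (subst prob_eq_0) auto
    moreover have "prob (?A \<union> ?B \<union> ?C) \<le> prob ?A + prob ?B + prob ?C"
    proof -
      have "prob (?A \<union> ?B) \<le> prob ?A + prob ?B" "prob (?A \<union> ?B \<union> ?C) \<le> prob (?A \<union> ?B) + prob ?C"
        using sets by (intro measure_Un_le; simp)+
      then show ?thesis by linarith
    qed
    \<comment> \<open>The exceptional events have total probability below 1, so some outcome avoids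
      them all. There the component is at most 1 in absolute value and within \<open>a\<close> of
      its mean, which bounds the mean.\<close>
    ultimately have "prob (?A \<union> ?B \<union> ?C) < 1"
      by linarith
    then have "?A \<union> ?B \<union> ?C \<noteq> space M"
      using prob_space by auto
    then obtain \<omega> where \<omega>: "\<omega> \<in> space M" "norm (X s \<omega> - X 0 \<omega>) \<le> 1" "\<bar>X s \<omega> $ i - mu i s\<bar> < a" "X 0 \<omega> = 0"
      by (force simp: not_le not_less)
    then have "\<bar>X s \<omega> $ i\<bar> \<le> 1"
      using component_le_norm_cart[of "X s \<omega>" i] by simp
    then show ?thesis using \<omega>(3) by linarith
  qed
  then have "mu i t = t * mu i 1"
    using d assms
    by (intro additive_bounded_imp_linear[where d = "min (d / 2) 1" and B = "1 + a"] mu_add) auto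
  then show ?thesis
    by (simp add: mu_def mean1)
qed

text \<open>Since the means vanish, the mixed terms drop out and second moments are additive. The
  diagonal ones are also nonnegative, hence monotone, and by Cauchy-Schwarz they bound the others on
  \<open>[0, 1]\<close>.\<close>

lemma second_linear:
  assumes "0 \<le> t"
  shows "second i j t = t * second i j 1"
proof -
  have add: "second i j (s + h) = second i j s + second i j h" if "0 \<le> s" "0 \<le> h" for s h i j
    using second_add[OF that] that by (simp add: mu_zero)
  have diag: "0 \<le> second i i t" "t \<le> 1 \<Longrightarrow> second i i t \<le> second i i 1" if "0 \<le> t" for t i
  proof -
    have nn: "0 \<le> second i i t" for t by (simp add: second_def)
    show "0 \<le> second i i t" by (rule nn)
    show "second i i t \<le> second i i 1" if "t \<le> 1"
      using add[of t "1 - t" i i] nn[of "1 - t"] that \<open>0 \<le> t\<close> by simp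
  qed
  have "\<bar>second i j t\<bar> \<le> second i i 1 + second j j 1" if t: "0 \<le> t" "t \<le> 1" for t
  proof -
    have "\<bar>second i j t\<bar> \<le> sqrt (second i i t) * sqrt (second j j t)"
      using Cauchy_Schwarz_integral[OF sq[of t i] sq[of t j]] t by (simp add: second_def power2_eq_square)
    also have "\<dots> \<le> second i i t + second j j t"
    proof -
      have "0 \<le> sqrt (second i i t) * sqrt (second j j t)"
        using diag(1)[OF t(1)] by simp
      moreover have "2 * sqrt (second i i t) * sqrt (second j j t) \<le> second i i t + second j j t"
        using sum_squares_bound[of "sqrt (second i i t)" "sqrt (second j j t)"] diag(1)[OF t(1)]
        by simp
      ultimately show ?thesis by linarith
    qed
    also have "\<dots> \<le> second i i 1 + second j j 1"
      using diag(2)[OF t, of i] diag(2)[OF t, of j] by simp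
    finally show ?thesis .
  qed
  from additive_bounded_imp_linear[OF add this zero_less_one assms] show ?thesis .
qed

text \<open>The increment after \<open>min s t\<close> is centred and independent of the earlier
  value, so only the common part contributes, as for Brownian motion.\<close>

lemma covariance:
  assumes "0 \<le> s" "0 \<le> t"
  shows "expectation (\<lambda>\<omega>. X s \<omega> $ i * X t \<omega> $ j) = min s t * second i j 1"
proof -
  have le: "expectation (\<lambda>\<omega>. X s \<omega> $ i * X t \<omega> $ j) = s * second i j 1" if "0 \<le> s" "s \<le> t" for s t i j
  proof -
    have "expectation (\<lambda>\<omega>. X s \<omega> $ i * (X (s + (t - s)) \<omega> $ j - X s \<omega> $ j)) = mu i s * mu j (t - s)"
      by (rule past_increment) (use that in auto)
    then have "expectation (\<lambda>\<omega>. X s \<omega> $ i * X t \<omega> $ j - X s \<omega> $ i * X s \<omega> $ j) = 0"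
      using that by (simp add: mu_zero right_diff_distrib)
    then have "expectation (\<lambda>\<omega>. X s \<omega> $ i * X t \<omega> $ j) = second i j s"
      using sq_integrable_mult[OF sq sq, of s t i j] sq_integrable_mult[OF sq sq, of s s i j] that
      by (simp add: second_def)
    then show ?thesis using second_linear[OF that(1), of i j] by simp
  qed
  show ?thesis
  proof (cases "s \<le> t")
    case False
    then show ?thesis
      using le[of t s j i] assms by (simp add: mult.commute second_def)
  qed (use le assms in simp)
qed

end

section \<open>The isometry of the stochastic integral\<close>

lemma sq_integrable_component:
  fixes U :: "'w \<Rightarrow> real^'d"
  assumes [measurable]: "U \<in> borel_measurable M" and "integrable M (\<lambda>\<omega>. (norm (U \<omega>))\<^sup>2)"
  shows "sq_integrable M (\<lambda>\<omega>. U \<omega> $ i)"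
  unfolding sq_integrable_def
proof
  show "(\<lambda>\<omega>. U \<omega> $ i) \<in> borel_measurable M"
    by (rule measurable_compose[OF assms(1) borel_measurable_nth])
  then have [measurable]: "(\<lambda>\<omega>. U \<omega> $ i) \<in> borel_measurable M" .
  show "integrable M (\<lambda>\<omega>. (U \<omega> $ i)\<^sup>2)"
  proof (rule Bochner_Integration.integrable_bound[OF assms(2)])
    show "AE \<omega> in M. norm ((U \<omega> $ i)\<^sup>2) \<le> norm ((norm (U \<omega>))\<^sup>2)"
      by (intro AE_I2) (simp add: abs_le_square_iff[symmetric] component_le_norm_cart)
  qed measurable
qed

text \<open>\<open>(|s| + |t| - |s - t|) / 2\<close> is the covariance kernel of two-sided Brownian
  motion; its second difference over two intervals is the length of their overlap.\<close>

lemma overlap_integral: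
  fixes a b c d :: real
  assumes "a \<le> b" "c \<le> d"
  shows "(\<integral>s. indicator {a<..b} s * indicator {c<..d} s \<partial>lborel)
       = (\<bar>b\<bar> + \<bar>d\<bar> - \<bar>b - d\<bar>) / 2 - (\<bar>b\<bar> + \<bar>c\<bar> - \<bar>b - c\<bar>) / 2
         - (\<bar>a\<bar> + \<bar>d\<bar> - \<bar>a - d\<bar>) / 2 + (\<bar>a\<bar> + \<bar>c\<bar> - \<bar>a - c\<bar>) / 2"
proof -
  have "{a<..b} \<inter> {c<..d} = {max a c<..min b d}"
    by auto
  then have "(\<integral>s. indicator {a<..b} s * indicator {c<..d} s \<partial>lborel) = measure lborel {max a c<..min b d}"
    by (simp flip: indicator_inter_arith)
  also have "\<dots> = max 0 (min b d - max a c)"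
    by (cases "max a c \<le> min b d") auto
  also have "\<dots> = (\<bar>b\<bar> + \<bar>d\<bar> - \<bar>b - d\<bar>) / 2 - (\<bar>b\<bar> + \<bar>c\<bar> - \<bar>b - c\<bar>) / 2
         - (\<bar>a\<bar> + \<bar>d\<bar> - \<bar>a - d\<bar>) / 2 + (\<bar>a\<bar> + \<bar>c\<bar> - \<bar>a - c\<bar>) / 2"
    using assms by (simp add: max_def min_def abs_if)
  finally show ?thesis .
qed

locale two_sided_sq_levy = prob_space M for M :: "'w measure" +
  fixes L1 L2 L :: "real \<Rightarrow> 'w \<Rightarrow> real^'d"
  assumes two_sided: "two_sided_levy M L1 L2 L"
    and mean: "(\<integral>\<omega>. L1 1 \<omega> \<partial>M) = 0"
    and sq_norm: "integrable M (\<lambda>\<omega>. (norm (L1 1 \<omega>))\<^sup>2)"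
begin

section \<open>Second moments of the two-sided Levy process\<close>

lemma levy12: "levy_process M L1" "levy_process M L2"
  using two_sided by (auto simp: two_sided_levy_def)

lemma measurable_12 [measurable]:
  "0 \<le> t \<Longrightarrow> L1 t \<in> borel_measurable M" "0 \<le> t \<Longrightarrow> L2 t \<in> borel_measurable M"
  using levy12 by (auto simp: levy_process_def)

lemma measurable_L [measurable]: "L t \<in> borel_measurable M"
  using two_sided by (simp add: two_sided_levy_def)

lemma same_marginal:
  assumes "0 \<le> t"
  shows "distr M borel (L1 t) = distr M borel (L2 t)"
proof -
  let ?P = "\<Pi>\<^sub>M t\<in>{0..}. borel :: (real^'d) measure"
  have marg: "distr M borel (X t) = distr (distr M ?P (\<lambda>\<omega>. \<lambda>t\<in>{0..}. X t \<omega>)) borel (\<lambda>f. f t)"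
    if "\<And>t. 0 \<le> t \<Longrightarrow> X t \<in> borel_measurable M" for X
  proof -
    have "(\<lambda>f. f t) \<in> measurable ?P borel"
      by (rule measurable_component_singleton) (use assms in simp)
    moreover have "(\<lambda>\<omega>. \<lambda>t\<in>{0..}. X t \<omega>) \<in> measurable M ?P"
      by (rule measurable_restrict) (use that in simp)
    ultimately show ?thesis
      using assms by (subst distr_distr) (auto simp: o_def)
  qed
  show ?thesis
    using marg[of L1, OF measurable_12(1)] marg[of L2, OF measurable_12(2)] two_sided
    by (simp add: two_sided_levy_def)
qed

lemma sq_levy1: "sq_levy M L1"
proof
  show "levy_process M L1" by (rule levy12)
  show sq: "sq_integrable M (\<lambda>\<omega>. L1 1 \<omega> $ i)" for i
    by (rule sq_integrable_component) (use sq_norm in auto)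
  have "sq_integrable M (\<lambda>\<omega>. norm (L1 1 \<omega>))"
    using sq_norm by (simp add: sq_integrable_def)
  then have "integrable M (\<lambda>\<omega>. norm (L1 1 \<omega>))"
    by (rule sq_integrable_imp_integrable)
  then have "integrable M (L1 1)"
    by (rule integrable_norm_cancel) simp
  from integral_bounded_linear[OF bounded_linear_vec_nth this]
  show "expectation (\<lambda>\<omega>. L1 1 \<omega> $ i) = 0" for i
    by (simp add: mean)
qed

interpretation X1: sq_levy M L1 by (rule sq_levy1)

lemma integral_marginal:
  fixes \<phi> :: "real^'d \<Rightarrow> real"
  assumes [measurable]: "\<phi> \<in> borel_measurable borel"
  shows "expectation (\<lambda>\<omega>. \<phi> (L2 1 \<omega>)) = expectation (\<lambda>\<omega>. \<phi> (L1 1 \<omega>))"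
proof -
  have "expectation (\<lambda>\<omega>. \<phi> (L2 1 \<omega>)) = (\<integral>v. \<phi> v \<partial>distr M borel (L2 1))"
    by (subst integral_distr) auto
  also have "\<dots> = expectation (\<lambda>\<omega>. \<phi> (L1 1 \<omega>))"
    by (subst same_marginal[symmetric]) (auto simp: integral_distr)
  finally show ?thesis .
qed

lemma sq_levy2: "sq_levy M L2"
proof
  show "levy_process M L2" by (rule levy12)
  show "expectation (\<lambda>\<omega>. L2 1 \<omega> $ i) = 0" for i
    using integral_marginal[of "\<lambda>v. v $ i"] X1.mean1 by simp
  have "integrable M (\<lambda>\<omega>. (L2 1 \<omega> $ i)\<^sup>2) \<longleftrightarrow> integrable (distr M borel (L2 1)) (\<lambda>v. (v $ i)\<^sup>2)" for i
    by (subst integrable_distr_eq) auto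
  moreover have "\<dots> i \<longleftrightarrow> integrable M (\<lambda>\<omega>. (L1 1 \<omega> $ i)\<^sup>2)" for i
    by (subst same_marginal[symmetric]) (auto simp: integrable_distr_eq)
  ultimately show "sq_integrable M (\<lambda>\<omega>. L2 1 \<omega> $ i)" for i
    using X1.sq1[of i] measurable_compose[OF measurable_12(2) borel_measurable_nth, of 1 i]
    by (simp add: sq_integrable_def)
qed

interpretation X2: sq_levy M L2 by (rule sq_levy2)

text \<open>Since \<open>L1 1\<close> is centred, this is its covariance matrix
  \<open>\<Sigma>_L\<close>.\<close>

definition S :: "'d \<Rightarrow> 'd \<Rightarrow> real" where
  "S i j = expectation (\<lambda>\<omega>. L1 1 \<omega> $ i * L1 1 \<omega> $ j)"

lemma cov1: "0 \<le> s \<Longrightarrow> 0 \<le> t \<Longrightarrow> expectation (\<lambda>\<omega>. L1 s \<omega> $ i * L1 t \<omega> $ j) = min s t * S i j"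
  using X1.covariance[of s t i j] by (simp add: S_def X1.second_def)

lemma cov2: "0 \<le> s \<Longrightarrow> 0 \<le> t \<Longrightarrow> expectation (\<lambda>\<omega>. L2 s \<omega> $ i * L2 t \<omega> $ j) = min s t * S i j"
  using X2.covariance[of s t i j] integral_marginal[of "\<lambda>v. v $ i * v $ j"] by (simp add: S_def X2.second_def)

lemma cov12:
  assumes "0 \<le> s" "0 \<le> t"
  shows "expectation (\<lambda>\<omega>. L1 s \<omega> $ i * L2 t \<omega> $ j) = 0"
proof -
  let ?P = "\<Pi>\<^sub>M t\<in>{0..}. borel :: (real^'d) measure"
  have "indep_var ?P (\<lambda>\<omega>. \<lambda>t\<in>{0..}. L1 t \<omega>) ?P (\<lambda>\<omega>. \<lambda>t\<in>{0..}. L2 t \<omega>)"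
    using two_sided by (simp add: two_sided_levy_def)
  moreover have "(\<lambda>f. f u $ i) \<in> borel_measurable ?P" if "0 \<le> u" for u i
    by (rule measurable_compose[OF _ borel_measurable_nth], rule measurable_component_singleton)
      (use that in simp)
  ultimately have "indep_var borel ((\<lambda>f. f s $ i) \<circ> (\<lambda>\<omega>. \<lambda>t\<in>{0..}. L1 t \<omega>))
      borel ((\<lambda>f. f t $ j) \<circ> (\<lambda>\<omega>. \<lambda>t\<in>{0..}. L2 t \<omega>))"
    using assms by (intro indep_var_compose) auto
  then have "indep_var borel (\<lambda>\<omega>. L1 s \<omega> $ i) borel (\<lambda>\<omega>. L2 t \<omega> $ j)"
    using assms by (simp add: o_def)
  then have "expectation (\<lambda>\<omega>. L1 s \<omega> $ i * L2 t \<omega> $ j)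
      = expectation (\<lambda>\<omega>. L1 s \<omega> $ i) * expectation (\<lambda>\<omega>. L2 t \<omega> $ j)"
    using assms by (intro indep_var_lebesgue_integral X1.integrable_X X2.integrable_X)
  then show ?thesis
    using X1.mu_zero[OF assms(1), of i] by (simp add: X1.mu_def)
qed

text \<open>Fatou: \<open>L2 s\<close> tends to \<open>L2 (-t)\<close> in mean square and to \<open>- L t\<close> almost surely as \<open>s\<close> increases to \<open>-t\<close>.\<close>

lemma L_negative:
  assumes "t < 0"
  shows "AE \<omega> in M. L t \<omega> $ i = - (L2 (- t) \<omega> $ i)"
proof -
  define u where "u = - t"
  have u: "u > 0" using assms by (simp add: u_def)
  define s where "s n = u - u / real (Suc (Suc n))" for n
  have s: "0 \<le> s n" "s n < u" for n
    using u by (auto simp: s_def field_simps)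
  have "(\<lambda>n. u / real (Suc (Suc n))) \<longlonglongrightarrow> 0"
    using LIMSEQ_Suc[OF LIMSEQ_Suc[OF lim_const_over_n[of u]]] by simp
  from tendsto_diff[OF tendsto_const this, of u] have s_lim: "s \<longlonglongrightarrow> u"
    by (simp add: s_def[abs_def])
  then have s_left: "filterlim s (at_left u) sequentially"
    using s(2)[THEN less_imp_neq] by (auto simp: filterlim_at s)
  have "AE \<omega> in M. \<forall>t<0. ((\<lambda>s. L2 s \<omega>) \<longlongrightarrow> - L t \<omega>) (at_left (- t))"
    using two_sided by (simp add: two_sided_levy_def)
  then have conv: "AE \<omega> in M. (\<lambda>n. L2 (s n) \<omega> $ i) \<longlonglongrightarrow> - (L t \<omega> $ i)"
  proof eventually_elim
    case (elim \<omega>)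
    then have "((\<lambda>s. L2 s \<omega>) \<longlongrightarrow> - L t \<omega>) (at_left u)"
      using assms by (simp add: u_def)
    from tendsto_vec_nth[OF filterlim_compose[OF this s_left], of i] show ?case by simp
  qed
  have [measurable]: "(\<lambda>\<omega>. L2 u \<omega> $ i) \<in> borel_measurable M" "(\<lambda>\<omega>. L2 (s n) \<omega> $ i) \<in> borel_measurable M"
    "(\<lambda>\<omega>. L t \<omega> $ i) \<in> borel_measurable M" for n
    using s(1) u by (auto intro!: X2.measurable_component measurable_compose[OF measurable_L borel_measurable_nth])
  have var: "(\<integral>\<^sup>+\<omega>. ennreal ((L2 (s n) \<omega> $ i - L2 u \<omega> $ i)\<^sup>2) \<partial>M) = ennreal ((u - s n) * S i i)" for n
  proof -
    have sq: "sq_integrable M (\<lambda>\<omega>. L2 (s n) \<omega> $ i)" "sq_integrable M (\<lambda>\<omega>. L2 u \<omega> $ i)"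
      using s u by (auto intro: X2.sq)
    have "expectation (\<lambda>\<omega>. (L2 (s n) \<omega> $ i - L2 u \<omega> $ i)\<^sup>2) = (u - s n) * S i i"
      using sq_integrable_mult[OF sq] sq_integrable_mult[OF sq(1) sq(1)] sq_integrable_mult[OF sq(2) sq(2)]
        cov2[of "s n" "s n" i i] cov2[of "s n" u i i] cov2[of u u i i] s[of n] u
      by (simp add: power2_diff power2_eq_square mult.assoc algebra_simps)
    then show ?thesis
      using sq_integrable_power2[OF sq_integrable_diff[OF sq]] by (simp add: nn_integral_eq_integral)
  qed
  have "(\<integral>\<^sup>+\<omega>. ennreal ((- (L t \<omega> $ i) - L2 u \<omega> $ i)\<^sup>2) \<partial>M)
      = (\<integral>\<^sup>+\<omega>. liminf (\<lambda>n. ennreal ((L2 (s n) \<omega> $ i - L2 u \<omega> $ i)\<^sup>2)) \<partial>M)"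
  proof (rule nn_integral_cong_AE)
    show "AE \<omega> in M. ennreal ((- (L t \<omega> $ i) - L2 u \<omega> $ i)\<^sup>2)
        = liminf (\<lambda>n. ennreal ((L2 (s n) \<omega> $ i - L2 u \<omega> $ i)\<^sup>2))"
      using conv
    proof eventually_elim
      case (elim \<omega>)
      then have "(\<lambda>n. ennreal ((L2 (s n) \<omega> $ i - L2 u \<omega> $ i)\<^sup>2)) \<longlonglongrightarrow> ennreal ((- (L t \<omega> $ i) - L2 u \<omega> $ i)\<^sup>2)"
        by (intro tendsto_intros)
      then show ?case
        by (rule lim_imp_Liminf[OF sequentially_bot, symmetric])
    qed
  qed
  also have "\<dots> \<le> liminf (\<lambda>n. \<integral>\<^sup>+\<omega>. ennreal ((L2 (s n) \<omega> $ i - L2 u \<omega> $ i)\<^sup>2) \<partial>M)"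
    by (intro nn_integral_liminf) simp
  also have "\<dots> = ennreal ((u - u) * S i i)"
    unfolding var by (intro lim_imp_Liminf[OF sequentially_bot] tendsto_intros s_lim)
  finally have "(\<integral>\<^sup>+\<omega>. ennreal ((- (L t \<omega> $ i) - L2 u \<omega> $ i)\<^sup>2) \<partial>M) = 0"
    by simp
  then have "AE \<omega> in M. ennreal ((- (L t \<omega> $ i) - L2 u \<omega> $ i)\<^sup>2) = 0"
    by (subst (asm) nn_integral_0_iff_AE) auto
  then show ?thesis
    by eventually_elim (simp add: u_def ennreal_eq_0_iff)
qed

text \<open>At a fixed time a Levy process almost surely does not jump, so for computing moments the
  left limit in the definition of \<open>L\<close> may be replaced by the value of
  \<open>L2\<close>.\<close>

definition path :: "real \<Rightarrow> 'w \<Rightarrow> real^'d" where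
  "path t = (if 0 \<le> t then L1 t else (\<lambda>\<omega>. - L2 (- t) \<omega>))"

lemma L_eq_path: "AE \<omega> in M. L t \<omega> $ i = path t \<omega> $ i"
  using two_sided L_negative[of t i] by (cases "0 \<le> t") (auto simp: path_def two_sided_levy_def)

lemma path_sq: "sq_integrable M (\<lambda>\<omega>. path t \<omega> $ i)"
  using X1.sq[of t i] sq_integrable_cmult[OF X2.sq[of "- t" i], of "-1"]
  by (cases "0 \<le> t") (auto simp: path_def)

lemma L_measurable_component [measurable]: "(\<lambda>\<omega>. L t \<omega> $ i) \<in> borel_measurable M"
  by (rule measurable_compose[OF measurable_L borel_measurable_nth])

lemma L_sq: "sq_integrable M (\<lambda>\<omega>. L t \<omega> $ i)"
proof (rule sq_integrable_cong_AE[OF path_sq[of t i]])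
  show "AE \<omega> in M. path t \<omega> $ i = L t \<omega> $ i"
    using L_eq_path[of t i] by eventually_elim simp
qed simp

lemma L_mean: "expectation (\<lambda>\<omega>. L t \<omega> $ i) = 0"
proof -
  have [measurable]: "(\<lambda>\<omega>. path t \<omega> $ i) \<in> borel_measurable M"
    using path_sq by (rule sq_integrable_measurable)
  have "expectation (\<lambda>\<omega>. L t \<omega> $ i) = expectation (\<lambda>\<omega>. path t \<omega> $ i)"
    by (rule integral_cong_AE) (use L_eq_path in auto)
  also have "\<dots> = 0"
    using X1.mu_zero[of t i] X2.mu_zero[of "- t" i]
    by (cases "0 \<le> t") (auto simp: path_def X1.mu_def X2.mu_def)
  finally show ?thesis .
qed

text \<open>For times of opposite sign the kernel is 0, matching the independence of
  \<open>L1\<close> and \<open>L2\<close>; for two negative times the signs cancel and it is the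
  minimum of the absolute values.\<close>

lemma L_cov: "expectation (\<lambda>\<omega>. L s \<omega> $ i * L t \<omega> $ j) = (\<bar>s\<bar> + \<bar>t\<bar> - \<bar>s - t\<bar>) / 2 * S i j"
proof -
  have [measurable]: "(\<lambda>\<omega>. path t \<omega> $ i) \<in> borel_measurable M" for t i
    using path_sq by (rule sq_integrable_measurable)
  have "expectation (\<lambda>\<omega>. L s \<omega> $ i * L t \<omega> $ j) = expectation (\<lambda>\<omega>. path s \<omega> $ i * path t \<omega> $ j)"
    by (rule integral_cong_AE) (use L_eq_path[of s i] L_eq_path[of t j] in auto)
  also have "\<dots> = (\<bar>s\<bar> + \<bar>t\<bar> - \<bar>s - t\<bar>) / 2 * S i j"
  proof (cases "0 \<le> s"; cases "0 \<le> t")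
    assume "0 \<le> s" "0 \<le> t"
    then show ?thesis by (simp add: path_def cov1 min_def)
  next
    assume "0 \<le> s" "\<not> 0 \<le> t"
    then show ?thesis using cov12[of s "- t" i j] by (simp add: path_def)
  next
    assume "\<not> 0 \<le> s" "0 \<le> t"
    then show ?thesis using cov12[of t "- s" j i] by (simp add: path_def mult.commute)
  next
    assume "\<not> 0 \<le> s" "\<not> 0 \<le> t"
    then show ?thesis by (simp add: path_def cov2 min_def)
  qed
  finally show ?thesis .
qed

lemma increment_sq: "sq_integrable M (\<lambda>\<omega>. L b \<omega> $ k - L a \<omega> $ k)"
  by (intro sq_integrable_diff L_sq)

lemma increment_cov:
  assumes "a \<le> b" "c \<le> d"
  shows "expectation (\<lambda>\<omega>. (L b \<omega> $ k - L a \<omega> $ k) * (L d \<omega> $ l - L c \<omega> $ l))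
       = S k l * (\<integral>s. indicator {a<..b} s * indicator {c<..d} s \<partial>lborel)"
proof -
  have "expectation (\<lambda>\<omega>. (L b \<omega> $ k - L a \<omega> $ k) * (L d \<omega> $ l - L c \<omega> $ l))
      = expectation (\<lambda>\<omega>. L b \<omega> $ k * L d \<omega> $ l - L b \<omega> $ k * L c \<omega> $ l - L a \<omega> $ k * L d \<omega> $ l + L a \<omega> $ k * L c \<omega> $ l)"
    by (intro Bochner_Integration.integral_cong) (auto simp: algebra_simps)
  also have "\<dots> = expectation (\<lambda>\<omega>. L b \<omega> $ k * L d \<omega> $ l) - expectation (\<lambda>\<omega>. L b \<omega> $ k * L c \<omega> $ l)
      - expectation (\<lambda>\<omega>. L a \<omega> $ k * L d \<omega> $ l) + expectation (\<lambda>\<omega>. L a \<omega> $ k * L c \<omega> $ l)"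
    using sq_integrable_mult[OF L_sq L_sq] by simp
  also have "\<dots> = S k l * (\<integral>s. indicator {a<..b} s * indicator {c<..d} s \<partial>lborel)"
    unfolding L_cov overlap_integral[OF assms] by (simp add: algebra_simps)
  finally show ?thesis .
qed

section \<open>Covariances of integrals of step functions\<close>

lemma step_integral_Cons:
  "step_integral L ((F, a, b) # ks) \<omega> $ i = (\<Sum>k\<in>UNIV. F $ i $ k * (L b \<omega> $ k - L a \<omega> $ k)) + step_integral L ks \<omega> $ i"
  by (simp add: step_integral_def matrix_vector_mult_def)

lemma step_fun_Cons:
  "step_fun ((F, a, b) # ks) s $ i $ k = F $ i $ k * indicator {a<..b} s + step_fun ks s $ i $ k"
  by (simp add: step_fun_def)

lemma step_integral_sq: "sq_integrable M (\<lambda>\<omega>. step_integral L ks \<omega> $ i)"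
proof (induction ks)
  case (Cons K ks)
  obtain F a b where K: "K = (F, a, b)" by (cases K) auto
  show ?case
    unfolding K step_integral_Cons
    by (intro sq_integrable_add sq_integrable_sum sq_integrable_cmult increment_sq Cons)
qed (simp add: step_integral_def)

lemma step_integral_mean: "expectation (\<lambda>\<omega>. step_integral L ks \<omega> $ i) = 0"
proof (induction ks)
  case (Cons K ks)
  obtain F a b where K: "K = (F, a, b)" by (cases K) auto
  show ?case
    unfolding K step_integral_Cons
    using sq_integrable_imp_integrable[OF step_integral_sq] sq_integrable_imp_integrable[OF L_sq]
    by (simp add: Cons L_mean)
qed (simp add: step_integral_def)

lemma indicator_sq: "sq_integrable lborel (indicator {a<..b::real})"
proof -
  have "(\<lambda>x. (indicator {a<..b} x)\<^sup>2) = (indicator {a<..b} :: real \<Rightarrow> real)"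
    by (auto simp: indicator_def)
  then show ?thesis
    by (cases "a \<le> b") (auto simp: sq_integrable_def emeasure_lborel_Ioc)
qed

lemma step_fun_sq: "sq_integrable lborel (\<lambda>s. step_fun ks s $ i $ k)"
proof (induction ks)
  case (Cons K ks)
  obtain F a b where K: "K = (F, a, b)" by (cases K) auto
  show ?case
    unfolding K step_fun_Cons by (intro sq_integrable_add sq_integrable_cmult indicator_sq Cons)
qed (simp add: step_fun_def)

text \<open>The intervals in a list may overlap, so the isometry is obtained by bilinearity: here
  one factor is a single increment, and \<open>step_cov\<close> then runs through a second
  list.\<close>

lemma step_increment_cov:
  assumes "\<forall>(F, a, b)\<in>set ks. a \<le> b" "c \<le> d"
  shows "expectation (\<lambda>\<omega>. step_integral L ks \<omega> $ i * (L d \<omega> $ l - L c \<omega> $ l))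
       = (\<Sum>k\<in>UNIV. S k l * (\<integral>s. step_fun ks s $ i $ k * indicator {c<..d} s \<partial>lborel))"
  using assms(1)
proof (induction ks)
  case (Cons K ks)
  obtain F a b where K: "K = (F, a, b)" by (cases K) auto
  have ab: "a \<le> b" using Cons.prems by (simp add: K)
  let ?D = "\<lambda>\<omega>. L d \<omega> $ l - L c \<omega> $ l"
  have int: "integrable M (\<lambda>\<omega>. (L b \<omega> $ k - L a \<omega> $ k) * ?D \<omega>)"
    "integrable M (\<lambda>\<omega>. step_integral L ks \<omega> $ i * ?D \<omega>)" for k
    by (intro sq_integrable_mult increment_sq step_integral_sq)+
  have int': "integrable lborel (\<lambda>s. indicator {a<..b} s * indicator {c<..d} s :: real)"
    "integrable lborel (\<lambda>s. step_fun ks s $ i $ k * indicator {c<..d} s)" for k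
    by (intro sq_integrable_mult indicator_sq step_fun_sq)+
  have "expectation (\<lambda>\<omega>. step_integral L (K # ks) \<omega> $ i * ?D \<omega>)
      = expectation (\<lambda>\<omega>. (\<Sum>k\<in>UNIV. F $ i $ k * ((L b \<omega> $ k - L a \<omega> $ k) * ?D \<omega>)) + step_integral L ks \<omega> $ i * ?D \<omega>)"
    unfolding K step_integral_Cons by (simp add: distrib_right sum_distrib_right mult.assoc)
  also have "\<dots> = (\<Sum>k\<in>UNIV. F $ i $ k * expectation (\<lambda>\<omega>. (L b \<omega> $ k - L a \<omega> $ k) * ?D \<omega>))
      + expectation (\<lambda>\<omega>. step_integral L ks \<omega> $ i * ?D \<omega>)"
    using int by (subst Bochner_Integration.integral_add) auto
  also have "\<dots> = (\<Sum>k\<in>UNIV. S k l * (F $ i $ k * (\<integral>s. indicator {a<..b} s * indicator {c<..d} s \<partial>lborel)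
      + (\<integral>s. step_fun ks s $ i $ k * indicator {c<..d} s \<partial>lborel)))"
    using Cons by (simp add: increment_cov[OF ab assms(2)] distrib_left sum.distrib mult.left_commute)
  also have "\<dots> = (\<Sum>k\<in>UNIV. S k l * (\<integral>s. F $ i $ k * (indicator {a<..b} s * indicator {c<..d} s)
      + step_fun ks s $ i $ k * indicator {c<..d} s \<partial>lborel))"
    using int' by simp
  finally show ?case
    unfolding K step_fun_Cons by (simp add: distrib_right mult.assoc)
qed (simp add: step_integral_def step_fun_def)

lemma step_cov:
  assumes "\<forall>(F, a, b)\<in>set ks. a \<le> b" "\<forall>(F, a, b)\<in>set ks'. a \<le> b"
  shows "expectation (\<lambda>\<omega>. step_integral L ks \<omega> $ i * step_integral L ks' \<omega> $ j)
       = (\<Sum>l\<in>UNIV. \<Sum>k\<in>UNIV. S k l * (\<integral>s. step_fun ks s $ i $ k * step_fun ks' s $ j $ l \<partial>lborel))"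
  using assms(2)
proof (induction ks')
  case (Cons K ks')
  obtain F a b where K: "K = (F, a, b)" by (cases K) auto
  have ab: "a \<le> b" using Cons.prems by (simp add: K)
  let ?I = "\<lambda>\<omega>. step_integral L ks \<omega> $ i"
  have int: "integrable M (\<lambda>\<omega>. ?I \<omega> * (L b \<omega> $ l - L a \<omega> $ l))"
    "integrable M (\<lambda>\<omega>. ?I \<omega> * step_integral L ks' \<omega> $ j)" for l
    by (intro sq_integrable_mult increment_sq step_integral_sq)+
  have int': "integrable lborel (\<lambda>s. step_fun ks s $ i $ k * indicator {a<..b} s)"
    "integrable lborel (\<lambda>s. step_fun ks s $ i $ k * step_fun ks' s $ j $ l)" for k l
    by (intro sq_integrable_mult indicator_sq step_fun_sq)+
  have "expectation (\<lambda>\<omega>. ?I \<omega> * step_integral L (K # ks') \<omega> $ j)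
      = expectation (\<lambda>\<omega>. (\<Sum>l\<in>UNIV. F $ j $ l * (?I \<omega> * (L b \<omega> $ l - L a \<omega> $ l))) + ?I \<omega> * step_integral L ks' \<omega> $ j)"
    unfolding K step_integral_Cons by (simp add: distrib_left sum_distrib_left mult.left_commute)
  also have "\<dots> = (\<Sum>l\<in>UNIV. F $ j $ l * expectation (\<lambda>\<omega>. ?I \<omega> * (L b \<omega> $ l - L a \<omega> $ l)))
      + expectation (\<lambda>\<omega>. ?I \<omega> * step_integral L ks' \<omega> $ j)"
    using int by (subst Bochner_Integration.integral_add) auto
  also have "\<dots> = (\<Sum>l\<in>UNIV. \<Sum>k\<in>UNIV. S k l * (F $ j $ l * (\<integral>s. step_fun ks s $ i $ k * indicator {a<..b} s \<partial>lborel)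
      + (\<integral>s. step_fun ks s $ i $ k * step_fun ks' s $ j $ l \<partial>lborel)))"
    using Cons by (simp add: step_increment_cov[OF assms(1) ab] distrib_left sum.distrib sum_distrib_left mult.left_commute)
  also have "\<dots> = (\<Sum>l\<in>UNIV. \<Sum>k\<in>UNIV. S k l * (\<integral>s. F $ j $ l * (step_fun ks s $ i $ k * indicator {a<..b} s)
      + step_fun ks s $ i $ k * step_fun ks' s $ j $ l \<partial>lborel))"
    using int' by simp
  finally show ?case
    unfolding K step_fun_Cons by (simp add: distrib_left mult.left_commute)
qed (simp add: step_integral_def step_fun_def)

lemma has_L2_integralE:
  assumes "has_L2_integral M L f I"
  obtains ks where "\<And>n. \<forall>(F, a, b)\<in>set (ks n). a \<le> b"
    "\<And>i k. tendsto_L2 lborel (\<lambda>n s. step_fun (ks n) s $ i $ k) (\<lambda>s. f s $ i $ k)"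
    "\<And>i. tendsto_L2 M (\<lambda>n \<omega>. step_integral L (ks n) \<omega> $ i) (\<lambda>\<omega>. I \<omega> $ i)"
proof -
  obtain ks where ks: "\<And>n. \<forall>(F, a, b)\<in>set (ks n). a \<le> b"
    and f: "(\<lambda>n. \<integral>\<^sup>+s. ennreal ((norm (step_fun (ks n) s - f s))\<^sup>2) \<partial>lborel) \<longlonglongrightarrow> 0"
    and I: "(\<lambda>n. \<integral>\<^sup>+\<omega>. ennreal ((norm (step_integral L (ks n) \<omega> - I \<omega>))\<^sup>2) \<partial>M) \<longlonglongrightarrow> 0"
    and meas: "f \<in> borel_measurable borel" "I \<in> borel_measurable M"
    using assms unfolding has_L2_integral_def by blast
  have "tendsto_L2 lborel (\<lambda>n s. step_fun (ks n) s $ i $ k) (\<lambda>s. f s $ i $ k)" for i k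
  proof (rule tendsto_L2_nn_integralI)
    have "(\<lambda>s. f s \<bullet> axis i (axis k 1)) \<in> borel_measurable borel"
      using meas(1) by measurable
    then show "(\<lambda>s. f s $ i $ k) \<in> borel_measurable lborel"
      by (simp add: inner_axis)
    show "(\<lambda>n. \<integral>\<^sup>+s. ennreal ((step_fun (ks n) s $ i $ k - f s $ i $ k)\<^sup>2) \<partial>lborel) \<longlonglongrightarrow> 0"
    proof (rule tendsto_sandwich[OF _ _ tendsto_const f])
      have "(A $ i $ k - B $ i $ k)\<^sup>2 \<le> (norm (A - B))\<^sup>2" for A B :: "real^'d^'d"
      proof -
        have "\<bar>(A - B) $ i $ k\<bar> \<le> norm (A - B)"
          using component_le_norm_cart[of "(A - B) $ i" k] Finite_Cartesian_Product.norm_nth_le[of "A - B" i] by linarith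
        then have "\<bar>(A - B) $ i $ k\<bar>\<^sup>2 \<le> (norm (A - B))\<^sup>2"
          by (intro power_mono) auto
        then show ?thesis by simp
      qed
      then show "\<forall>\<^sub>F n in sequentially. (\<integral>\<^sup>+s. ennreal ((step_fun (ks n) s $ i $ k - f s $ i $ k)\<^sup>2) \<partial>lborel)
          \<le> (\<integral>\<^sup>+s. ennreal ((norm (step_fun (ks n) s - f s))\<^sup>2) \<partial>lborel)"
        by (intro always_eventually allI nn_integral_mono ennreal_leI)
    qed simp
  qed (rule step_fun_sq)
  moreover have "tendsto_L2 M (\<lambda>n \<omega>. step_integral L (ks n) \<omega> $ i) (\<lambda>\<omega>. I \<omega> $ i)" for i
  proof (rule tendsto_L2_nn_integralI)
    show "(\<lambda>\<omega>. I \<omega> $ i) \<in> borel_measurable M"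
      by (rule measurable_compose[OF meas(2) borel_measurable_nth])
    show "(\<lambda>n. \<integral>\<^sup>+\<omega>. ennreal ((step_integral L (ks n) \<omega> $ i - I \<omega> $ i)\<^sup>2) \<partial>M) \<longlonglongrightarrow> 0"
    proof (rule tendsto_sandwich[OF _ _ tendsto_const I])
      have "(A $ i - B $ i)\<^sup>2 \<le> (norm (A - B))\<^sup>2" for A B :: "real^'d"
      proof -
        have "\<bar>(A - B) $ i\<bar>\<^sup>2 \<le> (norm (A - B))\<^sup>2"
          by (intro power_mono component_le_norm_cart) auto
        then show ?thesis by simp
      qed
      then show "\<forall>\<^sub>F n in sequentially. (\<integral>\<^sup>+\<omega>. ennreal ((step_integral L (ks n) \<omega> $ i - I \<omega> $ i)\<^sup>2) \<partial>M)
          \<le> (\<integral>\<^sup>+\<omega>. ennreal ((norm (step_integral L (ks n) \<omega> - I \<omega>))\<^sup>2) \<partial>M)"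
        by (intro always_eventually allI nn_integral_mono ennreal_leI)
    qed simp
  qed (rule step_integral_sq)
  ultimately show ?thesis
    using that ks by blast
qed

lemma L2_integral_sq:
  assumes "has_L2_integral M L f I"
  shows "sq_integrable M (\<lambda>\<omega>. I \<omega> $ i)" "sq_integrable lborel (\<lambda>s. f s $ i $ k)"
proof -
  obtain ks where ks: "\<And>n. \<forall>(F, a, b)\<in>set (ks n). a \<le> b"
    "\<And>i k. tendsto_L2 lborel (\<lambda>n s. step_fun (ks n) s $ i $ k) (\<lambda>s. f s $ i $ k)"
    "\<And>i. tendsto_L2 M (\<lambda>n \<omega>. step_integral L (ks n) \<omega> $ i) (\<lambda>\<omega>. I \<omega> $ i)"
    by (rule has_L2_integralE[OF assms]) (rule that)
  show "sq_integrable M (\<lambda>\<omega>. I \<omega> $ i)" "sq_integrable lborel (\<lambda>s. f s $ i $ k)"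
    by (rule tendsto_L2_sq_integrable(2)[OF ks(3)], rule tendsto_L2_sq_integrable(2)[OF ks(2)])
qed

lemma L2_integral_mean:
  assumes "has_L2_integral M L f I"
  shows "expectation (\<lambda>\<omega>. I \<omega> $ i) = 0"
proof -
  obtain ks where "\<And>n. \<forall>(F, a, b)\<in>set (ks n). a \<le> b"
    "\<And>i k. tendsto_L2 lborel (\<lambda>n s. step_fun (ks n) s $ i $ k) (\<lambda>s. f s $ i $ k)"
    and lim: "\<And>i. tendsto_L2 M (\<lambda>n \<omega>. step_integral L (ks n) \<omega> $ i) (\<lambda>\<omega>. I \<omega> $ i)"
    by (rule has_L2_integralE[OF assms]) (rule that)
  have "(\<lambda>n. expectation (\<lambda>\<omega>. step_integral L (ks n) \<omega> $ i * 1)) \<longlonglongrightarrow> expectation (\<lambda>\<omega>. I \<omega> $ i * 1)"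
    by (intro lim tendsto_L2_integral_mult tendsto_L2_const sq_integrable_const)
  then have "(\<lambda>n. 0) \<longlonglongrightarrow> expectation (\<lambda>\<omega>. I \<omega> $ i)"
    by (simp only: mult_1_right step_integral_mean)
  then show ?thesis
    by (rule LIMSEQ_unique[OF _ tendsto_const])
qed

text \<open>Both sides are continuous under mean square limits, so the identity extends from step
  functions. The form with two integrals and two components is the one that autocovariances
  require.\<close>

theorem L2_isometry:
  assumes "has_L2_integral M L f I" "has_L2_integral M L h J"
  shows "expectation (\<lambda>\<omega>. I \<omega> $ i * J \<omega> $ j)
       = (\<Sum>l\<in>UNIV. \<Sum>k\<in>UNIV. S k l * (\<integral>s. f s $ i $ k * h s $ j $ l \<partial>lborel))"
proof -
  obtain ks where ks: "\<And>n. \<forall>(F, a, b)\<in>set (ks n). a \<le> b"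
    "\<And>i k. tendsto_L2 lborel (\<lambda>n s. step_fun (ks n) s $ i $ k) (\<lambda>s. f s $ i $ k)"
    "\<And>i. tendsto_L2 M (\<lambda>n \<omega>. step_integral L (ks n) \<omega> $ i) (\<lambda>\<omega>. I \<omega> $ i)"
    by (rule has_L2_integralE[OF assms(1)]) (rule that)
  obtain ls where ls: "\<And>n. \<forall>(F, a, b)\<in>set (ls n). a \<le> b"
    "\<And>i k. tendsto_L2 lborel (\<lambda>n s. step_fun (ls n) s $ i $ k) (\<lambda>s. h s $ i $ k)"
    "\<And>i. tendsto_L2 M (\<lambda>n \<omega>. step_integral L (ls n) \<omega> $ i) (\<lambda>\<omega>. J \<omega> $ i)"
    by (rule has_L2_integralE[OF assms(2)]) (rule that)
  have "(\<lambda>n. \<Sum>l\<in>UNIV. \<Sum>k\<in>UNIV. S k l * (\<integral>s. step_fun (ks n) s $ i $ k * step_fun (ls n) s $ j $ l \<partial>lborel))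
      \<longlonglongrightarrow> (\<Sum>l\<in>UNIV. \<Sum>k\<in>UNIV. S k l * (\<integral>s. f s $ i $ k * h s $ j $ l \<partial>lborel))"
    by (intro tendsto_intros tendsto_L2_integral_mult ks ls)
  moreover have "(\<lambda>n. expectation (\<lambda>\<omega>. step_integral L (ks n) \<omega> $ i * step_integral L (ls n) \<omega> $ j))
      \<longlonglongrightarrow> expectation (\<lambda>\<omega>. I \<omega> $ i * J \<omega> $ j)"
    by (intro tendsto_L2_integral_mult ks ls)
  ultimately show ?thesis
    using LIMSEQ_unique by (simp add: step_cov[OF ks(1) ls(1)])
qed

end

section \<open>Filtering the kernel\<close>

lemma poly_det: "poly (det A) z = det (\<chi> i j. poly (A $ i $ j) z)"
  for A :: "complex poly^'n^'n"
  by (simp add: det_def poly_sum poly_prod)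

text \<open>Every term of the Leibniz expansion takes one entry from each column. Bounds by columns
  fit Cramer's rule, which replaces a column.\<close>

lemma degree_det_le:
  fixes A :: "complex poly^'n^'n"
  assumes "\<And>i j. degree (A $ i $ j) \<le> d j"
  shows "degree (det A) \<le> (\<Sum>j\<in>UNIV. d j)"
  unfolding det_def
proof (rule degree_sum_le)
  fix \<pi> :: "'n \<Rightarrow> 'n" assume "\<pi> \<in> {\<pi>. \<pi> permutes UNIV}"
  then have perm: "\<pi> permutes UNIV" by simp
  have "degree (of_int (sign \<pi>) * (\<Prod>i\<in>UNIV. A $ i $ \<pi> i)) \<le> degree (\<Prod>i\<in>UNIV. A $ i $ \<pi> i)"
    using degree_mult_le[of "of_int (sign \<pi>)" "\<Prod>i\<in>UNIV. A $ i $ \<pi> i"] by simp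
  also have "\<dots> \<le> (\<Sum>i\<in>UNIV. degree (A $ i $ \<pi> i))"
    using degree_prod_sum_le[of UNIV "\<lambda>i. A $ i $ \<pi> i"] by (simp add: o_def)
  also have "\<dots> \<le> (\<Sum>i\<in>UNIV. d (\<pi> i))"
    by (intro sum_mono assms)
  also have "\<dots> = (\<Sum>j\<in>UNIV. d j)"
    using sum.permute[OF perm, of d] by (simp add: o_def)
  finally show "degree (of_int (sign \<pi>) * (\<Prod>i\<in>UNIV. A $ i $ \<pi> i)) \<le> (\<Sum>j\<in>UNIV. d j)" .
qed simp

lemma degree_poly_entries: "degree (poly_entries R $ i $ j) \<le> degree R"
  by (simp add: poly_entries_def map_poly_degree_leq)

text \<open>Cramer's rule, with column \<open>j\<close> of the quotient as the solution of a linear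
  system with matrix \<open>P(z)\<close>: all entries get the denominator
  \<open>det P(z)\<close>.\<close>

lemma matrix_fraction_entry:
  fixes P Q :: "(real^'n^'n) poly"
  defines "D \<equiv> det (poly_entries P)"
  assumes nz: "poly D z \<noteq> 0"
  shows "(matrix_inv (mpoly_eval P z) ** mpoly_eval Q z) $ i $ j
       = poly (det (\<chi> k l. if l = i then poly_entries Q $ k $ j else poly_entries P $ k $ l)) z / poly D z"
proof -
  let ?A = "mpoly_eval P z" and ?B = "mpoly_eval Q z"
  have det: "det ?A = poly D z"
    by (simp add: D_def poly_det mpoly_eval_def)
  then have "invertible ?A"
    using nz by (simp add: invertible_det_nz)
  then have inv: "?A ** matrix_inv ?A = mat 1"
    unfolding invertible_def matrix_inv_def by (metis (mono_tags, lifting) someI_ex)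
  define x where "x = (\<chi> k. (matrix_inv ?A ** ?B) $ k $ j)"
  have "?A *v x = (\<chi> k. (?A ** (matrix_inv ?A ** ?B)) $ k $ j)"
    by (simp add: x_def matrix_vector_mult_def matrix_matrix_mult_def)
  also have "\<dots> = (\<chi> k. ?B $ k $ j)"
    by (simp add: matrix_mul_assoc inv)
  finally have "x = (\<chi> k. det (\<chi> i l. if l = k then ?B $ i $ j else ?A $ i $ l) / det ?A)"
    using cramer[of ?A x "\<chi> k. ?B $ k $ j"] det nz by (simp cong: if_cong)
  then have "x $ i = det (\<chi> k l. if l = i then ?B $ k $ j else ?A $ k $ l) / det ?A"
    by simp
  moreover have "(\<chi> k l. if l = i then ?B $ k $ j else ?A $ k $ l)
      = (\<chi> k l. poly (if l = i then poly_entries Q $ k $ j else poly_entries P $ k $ l) z)"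
    by (simp add: vec_eq_iff mpoly_eval_def)
  ultimately show ?thesis
    by (simp add: det x_def poly_det)
qed

lemma degree_complex_filter_poly: "degree (complex_filter_poly m lam \<Delta>) \<le> m"
proof -
  have "degree (complex_filter_poly m lam \<Delta>) \<le> (\<Sum>i=1..m. degree [:1, - exp (complex_of_real \<Delta> * lam i):])"
    unfolding complex_filter_poly_def by (rule order_trans[OF degree_prod_sum_le]) (simp_all add: o_def)
  also have "\<dots> \<le> (\<Sum>i=1..m. 1)"
    by (rule sum_mono) simp
  finally show ?thesis by simp
qed

text \<open>Pairing one factor of the filter with one linear factor of \<open>D\<close> gives a
  difference quotient of an exponential, whose singularity is removable. A repeated zero merely
  repeats such a factor.\<close>

lemma entire_quotient:
  fixes N :: "complex poly" and lam :: "nat \<Rightarrow> complex"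
  assumes D: "D = smult c (\<Prod>i=1..m. [:- lam i, 1:])" and c: "c \<noteq> 0"
  shows "\<exists>H. H holomorphic_on UNIV \<and>
    (\<forall>z. poly D z \<noteq> 0 \<longrightarrow> H z = poly (complex_filter_poly m lam \<Delta>) (exp (- (complex_of_real \<Delta> * z))) * (poly N z / poly D z))"
proof -
  let ?f = "\<lambda>l z. - exp (complex_of_real \<Delta> * (l - z))"
  \<comment> \<open>Since \<open>?f l l = -1\<close>, the numerator \<open>?f l z - ?f l l\<close>
    is the filter factor \<open>1 - exp (\<Delta> (l - z))\<close>.\<close>
  define \<psi> where "\<psi> l z = (if z = l then deriv (?f l) l else (?f l z - ?f l l) / (z - l))" for l z
  have hol: "\<psi> l holomorphic_on UNIV" for l
    unfolding \<psi>_def[abs_def] by (rule pole_lemma_open) (auto intro!: holomorphic_intros)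
  define H where "H z = poly N z / c * (\<Prod>i=1..m. \<psi> (lam i) z)" for z
  have "H holomorphic_on UNIV"
    unfolding H_def[abs_def] using c hol by (intro holomorphic_intros) auto
  moreover have "H z = poly (complex_filter_poly m lam \<Delta>) (exp (- (complex_of_real \<Delta> * z))) * (poly N z / poly D z)"
    if nz: "poly D z \<noteq> 0" for z
  proof -
    have Dz: "poly D z = c * (\<Prod>i=1..m. z - lam i)"
      by (simp add: D poly_prod)
    have "z \<noteq> lam i" if "i \<in> {1..m}" for i
      using nz that by (auto simp: Dz)
    then have "(\<Prod>i=1..m. \<psi> (lam i) z)
        = (\<Prod>i=1..m. (1 - exp (complex_of_real \<Delta> * lam i) * exp (- (complex_of_real \<Delta> * z))) / (z - lam i))"
      by (intro prod.cong refl) (auto simp: \<psi>_def right_diff_distrib exp_diff exp_minus divide_simps)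
    also have "\<dots> = poly (complex_filter_poly m lam \<Delta>) (exp (- (complex_of_real \<Delta> * z))) / (\<Prod>i=1..m. z - lam i)"
      by (simp add: complex_filter_poly_def poly_prod prod_dividef mult.commute)
    finally show ?thesis
      by (simp add: H_def Dz)
  qed
  ultimately show ?thesis by blast
qed

text \<open>
  The difference of the primitive is the integral of \<open>G\<close> over \<open>[-iR, iR]\<close>. This segment is moved to
  \<open>Re z = -K\<close> with \<open>K\<close> tending to infinity, where the factor \<open>exp (\<alpha> * Re z)\<close> kills the integrand; the
  two horizontal sides are small for large \<open>R\<close> because \<open>N / D\<close> vanishes at infinity.
\<close>

lemma primitive_difference_tendsto_0:
  fixes N D :: "complex poly"
  assumes deg: "degree N < degree D"
    and G: "\<And>z. (GG has_field_derivative G z) (at z)"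
    and bound: "\<And>z. poly D z \<noteq> 0 \<Longrightarrow> Re z \<le> 0 \<Longrightarrow> norm (G z) \<le> C * exp (\<alpha> * Re z) * norm (poly N z / poly D z)"
    and C: "C \<ge> 0" and \<alpha>: "\<alpha> > 0"
  shows "((\<lambda>R. GG (\<i> * complex_of_real R) - GG (- (\<i> * complex_of_real R))) \<longlongrightarrow> 0) at_top"
proof (rule tendstoI)
  fix e :: real assume e: "e > 0"
  \<comment> \<open>The two horizontal sides will contribute at most
    \<open>C * \<epsilon> / \<alpha>\<close> each, together \<open>e / 2 * (C / (C + 1))\<close>;
    the 1 covers the case \<open>C = 0\<close>.\<close>
  define \<epsilon> where "\<epsilon> = e * \<alpha> / (4 * (C + 1))"
  have \<epsilon>: "\<epsilon> > 0" using e \<alpha> C by (simp add: \<epsilon>_def)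
  have "((\<lambda>z. poly N z / poly D z) \<longlongrightarrow> 0) at_infinity"
    by (rule poly_divide_tendsto_0_at_infinity[OF deg])
  then have "\<forall>\<^sub>F z in at_infinity. norm (poly N z / poly D z) < \<epsilon>"
    using \<epsilon> by (auto dest!: tendstoD simp: dist_norm)
  then obtain r1 where r1: "\<And>z. norm z \<ge> r1 \<Longrightarrow> norm (poly N z / poly D z) < \<epsilon>"
    by (auto simp: eventually_at_infinity)
  have D0: "D \<noteq> 0" using deg by auto
  then have "bounded {z. poly D z = 0}"
    by (intro finite_imp_bounded poly_roots_finite)
  then obtain r2 where r2: "\<And>z. poly D z = 0 \<Longrightarrow> norm z \<le> r2"
    by (auto simp: bounded_iff)
  \<comment> \<open>From norm \<open>r\<close> on the fraction is below \<open>\<epsilon>\<close>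
    and \<open>D\<close> has no zeros; the last 1 makes \<open>r\<close> positive.\<close>
  define r where "r = max (max r1 (r2 + 1)) 1"
  have small: "norm (G z) \<le> C * \<epsilon> * exp (\<alpha> * Re z)" if z: "norm z \<ge> r" "Re z \<le> 0" for z
  proof -
    have "poly D z \<noteq> 0" using r2[of z] z by (force simp: r_def)
    then have "norm (G z) \<le> C * exp (\<alpha> * Re z) * norm (poly N z / poly D z)"
      using bound z by blast
    also have "\<dots> \<le> C * exp (\<alpha> * Re z) * \<epsilon>"
      using r1[of z] z C by (intro mult_left_mono) (auto simp: r_def)
    finally show ?thesis by (simp add: ac_simps)
  qed
  \<comment> \<open>Along the side the derivative is dominated by that of \<open>?p\<close>, whose
    total increase is at most \<open>C * \<epsilon> / \<alpha>\<close> for every length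
    \<open>K\<close>.\<close>
  have side: "norm (GG w - GG (w - complex_of_real K)) \<le> C * \<epsilon> / \<alpha>"
    if w: "Re w = 0" "norm w \<ge> r" and K: "K > 0" for w K
  proof -
    let ?f = "\<lambda>x. GG (w + complex_of_real x)" and ?p = "\<lambda>x. C * \<epsilon> / \<alpha> * exp (\<alpha> * x)"
    have der: "(?f has_vector_derivative G (w + complex_of_real x)) (at x)" for x
    proof -
      have "((\<lambda>x. w + complex_of_real x) has_vector_derivative 1) (at x)"
        by (auto intro!: derivative_eq_intros simp: has_vector_derivative_def scaleR_conv_of_real)
      from field_vector_diff_chain_at[OF this G] show ?thesis by (simp add: o_def)
    qed
    have der': "(?p has_vector_derivative C * \<epsilon> * exp (\<alpha> * x)) (at x)" for x
      unfolding has_real_derivative_iff_has_vector_derivative[symmetric]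
      using \<alpha> by (auto intro!: derivative_eq_intros)
    have "norm (?f 0 - ?f (- K)) \<le> ?p 0 - ?p (- K)"
    proof (rule differentiable_bound_general[where \<phi> = ?p])
      show "continuous_on {- K..0} ?f" "continuous_on {- K..0} ?p"
        using has_vector_derivative_continuous[OF der] has_vector_derivative_continuous[OF der']
        by (blast intro: continuous_at_imp_continuous_on)+
      show "norm (G (w + complex_of_real x)) \<le> C * \<epsilon> * exp (\<alpha> * x)" if "- K < x" "x < 0" for x
      proof -
        have "norm (w + complex_of_real x) \<ge> \<bar>Im (w + complex_of_real x)\<bar>"
          by (rule abs_Im_le_cmod)
        moreover have "norm w = \<bar>Im w\<bar>"
          using w by (simp add: cmod_def)
        ultimately show ?thesis
          using small[of "w + complex_of_real x"] w that by simp
      qed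
    qed (use K der der' in auto)
    also have "\<dots> \<le> C * \<epsilon> / \<alpha>"
      using C \<epsilon> \<alpha> by simp
    finally show ?thesis by simp
  qed
  have main: "norm (GG (\<i> * complex_of_real R) - GG (- (\<i> * complex_of_real R))) < e" if R: "R \<ge> r" for R
  proof -
    let ?a = "\<i> * complex_of_real R"
    have Rpos: "R > 0" using R by (simp add: r_def)
    \<comment> \<open>Here \<open>R\<close> is fixed: the side has length \<open>2 * R\<close>,
      while the bound on \<open>G\<close> decays exponentially in \<open>K\<close>.\<close>
    have vert: "norm (GG (?a - complex_of_real K) - GG (- ?a - complex_of_real K)) \<le> C * \<epsilon> * exp (- \<alpha> * K) * (2 * R)"
      if K: "K \<ge> r" for K
    proof -
      have "norm (GG (?a - complex_of_real K) - GG (- ?a - complex_of_real K))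
          \<le> C * \<epsilon> * exp (- \<alpha> * K) * norm ((?a - complex_of_real K) - (- ?a - complex_of_real K))"
      proof (rule field_differentiable_bound[where S = "{z. Re z = - K}"])
        show "convex {z. Re z = - K}"
        proof (rule convexI)
          fix x y :: complex and u v :: real
          assume "x \<in> {z. Re z = - K}" "y \<in> {z. Re z = - K}" "u + v = 1"
          moreover from this have "u * (- K) + v * (- K) = - K"
            by (metis distrib_right mult_1)
          ultimately show "u *\<^sub>R x + v *\<^sub>R y \<in> {z. Re z = - K}" by simp
        qed
        show "(GG has_field_derivative G z) (at z within {z. Re z = - K})" for z
          by (rule has_field_derivative_at_within[OF G])
        show "norm (G z) \<le> C * \<epsilon> * exp (- \<alpha> * K)" if "z \<in> {z. Re z = - K}" for z
          using small[of z] that K abs_Re_le_cmod[of z] by (auto simp: r_def)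
      qed auto
      also have "norm ((?a - complex_of_real K) - (- ?a - complex_of_real K)) = 2 * R"
        using Rpos by (simp add: norm_mult flip: mult_2)
      finally show ?thesis .
    qed
    have "((\<lambda>K. C * \<epsilon> / \<alpha> + C * \<epsilon> / \<alpha> + C * \<epsilon> * exp (- \<alpha> * K) * (2 * R)) \<longlongrightarrow> C * \<epsilon> / \<alpha> + C * \<epsilon> / \<alpha> + C * \<epsilon> * 0 * (2 * R)) at_top"
    proof (intro tendsto_intros)
      show "((\<lambda>K. exp (- \<alpha> * K)) \<longlongrightarrow> 0) at_top"
      proof (rule filterlim_compose[OF exp_at_bot])
        have "filterlim (\<lambda>K. \<alpha> * K) at_top at_top"
          using \<alpha> by (intro filterlim_tendsto_pos_mult_at_top[OF tendsto_const _ filterlim_ident])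
        then show "filterlim (\<lambda>K. - \<alpha> * K) at_bot at_top"
          by (simp add: filterlim_uminus_at_bot)
      qed
    qed
    moreover have "\<forall>\<^sub>F K in at_top. norm (GG ?a - GG (- ?a)) \<le> C * \<epsilon> / \<alpha> + C * \<epsilon> / \<alpha> + C * \<epsilon> * exp (- \<alpha> * K) * (2 * R)"
      using eventually_ge_at_top[of r]
    proof eventually_elim
      case (elim K)
      then have K: "K > 0" by (simp add: r_def)
      have na: "norm ?a \<ge> r" "norm (- ?a) \<ge> r" using R Rpos by (simp_all add: norm_mult)
      have "GG ?a - GG (- ?a) = (GG ?a - GG (?a - complex_of_real K)) - (GG (- ?a) - GG (- ?a - complex_of_real K))
          + (GG (?a - complex_of_real K) - GG (- ?a - complex_of_real K))"
        by simp
      also have "norm \<dots> \<le> C * \<epsilon> / \<alpha> + C * \<epsilon> / \<alpha> + C * \<epsilon> * exp (- \<alpha> * K) * (2 * R)"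
      proof -
        have "norm (x - y + z) \<le> norm x + norm y + norm z" for x y z :: complex
          using norm_triangle_ineq[of "x - y" z] norm_triangle_ineq4[of x y] by linarith
        moreover have "norm (GG ?a - GG (?a - complex_of_real K)) \<le> C * \<epsilon> / \<alpha>"
          "norm (GG (- ?a) - GG (- ?a - complex_of_real K)) \<le> C * \<epsilon> / \<alpha>"
          using na K by (intro side; simp)+
        ultimately show ?thesis
          using vert[OF elim] by (meson add_mono order_trans)
      qed
      finally show ?case .
    qed
    ultimately have "norm (GG ?a - GG (- ?a)) \<le> C * \<epsilon> / \<alpha> + C * \<epsilon> / \<alpha> + C * \<epsilon> * 0 * (2 * R)"
      by (intro tendsto_lowerbound) auto
    also have "\<dots> = e / 2 * (C / (C + 1))"
    proof -
      define c where "c = C + 1"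
      have "c > 0" using C by (simp add: c_def)
      then show ?thesis
        using \<alpha> unfolding \<epsilon>_def c_def[symmetric] by (simp add: field_simps)
    qed
    also have "\<dots> \<le> e / 2 * 1"
      using e C by (intro mult_left_mono) auto
    finally show ?thesis using e by simp
  qed
  show "\<forall>\<^sub>F R in at_top. dist (GG (\<i> * complex_of_real R) - GG (- (\<i> * complex_of_real R))) 0 < e"
    using eventually_ge_at_top[of r] by eventually_elim (use main in \<open>simp add: dist_norm\<close>)
qed

text \<open>Evaluating at \<open>t - k \<Delta>\<close> multiplies the integrand by
  \<open>exp (- k \<Delta> z)\<close> on \<open>z = \<i> x\<close>, so the filtered truncated
  integrals combine into one integral of the entire function \<open>G\<close> along a segment of the
  imaginary axis, that is, into a difference of its primitive.\<close>

lemma filtered_fourier_tendsto_0: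
  fixes N D :: "complex poly"
  assumes D: "D = smult c (\<Prod>i=1..m. [:- lam i, 1:])" and c: "c \<noteq> 0"
    and deg: "degree N < m" and neg: "\<And>i. i \<in> {1..m} \<Longrightarrow> Re (lam i) < 0"
    and \<Delta>: "\<Delta> > 0" and t: "t > real m * \<Delta>"
  defines "W \<equiv> complex_filter_poly m lam \<Delta>"
    and "F \<equiv> \<lambda>x. poly N (\<i> * complex_of_real x) / poly D (\<i> * complex_of_real x)"
  shows "((\<lambda>R. \<Sum>k\<le>m. coeff W k *
      (complex_of_real (1 / (2 * pi)) * (\<integral>x\<in>{-R..R}. exp (\<i> * complex_of_real ((t - real k * \<Delta>) * x)) * F x \<partial>lborel)))
    \<longlongrightarrow> 0) at_top"
proof -
  obtain H where hol: "H holomorphic_on UNIV"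
    and H: "\<And>z. poly D z \<noteq> 0 \<Longrightarrow> H z = poly W (exp (- (complex_of_real \<Delta> * z))) * (poly N z / poly D z)"
    using entire_quotient[OF D c] unfolding W_def by blast
  define G where "G z = exp (complex_of_real t * z) * H z" for z
  have holG: "G holomorphic_on UNIV"
    unfolding G_def[abs_def] by (intro holomorphic_intros hol)
  then obtain GG where GG: "\<And>z. (GG has_field_derivative G z) (at z)"
    using holomorphic_convex_primitive'[of UNIV G] by auto
  have degD: "degree D = m"
    using c by (simp add: D degree_prod_sum_eq)
  have degW: "degree W \<le> m"
    unfolding W_def by (rule degree_complex_filter_poly)
  have Gz: "G z = (\<Sum>k\<le>m. coeff W k * exp (complex_of_real (t - real k * \<Delta>) * z)) * (poly N z / poly D z)"
    if "poly D z \<noteq> 0" for z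
  proof -
    have "exp (complex_of_real t * z) * poly W (exp (- (complex_of_real \<Delta> * z)))
        = (\<Sum>k\<le>m. coeff W k * (exp (complex_of_real t * z) * exp (- (complex_of_real \<Delta> * z)) ^ k))"
    proof -
      have "poly W w = (\<Sum>k\<le>m. coeff W k * w ^ k)" for w
        unfolding poly_altdef by (rule sum.mono_neutral_left) (use degW in \<open>auto simp: coeff_eq_0\<close>)
      then show ?thesis by (simp add: sum_distrib_left ac_simps)
    qed
    also have "\<dots> = (\<Sum>k\<le>m. coeff W k * exp (complex_of_real (t - real k * \<Delta>) * z))"
      by (intro sum.cong refl) (simp add: exp_of_nat_mult[symmetric] exp_add[symmetric] algebra_simps)
    finally show ?thesis
      by (simp add: G_def H[OF that])
  qed
  define C where "C = (\<Sum>k\<le>m. norm (coeff W k))"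
  \<comment> \<open>In the left half plane the largest of the exponentials is the one with
    \<open>k = m\<close>; its rate \<open>t - m \<Delta>\<close> is positive, which is where
    \<open>t > m \<Delta>\<close> enters.\<close>
  have bound: "norm (G z) \<le> C * exp ((t - real m * \<Delta>) * Re z) * norm (poly N z / poly D z)"
    if nz: "poly D z \<noteq> 0" and z: "Re z \<le> 0" for z
  proof -
    have "norm (\<Sum>k\<le>m. coeff W k * exp (complex_of_real (t - real k * \<Delta>) * z))
        \<le> (\<Sum>k\<le>m. norm (coeff W k) * exp ((t - real m * \<Delta>) * Re z))"
    proof (rule sum_norm_le)
      fix k assume "k \<in> {..m}"
      then have "t - real m * \<Delta> \<le> t - real k * \<Delta>"
        using \<Delta> by simp
      then have "(t - real k * \<Delta>) * Re z \<le> (t - real m * \<Delta>) * Re z"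
        using z by (rule mult_right_mono_neg)
      then show "norm (coeff W k * exp (complex_of_real (t - real k * \<Delta>) * z)) \<le> norm (coeff W k) * exp ((t - real m * \<Delta>) * Re z)"
        by (simp add: norm_mult mult_left_mono)
    qed
    then show ?thesis
      unfolding Gz[OF nz] norm_mult[of "\<Sum>k\<le>m. coeff W k * exp (complex_of_real (t - real k * \<Delta>) * z)"]
      by (intro mult_right_mono) (simp_all add: C_def sum_distrib_right)
  qed
  have lim: "((\<lambda>R. GG (\<i> * complex_of_real R) - GG (- (\<i> * complex_of_real R))) \<longlongrightarrow> 0) at_top"
    by (rule primitive_difference_tendsto_0[OF _ GG bound]) (use deg degD t in \<open>auto simp: C_def sum_nonneg\<close>)
  have Dnz: "poly D (\<i> * complex_of_real x) \<noteq> 0" for x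
  proof -
    have "\<i> * complex_of_real x \<noteq> lam i" if "i \<in> {1..m}" for i
    proof
      assume "\<i> * complex_of_real x = lam i"
      moreover have "Re (\<i> * complex_of_real x) = 0" by simp
      ultimately show False using neg[OF that] by simp
    qed
    then show ?thesis
      using c by (auto simp: D poly_prod)
  qed
  have contF: "continuous_on A F" for A
    unfolding F_def by (intro continuous_intros) (use Dnz in auto)
  have int: "set_integrable lborel {-R..R} (\<lambda>x. exp (\<i> * complex_of_real (s * x)) * F x)" for R s
    by (intro borel_integrable_atLeastAtMost' continuous_intros contF)
  have eq: "(\<Sum>k\<le>m. coeff W k *
      (complex_of_real (1 / (2 * pi)) * (\<integral>x\<in>{-R..R}. exp (\<i> * complex_of_real ((t - real k * \<Delta>) * x)) * F x \<partial>lborel)))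
    = complex_of_real (1 / (2 * pi)) * (- \<i>) * (GG (\<i> * complex_of_real R) - GG (- (\<i> * complex_of_real R)))"
    if R: "R \<ge> 0" for R
  proof -
    have "(\<Sum>k\<le>m. coeff W k * (\<integral>x\<in>{-R..R}. exp (\<i> * complex_of_real ((t - real k * \<Delta>) * x)) * F x \<partial>lborel))
        = (\<integral>x\<in>{-R..R}. (\<Sum>k\<le>m. coeff W k * (exp (\<i> * complex_of_real ((t - real k * \<Delta>) * x)) * F x)) \<partial>lborel)"
    proof -
      define h where "h k x = exp (\<i> * complex_of_real ((t - real k * \<Delta>) * x)) * F x" for k x
      have h: "integrable lborel (\<lambda>x. indicator {-R..R} x *\<^sub>R h k x)" for k
        unfolding h_def by (rule int[unfolded set_integrable_def])
      have "(\<Sum>k\<le>m. coeff W k * (\<integral>x. indicator {-R..R} x *\<^sub>R h k x \<partial>lborel))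
          = (\<Sum>k\<le>m. \<integral>x. coeff W k * (indicator {-R..R} x *\<^sub>R h k x) \<partial>lborel)"
        by (simp only: integral_mult_right_zero)
      also have "\<dots> = (\<integral>x. (\<Sum>k\<le>m. coeff W k * (indicator {-R..R} x *\<^sub>R h k x)) \<partial>lborel)"
        by (rule Bochner_Integration.integral_sum[symmetric]) (rule integrable_mult_right[OF h])
      also have "\<dots> = (\<integral>x. indicator {-R..R} x *\<^sub>R (\<Sum>k\<le>m. coeff W k * h k x) \<partial>lborel)"
        by (simp add: scaleR_sum_right)
      finally show ?thesis
        by (simp add: set_lebesgue_integral_def h_def)
    qed
    also have "\<dots> = (\<integral>x\<in>{-R..R}. G (\<i> * complex_of_real x) \<partial>lborel)"
      by (intro arg_cong[where f = "set_lebesgue_integral lborel {-R..R}"] ext)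
        (simp add: Gz[OF Dnz] F_def sum_distrib_left sum_distrib_right sum_divide_distrib ac_simps)
    \<comment> \<open>The substitution \<open>z = \<i> x\<close> gives
      \<open>dx = - \<i> dz\<close>, hence the factor \<open>- \<i>\<close>.\<close>
    also have "\<dots> = - \<i> * GG (\<i> * complex_of_real R) - - \<i> * GG (\<i> * complex_of_real (- R))"
      unfolding set_lebesgue_integral_def
    proof (rule integral_FTC_Icc[where F = "\<lambda>x. - \<i> * GG (\<i> * complex_of_real x)"])
      fix x
      have "((\<lambda>x. \<i> * complex_of_real x) has_vector_derivative \<i>) (at x)"
        by (auto intro!: derivative_eq_intros simp: has_vector_derivative_def scaleR_conv_of_real)
      from field_vector_diff_chain_at[OF this GG]
      have "((\<lambda>x. GG (\<i> * complex_of_real x)) has_vector_derivative \<i> * G (\<i> * complex_of_real x)) (at x)"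
        by (simp add: o_def)
      from has_vector_derivative_mult_right[OF this, of "- \<i>"]
      show "((\<lambda>x. - \<i> * GG (\<i> * complex_of_real x)) has_vector_derivative G (\<i> * complex_of_real x)) (at x within {-R..R})"
        by (simp add: has_vector_derivative_at_within mult.assoc[symmetric])
    next
      show "continuous_on {-R..R} (\<lambda>x. G (\<i> * complex_of_real x))"
        by (intro continuous_on_compose2[OF holomorphic_on_imp_continuous_on[OF holG]] continuous_intros) auto
    qed (use R in auto)
    finally have segment: "(\<Sum>k\<le>m. coeff W k * (\<integral>x\<in>{-R..R}. exp (\<i> * complex_of_real ((t - real k * \<Delta>) * x)) * F x \<partial>lborel))
        = - \<i> * GG (\<i> * complex_of_real R) - - \<i> * GG (\<i> * complex_of_real (- R))" .
    have pull: "(\<Sum>k\<le>m. coeff W k * (p * b k)) = p * (\<Sum>k\<le>m. coeff W k * b k)" for p b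
      by (simp add: sum_distrib_left mult.left_commute)
    show ?thesis
      unfolding pull segment by (simp add: algebra_simps)
  qed
  have "((\<lambda>R. complex_of_real (1 / (2 * pi)) * (- \<i>) * (GG (\<i> * complex_of_real R) - GG (- (\<i> * complex_of_real R))))
      \<longlongrightarrow> complex_of_real (1 / (2 * pi)) * (- \<i>) * 0) at_top"
    by (intro tendsto_intros lim)
  from this[unfolded mult_zero_right] show ?thesis
    by (rule Lim_transform_eventually) (rule eventually_mono[OF eventually_ge_at_top[of 0]], rule eq[symmetric])
qed

text \<open>The filtered truncated transforms tend to the filtered kernel in mean and to 0 pointwise
  beyond \<open>m \<Delta>\<close>; Fatou's lemma identifies the two limits up to a null
  set.\<close>

lemma filtered_kernel_zero:
  fixes N D :: "complex poly" and g :: "real \<Rightarrow> complex"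
  assumes D: "D = smult c (\<Prod>i=1..m. [:- lam i, 1:])" and c: "c \<noteq> 0"
    and deg: "degree N < m" and neg: "\<And>i. i \<in> {1..m} \<Longrightarrow> Re (lam i) < 0"
    and \<Delta>: "\<Delta> > 0"
    and inv: "has_L2_inverse_fourier (\<lambda>x. poly N (\<i> * complex_of_real x) / poly D (\<i> * complex_of_real x)) g"
  shows "AE t in lborel. t > real m * \<Delta> \<longrightarrow> (\<Sum>k\<le>m. coeff (complex_filter_poly m lam \<Delta>) k * g (t - real k * \<Delta>)) = 0"
proof -
  let ?F = "\<lambda>x. poly N (\<i> * complex_of_real x) / poly D (\<i> * complex_of_real x)"
  let ?a = "coeff (complex_filter_poly m lam \<Delta>)"
  define T where "T R t = complex_of_real (1 / (2 * pi)) * (\<integral>x\<in>{-R..R}. exp (\<i> * complex_of_real (t * x)) * ?F x \<partial>lborel)"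
    for R t
  have F [measurable]: "?F \<in> borel_measurable borel" and g [measurable]: "g \<in> borel_measurable borel"
    and lim: "((\<lambda>R. \<integral>\<^sup>+t. ennreal ((norm (T R t - g t))\<^sup>2) \<partial>lborel) \<longlongrightarrow> 0) at_top"
    using inv by (simp_all add: has_L2_inverse_fourier_def T_def)
  have [measurable]: "T R \<in> borel_measurable borel" for R
    unfolding T_def[abs_def] set_lebesgue_integral_def by measurable
  define w where "w t = (\<Sum>k\<le>m. ?a k * g (t - real k * \<Delta>))" for t
  define wR where "wR R t = (\<Sum>k\<le>m. ?a k * T R (t - real k * \<Delta>))" for R t
  have [measurable]: "w \<in> borel_measurable borel" "wR R \<in> borel_measurable borel" for R
    unfolding w_def[abs_def] wR_def[abs_def] by measurable
  define e where "e R = (\<integral>\<^sup>+t. ennreal ((norm (T R t - g t))\<^sup>2) \<partial>lborel)" for R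
  \<comment> \<open>Cauchy-Schwarz over the \<open>m + 1\<close> summands and translation invariance
    of Lebesgue measure reduce the filtered error to the unfiltered error
    \<open>e R\<close>.\<close>
  have bound: "(\<integral>\<^sup>+t. ennreal ((norm (wR R t - w t))\<^sup>2) \<partial>lborel) \<le> ennreal (real (m + 1) * (\<Sum>k\<le>m. (norm (?a k))\<^sup>2)) * e R" for R
  proof -
    have "(norm (wR R t - w t))\<^sup>2 \<le> (\<Sum>k\<le>m. (real (m + 1) * (norm (?a k))\<^sup>2) * (norm (T R (t - real k * \<Delta>) - g (t - real k * \<Delta>)))\<^sup>2)" for t
    proof -
      let ?n = "\<lambda>k. norm (?a k) * norm (T R (t - real k * \<Delta>) - g (t - real k * \<Delta>))"
      have "norm (wR R t - w t) \<le> (\<Sum>k\<le>m. ?n k)"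
        unfolding w_def wR_def sum_subtractf[symmetric]
        by (rule sum_norm_le) (simp add: norm_mult flip: right_diff_distrib)
      then have "(norm (wR R t - w t))\<^sup>2 \<le> (\<Sum>k\<le>m. ?n k)\<^sup>2"
        by (intro power_mono) auto
      also have "\<dots> \<le> (\<Sum>k\<le>m. (?n k)\<^sup>2) * real (m + 1)"
        using sum_squared_le_sum_of_squares[of ?n "{..m}"] by simp
      finally show ?thesis
        by (simp add: sum_distrib_left sum_distrib_right power_mult_distrib ac_simps)
    qed
    then have "(\<integral>\<^sup>+t. ennreal ((norm (wR R t - w t))\<^sup>2) \<partial>lborel)
        \<le> (\<integral>\<^sup>+t. (\<Sum>k\<le>m. ennreal (real (m + 1) * (norm (?a k))\<^sup>2) * ennreal ((norm (T R (t - real k * \<Delta>) - g (t - real k * \<Delta>)))\<^sup>2)) \<partial>lborel)"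
      by (intro nn_integral_mono) (simp add: sum_ennreal ennreal_mult[symmetric] ennreal_leI)
    also have "\<dots> = (\<Sum>k\<le>m. ennreal (real (m + 1) * (norm (?a k))\<^sup>2) * (\<integral>\<^sup>+t. ennreal ((norm (T R (t - real k * \<Delta>) - g (t - real k * \<Delta>)))\<^sup>2) \<partial>lborel))"
      by (subst nn_integral_sum) (auto simp: nn_integral_cmult)
    also have "\<dots> = (\<Sum>k\<le>m. ennreal (real (m + 1) * (norm (?a k))\<^sup>2) * e R)"
    proof (intro sum.cong refl)
      fix k
      have "e R = (\<integral>\<^sup>+t. ennreal ((norm (T R (t - real k * \<Delta>) - g (t - real k * \<Delta>)))\<^sup>2) \<partial>lborel)"
        unfolding e_def using nn_integral_real_affine[of "\<lambda>t. ennreal ((norm (T R t - g t))\<^sup>2)" 1 "- (real k * \<Delta>)"]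
        by simp
      then show "ennreal (real (m + 1) * (norm (?a k))\<^sup>2) * (\<integral>\<^sup>+t. ennreal ((norm (T R (t - real k * \<Delta>) - g (t - real k * \<Delta>)))\<^sup>2) \<partial>lborel)
          = ennreal (real (m + 1) * (norm (?a k))\<^sup>2) * e R" by simp
    qed
    also have "\<dots> = ennreal (real (m + 1) * (\<Sum>k\<le>m. (norm (?a k))\<^sup>2)) * e R"
      by (simp add: sum_distrib_right[symmetric] sum_distrib_left sum_ennreal del: of_nat_add of_nat_Suc)
    finally show ?thesis .
  qed
  \<comment> \<open>Fatou's lemma works along a sequence, so \<open>R\<close> runs through the
    natural numbers.\<close>
  let ?R = "\<lambda>n. real n"
  have "(\<lambda>n. e (?R n)) \<longlonglongrightarrow> 0"
    using filterlim_compose[OF lim filterlim_real_sequentially] by (simp add: e_def)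
  from ennreal_tendsto_cmult[OF _ this]
  have e_lim: "(\<lambda>n. ennreal (real (m + 1) * (\<Sum>k\<le>m. (norm (?a k))\<^sup>2)) * e (?R n)) \<longlonglongrightarrow> 0"
    by simp
  let ?I = "\<lambda>t. indicator {real m * \<Delta><..} t :: ennreal"
  have "(\<integral>\<^sup>+t. ?I t * ennreal ((norm (w t))\<^sup>2) \<partial>lborel)
      = (\<integral>\<^sup>+t. liminf (\<lambda>n. ?I t * ennreal ((norm (wR (?R n) t - w t))\<^sup>2)) \<partial>lborel)"
  proof (rule nn_integral_cong)
    fix t
    show "?I t * ennreal ((norm (w t))\<^sup>2) = liminf (\<lambda>n. ?I t * ennreal ((norm (wR (?R n) t - w t))\<^sup>2))"
    proof (cases "t > real m * \<Delta>")
      case True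
      have "((\<lambda>R. wR R t) \<longlongrightarrow> 0) at_top"
        unfolding wR_def T_def by (rule filtered_fourier_tendsto_0[OF D c deg neg \<Delta> True])
      then have "(\<lambda>n. wR (?R n) t) \<longlonglongrightarrow> 0"
        by (rule filterlim_compose[OF _ filterlim_real_sequentially])
      then have "(\<lambda>n. ennreal ((norm (wR (?R n) t - w t))\<^sup>2)) \<longlonglongrightarrow> ennreal ((norm (0 - w t))\<^sup>2)"
        by (intro tendsto_intros)
      from lim_imp_Liminf[OF sequentially_bot this] True show ?thesis
        by simp
    qed (simp add: Liminf_const)
  qed
  also have "\<dots> \<le> liminf (\<lambda>n. \<integral>\<^sup>+t. ?I t * ennreal ((norm (wR (?R n) t - w t))\<^sup>2) \<partial>lborel)"
    by (intro nn_integral_liminf) measurable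
  also have "\<dots> \<le> liminf (\<lambda>n. ennreal (real (m + 1) * (\<Sum>k\<le>m. (norm (?a k))\<^sup>2)) * e (?R n))"
    by (intro Liminf_mono always_eventually allI order_trans[OF nn_integral_mono bound])
      (auto simp: indicator_def)
  also have "\<dots> = 0"
    by (rule lim_imp_Liminf[OF sequentially_bot e_lim])
  finally have "(\<integral>\<^sup>+t. ?I t * ennreal ((norm (w t))\<^sup>2) \<partial>lborel) = 0"
    by simp
  then have "AE t in lborel. ?I t * ennreal ((norm (w t))\<^sup>2) = 0"
    by (subst (asm) nn_integral_0_iff_AE) auto
  then show ?thesis
    by eventually_elim (auto simp: w_def indicator_def split: if_splits)
qed

section \<open>The kernel of the MCARMA process\<close>

lemma degree_ar_poly: "degree (ar_poly p A) \<le> p"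
  unfolding ar_poly_def
  by (intro degree_add_le degree_sum_le order_trans[OF degree_monom_le]) auto

lemma degree_ma_poly: "degree (ma_poly q B) \<le> q"
  unfolding ma_poly_def
  by (intro degree_sum_le order_trans[OF degree_monom_le]) auto

text \<open>In the numerator given by Cramer's rule one column of \<open>P\<close>, of degree at
  most \<open>p\<close>, gives way to a column of \<open>Q\<close>; the strict inequality
  \<open>degree Q < p\<close> thus puts its degree below \<open>m\<close>, which is the decay that
  the contour shift requires.\<close>

lemma mcarma_kernel_filter_zero:
  fixes P Q :: "(real^'d^'d) poly" and g :: "real \<Rightarrow> real^'d^'d" and i j :: 'd
  assumes P: "degree P \<le> p" and Q: "degree Q < p"
    and zeros: "{#lam i. i \<in># mset_set {1..p * CARD('d)}#} = proots (det (poly_entries P))"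
    and neg: "\<forall>i\<in>{1..p * CARD('d)}. Re (lam i) < 0"
    and kernel: "mcarma_kernel P Q g" and \<Delta>: "\<Delta> > 0"
  defines "m \<equiv> p * CARD('d)"
  shows "AE t in lborel. t > real m * \<Delta> \<longrightarrow>
    (\<Sum>k\<le>m. coeff (filter_poly m lam \<Delta>) k * g (t - real k * \<Delta>) $ i $ j) = 0"
proof -
  define D where "D = det (poly_entries P)"
  define N where "N = det (\<chi> k l. if l = i then poly_entries Q $ k $ j else poly_entries P $ k $ l)"
  have m: "m > 0" using Q by (simp add: m_def)
  \<comment> \<open>The listed zeros are \<open>m > 0\<close> in number while
    \<open>proots 0\<close> is empty, which excludes \<open>D = 0\<close>.\<close>
  have "size (proots D) = m"
    using arg_cong[OF zeros, of size] by (simp add: D_def m_def)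
  then have "D \<noteq> 0" using m by auto
  have "D = smult (lead_coeff D) (\<Prod>x\<in>#proots D. [:- x, 1:])"
    by (rule complex_poly_decompose_multiset[symmetric])
  also have "(\<Prod>x\<in>#proots D. [:- x, 1:]) = (\<Prod>i=1..m. [:- lam i, 1:])"
    unfolding D_def zeros[symmetric] m_def[symmetric]
    by (simp add: image_mset.compositionality o_def prod_unfold_prod_mset)
  finally have D: "D = smult (lead_coeff D) (\<Prod>i=1..m. [:- lam i, 1:])" .
  have "degree N \<le> (\<Sum>l\<in>UNIV. if l = i then degree Q else p)"
    unfolding N_def
  proof (rule degree_det_le)
    fix k l
    show "degree ((\<chi> k l. if l = i then poly_entries Q $ k $ j else poly_entries P $ k $ l) $ k $ l)
        \<le> (if l = i then degree Q else p)"
      using degree_poly_entries[of Q k j] order_trans[OF degree_poly_entries P, of k l] by simp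
  qed
  also have "\<dots> < (\<Sum>l\<in>(UNIV :: 'd set). p)"
    by (rule sum_strict_mono_ex1) (use Q in auto)
  finally have deg: "degree N < m"
    by (simp add: m_def mult.commute)
  have Dnz: "poly D (\<i> * complex_of_real x) \<noteq> 0" for x
  proof -
    have "\<i> * complex_of_real x \<noteq> lam l" if "l \<in> {1..m}" for l
    proof
      assume "\<i> * complex_of_real x = lam l"
      moreover have "Re (\<i> * complex_of_real x) = 0" by simp
      ultimately show False using bspec[OF neg, of l] that by (simp add: m_def)
    qed
    then show ?thesis
      using \<open>D \<noteq> 0\<close> by (subst D) (auto simp: poly_prod)
  qed
  have "has_L2_inverse_fourier (\<lambda>x. poly N (\<i> * complex_of_real x) / poly D (\<i> * complex_of_real x)) (\<lambda>t. complex_of_real (g t $ i $ j))"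
    using kernel Dnz by (simp add: mcarma_kernel_def matrix_fraction_entry D_def N_def)
  then have "AE t in lborel. t > real m * \<Delta> \<longrightarrow>
      (\<Sum>k\<le>m. coeff (complex_filter_poly m lam \<Delta>) k * complex_of_real (g (t - real k * \<Delta>) $ i $ j)) = 0"
    using neg \<open>D \<noteq> 0\<close> by (intro filtered_kernel_zero[OF D _ deg _ \<Delta>]) (auto simp: m_def)
  moreover have "coeff (complex_filter_poly m lam \<Delta>) k = complex_of_real (coeff (filter_poly m lam \<Delta>) k)" for k
    using of_real_filter_poly[OF zeros, of \<Delta>] coeff_map_poly[of complex_of_real "filter_poly m lam \<Delta>" k]
    by (simp add: m_def)
  ultimately show ?thesis
    by (simp flip: of_real_mult of_real_sum)
qed

section \<open>The filtered process\<close>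

lemma backshift_funpow: "(backshift ^^ k) V n = V (n - int k)"
  by (induction k arbitrary: n) (simp_all add: backshift_def algebra_simps)

lemma degree_filter_poly: "degree (filter_poly m lam \<Delta>) \<le> m"
  unfolding filter_poly_def using map_poly_degree_leq degree_complex_filter_poly order_trans by blast

lemma borel_measurable_vec:
  fixes f :: "'w \<Rightarrow> real^'d"
  assumes "\<And>i. (\<lambda>\<omega>. f \<omega> $ i) \<in> borel_measurable M"
  shows "f \<in> borel_measurable M"
  by (subst borel_measurable_euclidean_space) (use assms in \<open>auto simp: Basis_vec_def inner_axis\<close>)

lemma (in prob_space) white_noise_componentsI:
  fixes z :: "int \<Rightarrow> 'd::finite \<Rightarrow> 'a \<Rightarrow> real"
  assumes sq: "\<And>n i. sq_integrable M (z n i)" and mean: "\<And>n i. expectation (z n i) = 0"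
    and orth: "\<And>n k i j. n \<noteq> k \<Longrightarrow> expectation (\<lambda>\<omega>. z n i \<omega> * z k j \<omega>) = 0"
    and stat: "\<And>n i j. expectation (\<lambda>\<omega>. z n i \<omega> * z n j \<omega>) = S i j"
  shows "white_noise M (\<lambda>n \<omega>. \<chi> i. z n i \<omega>)"
proof -
  let ?Z = "\<lambda>n \<omega>. \<chi> i. z n i \<omega>"
  have meas [measurable]: "?Z n \<in> borel_measurable M" for n
    by (rule borel_measurable_vec) (use sq in \<open>auto simp: sq_integrable_def\<close>)
  have norm: "integrable M (\<lambda>\<omega>. (norm (?Z n \<omega>))\<^sup>2)" for n
    using sq_integrable_mult[OF sq sq] by (simp add: power2_norm_eq_inner inner_vec_def)
  have zero: "(\<integral>\<omega>. ?Z n \<omega> \<partial>M) = 0" for n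
  proof -
    have "sq_integrable M (\<lambda>\<omega>. norm (?Z n \<omega>))"
      using norm[of n] by (simp add: sq_integrable_def)
    then have "integrable M (\<lambda>\<omega>. norm (?Z n \<omega>))"
      by (rule sq_integrable_imp_integrable)
    then have "integrable M (?Z n)"
      by (rule integrable_norm_cancel) simp
    from integral_bounded_linear[OF bounded_linear_vec_nth this]
    show ?thesis by (simp add: vec_eq_iff mean)
  qed
  have "covariance_matrix M (?Z n) (?Z k) = (\<chi> i j. expectation (\<lambda>\<omega>. z n i \<omega> * z k j \<omega>))" for n k
    unfolding covariance_matrix_def zero by simp
  then have "covariance_matrix M (?Z n) (?Z k) = (if n = k then \<chi> i j. S i j else 0)" for n k
    by (simp add: vec_eq_iff orth stat)
  then show ?thesis
    unfolding white_noise_def using meas norm zero by simp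
qed

lemma scalar_filter_component:
  assumes "degree \<phi> \<le> m"
  shows "scalar_filter \<phi> V n \<omega> $ i = (\<Sum>k\<le>m. coeff \<phi> k * V (n - int k) \<omega> $ i)"
proof -
  have "scalar_filter \<phi> V n \<omega> $ i = (\<Sum>k\<le>degree \<phi>. coeff \<phi> k * V (n - int k) \<omega> $ i)"
    by (simp add: scalar_filter_def backshift_funpow)
  also have "\<dots> = (\<Sum>k\<le>m. coeff \<phi> k * V (n - int k) \<omega> $ i)"
    by (rule sum.mono_neutral_left) (use assms in \<open>auto simp: coeff_eq_0\<close>)
  finally show ?thesis .
qed

lemma matrix_filter_component:
  fixes c :: "nat \<Rightarrow> 'd::finite \<Rightarrow> 'd \<Rightarrow> real"
  assumes "m > 0"
  defines "\<Psi> \<equiv> \<Sum>k<m. monom (\<chi> i j. c k i j) k"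
  shows "degree \<Psi> < m"
    and "matrix_filter \<Psi> V n \<omega> $ i = (\<Sum>k<m. \<Sum>j\<in>UNIV. c k i j * V (n - int k) \<omega> $ j)"
proof -
  have coeff: "coeff \<Psi> k = (if k < m then \<chi> i j. c k i j else 0)" for k
    by (simp add: \<Psi>_def coeff_sum)
  show deg: "degree \<Psi> < m"
    unfolding \<Psi>_def by (rule degree_sum_less) (use assms(1) in \<open>auto intro: le_less_trans[OF degree_monom_le]\<close>)
  have "matrix_filter \<Psi> V n \<omega> $ i = (\<Sum>k\<le>degree \<Psi>. (coeff \<Psi> k *v V (n - int k) \<omega>) $ i)"
    by (simp add: matrix_filter_def backshift_funpow)
  also have "\<dots> = (\<Sum>k<m. (coeff \<Psi> k *v V (n - int k) \<omega>) $ i)"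
    by (rule sum.mono_neutral_left) (use deg in \<open>auto simp: coeff_eq_0\<close>)
  also have "\<dots> = (\<Sum>k<m. \<Sum>j\<in>UNIV. c k i j * V (n - int k) \<omega> $ j)"
    by (simp add: coeff matrix_vector_mult_def)
  finally show "matrix_filter \<Psi> V n \<omega> $ i = (\<Sum>k<m. \<Sum>j\<in>UNIV. c k i j * V (n - int k) \<omega> $ j)" .
qed

text \<open>In effect the filtered process is the stochastic integral of one kernel
  \<open>\<kappa>\<close>, causal by its indicators and zero almost everywhere beyond
  \<open>m \<Delta>\<close>. The isometry turns covariances into integrals of products of its
  translates.\<close>

lemma (in two_sided_sq_levy) filtered_finitely_correlated:
  fixes Y :: "real \<Rightarrow> 'w \<Rightarrow> real^'d" and g :: "real \<Rightarrow> real^'d^'d"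
  assumes Y: "\<And>t. has_L2_integral M L (\<lambda>s. indicator {..t} s *\<^sub>R g (t - s)) (Y t)"
    and vanish: "\<And>i j. AE u in lborel. u > real m * \<Delta> \<longrightarrow> (\<Sum>k\<le>m. a k * g (u - real k * \<Delta>) $ i $ j) = 0"
    and \<Delta>: "\<Delta> > 0"
  shows "finitely_correlated M (\<lambda>n i \<omega>. \<Sum>k\<le>m. a k * Y (of_int (n - int k) * \<Delta>) \<omega> $ i) m"
proof -
  let ?t = "\<lambda>n k. of_int (n - int k) * \<Delta>"
  let ?x = "\<lambda>n i \<omega>. \<Sum>k\<le>m. a k * Y (?t n k) \<omega> $ i"
  define f where "f t s = indicator {..t} s *\<^sub>R g (t - s)" for t s
  have Y': "has_L2_integral M L (f t) (Y t)" for t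
    using Y by (simp add: f_def[abs_def])
  \<comment> \<open>Rewritten in the variable \<open>u = n \<Delta> - s\<close>, the indicator of
    \<open>{..(n - k) \<Delta>}\<close> becomes that of \<open>{k \<Delta>..}\<close>, so
    \<open>\<kappa>\<close> vanishes for negative arguments.\<close>
  define \<kappa> where "\<kappa> i j u = (\<Sum>k\<le>m. a k * (indicator {real k * \<Delta>..} u * g (u - real k * \<Delta>) $ i $ j))" for i j u
  have \<kappa>: "(\<Sum>k\<le>m. a k * f (?t n k) s $ i $ j) = \<kappa> i j (of_int n * \<Delta> - s)" for n i j s
    unfolding \<kappa>_def f_def
    by (intro sum.cong refl) (auto simp: indicator_def algebra_simps)
  have Ysq: "sq_integrable M (\<lambda>\<omega>. Y t \<omega> $ i)" and fsq: "sq_integrable lborel (\<lambda>s. f t s $ i $ j)" for t i j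
    using L2_integral_sq[OF Y'] by auto
  \<comment> \<open>The autocovariance as a function of the time difference alone; that it exists is
    the stationarity.\<close>
  define R where "R i j h = (\<Sum>l\<in>UNIV. \<Sum>k\<in>UNIV. S k l * (\<integral>u. \<kappa> i k u * \<kappa> j l (u + h) \<partial>lborel))" for i j h
  have cov: "expectation (\<lambda>\<omega>. ?x n i \<omega> * ?x n' j \<omega>) = R i j (of_int (n' - n) * \<Delta>)" for n n' i j
  proof -
    have "expectation (\<lambda>\<omega>. ?x n i \<omega> * ?x n' j \<omega>)
        = expectation (\<lambda>\<omega>. \<Sum>p\<le>m. \<Sum>q\<le>m. a p * a q * (Y (?t n p) \<omega> $ i * Y (?t n' q) \<omega> $ j))"
      unfolding sum_product by (simp add: ac_simps)
    also have "\<dots> = (\<Sum>p\<le>m. \<Sum>q\<le>m. a p * a q * expectation (\<lambda>\<omega>. Y (?t n p) \<omega> $ i * Y (?t n' q) \<omega> $ j))"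
      using sq_integrable_mult[OF Ysq Ysq] by simp
    also have "\<dots> = (\<Sum>p\<le>m. \<Sum>q\<le>m. \<Sum>l\<in>UNIV. \<Sum>k\<in>UNIV. S k l * (a p * a q * (\<integral>s. f (?t n p) s $ i $ k * f (?t n' q) s $ j $ l \<partial>lborel)))"
      unfolding L2_isometry[OF Y' Y'] by (simp add: sum_distrib_left ac_simps)
    also have "\<dots> = (\<Sum>p\<le>m. \<Sum>l\<in>UNIV. \<Sum>k\<in>UNIV. \<Sum>q\<le>m. S k l * (a p * a q * (\<integral>s. f (?t n p) s $ i $ k * f (?t n' q) s $ j $ l \<partial>lborel)))"
      by (simp only: sum.swap[of _ UNIV "{..m}"])
    also have "\<dots> = (\<Sum>l\<in>UNIV. \<Sum>k\<in>UNIV. \<Sum>p\<le>m. \<Sum>q\<le>m. S k l * (a p * a q * (\<integral>s. f (?t n p) s $ i $ k * f (?t n' q) s $ j $ l \<partial>lborel)))"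
      by (simp only: sum.swap[of _ UNIV "{..m}"])
    also have "\<dots> = (\<Sum>l\<in>UNIV. \<Sum>k\<in>UNIV. S k l * (\<integral>s. (\<Sum>p\<le>m. \<Sum>q\<le>m. a p * a q * (f (?t n p) s $ i $ k * f (?t n' q) s $ j $ l)) \<partial>lborel))"
      using sq_integrable_mult[OF fsq fsq] by (simp add: sum_distrib_left)
    also have "\<dots> = (\<Sum>l\<in>UNIV. \<Sum>k\<in>UNIV. S k l * (\<integral>s. \<kappa> i k (of_int n * \<Delta> - s) * \<kappa> j l (of_int n' * \<Delta> - s) \<partial>lborel))"
      unfolding \<kappa>[symmetric] sum_product by (simp add: ac_simps)
    also have "\<dots> = R i j (of_int (n' - n) * \<Delta>)"
    proof -
      have "(\<integral>s. \<kappa> i k (of_int n * \<Delta> - s) * \<kappa> j l (of_int n' * \<Delta> - s) \<partial>lborel)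
          = (\<integral>u. \<kappa> i k u * \<kappa> j l (u + of_int (n' - n) * \<Delta>) \<partial>lborel)" for k l
        by (subst lborel_integral_real_affine[of "-1" _ "of_int n * \<Delta>"]) (simp_all add: algebra_simps)
      then show ?thesis by (simp add: R_def)
    qed
    finally show ?thesis .
  qed
  show ?thesis
  proof
    show "sq_integrable M (?x n i)" for n i
      by (intro sq_integrable_sum sq_integrable_cmult Ysq)
    show "expectation (?x n i) = 0" for n i
      using sq_integrable_imp_integrable[OF Ysq] by (simp add: L2_integral_mean[OF Y'])
    show "expectation (\<lambda>\<omega>. ?x (n + h) i \<omega> * ?x (k + h) j \<omega>) = expectation (\<lambda>\<omega>. ?x n i \<omega> * ?x k j \<omega>)" for n h i k j
      unfolding cov by simp
    show "expectation (\<lambda>\<omega>. ?x n i \<omega> * ?x k j \<omega>) = 0" if nk: "int m \<le> n - k" for n k i j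
    proof -
      have "(\<integral>u. \<kappa> i r u * \<kappa> j l (u + of_int (k - n) * \<Delta>) \<partial>lborel) = 0" for r l
      proof (rule integral_eq_zero_AE)
        \<comment> \<open>At lag exactly \<open>m\<close> the supports of the two factors touch in
          the single point \<open>m \<Delta>\<close>, discarded here as a null set.\<close>
        have "AE u in lborel. u \<noteq> real m * \<Delta>"
          by (rule AE_lborel_singleton)
        then show "AE u in lborel. \<kappa> i r u * \<kappa> j l (u + of_int (k - n) * \<Delta>) = 0"
          using vanish[of i r]
        proof eventually_elim
          case (elim u)
          show ?case
          proof (cases "u > real m * \<Delta>")
            case True
            have "real p * \<Delta> \<le> u" if "p \<le> m" for p
              using True that \<Delta> by (meson less_imp_le mult_right_mono of_nat_mono order_trans)
            then have "\<kappa> i r u = (\<Sum>p\<le>m. a p * g (u - real p * \<Delta>) $ i $ r)"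
              unfolding \<kappa>_def by (intro sum.cong refl) auto
            then show ?thesis using elim True by simp
          next
            case False
            have "real m \<le> of_int (n - k)"
              using nk by (metis of_int_le_iff of_int_of_nat_eq)
            then have "real m * \<Delta> \<le> of_int (n - k) * \<Delta>"
              using \<Delta> by (intro mult_right_mono) auto
            then have "u + of_int (k - n) * \<Delta> < 0"
              using False elim by (simp add: algebra_simps)
            moreover have "0 \<le> real p * \<Delta>" for p
              using \<Delta> by simp
            ultimately have "\<not> real p * \<Delta> \<le> u + of_int (k - n) * \<Delta>" for p
              by (meson leD le_less_trans)
            then have "\<kappa> j l (u + of_int (k - n) * \<Delta>) = 0"
              unfolding \<kappa>_def by simp
            then show ?thesis by simp
          qed
        qed
      qed
      then show ?thesis
        unfolding cov R_def by simp
    qed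
  qed
qed

theorem corollary2:
  fixes M :: "'w measure"
    and L1 L2 L Y :: "real \<Rightarrow> 'w \<Rightarrow> real^'d"
    and A B :: "nat \<Rightarrow> real^'d^'d"
    and p q :: nat
    and lam :: "nat \<Rightarrow> complex"
  assumes "prob_space M"
    and "q < p"
    and "two_sided_levy M L1 L2 L"
    and "(\<integral>\<omega>. L1 1 \<omega> \<partial>M) = 0"
    and "integrable M (\<lambda>\<omega>. (norm (L1 1 \<omega>))\<^sup>2)"
    and "{#lam i. i \<in># mset_set {1..p * CARD('d)}#} = proots (det (poly_entries (ar_poly p A)))"
    and "\<forall>i\<in>{1..p * CARD('d)}. Re (lam i) < 0"
    and "mcarma_process M L (ar_poly p A) (ma_poly q B) Y"
  shows "\<forall>\<Delta>>0. \<exists>(\<Psi> :: (real^'d^'d) poly) (Z :: int \<Rightarrow> 'w \<Rightarrow> real^'d).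
           degree \<Psi> < p * CARD('d) \<and> white_noise M Z \<and>
           (\<forall>n. AE \<omega> in M.
              scalar_filter (filter_poly (p * CARD('d)) lam \<Delta>) (\<lambda>k. Y (of_int k * \<Delta>)) n \<omega>
                = matrix_filter \<Psi> Z n \<omega>)"
proof (intro allI impI)
  fix \<Delta> :: real assume \<Delta>: "\<Delta> > 0"
  interpret prob_space M by fact
  interpret levy: two_sided_sq_levy M L1 L2 L
    by unfold_locales fact+
  define m where "m = p * CARD('d)"
  define \<phi> where "\<phi> = filter_poly m lam \<Delta>"
  have m: "m > 0" using \<open>q < p\<close> by (simp add: m_def)
  obtain g where kernel: "mcarma_kernel (ar_poly p A) (ma_poly q B) g"
    and Y: "\<And>t. has_L2_integral M L (\<lambda>s. indicator {..t} s *\<^sub>R g (t - s)) (Y t)"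
    using assms(8) unfolding mcarma_process_def by blast
  have "AE u in lborel. u > real m * \<Delta> \<longrightarrow> (\<Sum>k\<le>m. coeff \<phi> k * g (u - real k * \<Delta>) $ i $ j) = 0" for i j
    unfolding \<phi>_def m_def
    by (rule mcarma_kernel_filter_zero[OF degree_ar_poly le_less_trans[OF degree_ma_poly \<open>q < p\<close>]
        assms(6,7) kernel \<Delta>])
  from levy.filtered_finitely_correlated[OF Y this \<Delta>]
  interpret X: finitely_correlated M "\<lambda>n i \<omega>. \<Sum>k\<le>m. coeff \<phi> k * Y (of_int (n - int k) * \<Delta>) \<omega> $ i" m .
  obtain z :: "int \<Rightarrow> 'd \<Rightarrow> 'w \<Rightarrow> real" and c where sq: "\<And>n i. sq_integrable M (z n i)" and mean: "\<And>n i. expectation (z n i) = 0"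
    and orth: "\<And>n k i j. n \<noteq> k \<Longrightarrow> expectation (\<lambda>\<omega>. z n i \<omega> * z k j \<omega>) = 0"
    and stat: "\<And>n i j. expectation (\<lambda>\<omega>. z n i \<omega> * z n j \<omega>) = expectation (\<lambda>\<omega>. z 0 i \<omega> * z 0 j \<omega>)"
    and rep: "\<And>n i. AE \<omega> in M. (\<Sum>k\<le>m. coeff \<phi> k * Y (of_int (n - int k) * \<Delta>) \<omega> $ i)
        = (\<Sum>k<m. \<Sum>j\<in>UNIV. c k i j * z (n - int k) j \<omega>)"
    by (rule X.moving_average_representation[OF m]) (rule that)
  define \<Psi> where "\<Psi> = (\<Sum>k<m. monom (\<chi> i j. c k i j) k)"
  define Z where "Z n \<omega> = (\<chi> i. z n i \<omega>)" for n \<omega>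
  have "white_noise M Z"
    unfolding Z_def[abs_def] by (rule white_noise_componentsI[OF sq mean orth stat])
  moreover have "degree \<Psi> < m"
    unfolding \<Psi>_def by (rule matrix_filter_component(1)[OF m])
  moreover have "AE \<omega> in M. scalar_filter \<phi> (\<lambda>k. Y (of_int k * \<Delta>)) n \<omega> = matrix_filter \<Psi> Z n \<omega>" for n
  proof -
    have "AE \<omega> in M. \<forall>i\<in>UNIV. scalar_filter \<phi> (\<lambda>k. Y (of_int k * \<Delta>)) n \<omega> $ i = matrix_filter \<Psi> Z n \<omega> $ i"
    proof (rule AE_finite_allI)
      fix i
      show "AE \<omega> in M. scalar_filter \<phi> (\<lambda>k. Y (of_int k * \<Delta>)) n \<omega> $ i = matrix_filter \<Psi> Z n \<omega> $ i"
        using rep[of n i]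
        unfolding \<Psi>_def matrix_filter_component(2)[OF m] scalar_filter_component[OF degree_filter_poly[of m lam \<Delta>, folded \<phi>_def]]
        by (simp add: Z_def)
    qed simp
    then show ?thesis
      by eventually_elim (simp add: vec_eq_iff)
  qed
  ultimately show "\<exists>(\<Psi> :: (real^'d^'d) poly) (Z :: int \<Rightarrow> 'w \<Rightarrow> real^'d).
           degree \<Psi> < p * CARD('d) \<and> white_noise M Z \<and>
           (\<forall>n. AE \<omega> in M.
              scalar_filter (filter_poly (p * CARD('d)) lam \<Delta>) (\<lambda>k. Y (of_int k * \<Delta>)) n \<omega>
                = matrix_filter \<Psi> Z n \<omega>)"
    unfolding \<phi>_def m_def by blast
qed

end
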